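(* Let $D$ be good, with $r$ distinct prime factors, and assume $\operatorname{sign}(D) = \epsilon_D$. Let $I_D(X)$ be the number of integers $q$ with $|q|\le X$, $Dq$ square-free, such that $\mathbb{Q}(\sqrt{Dq})$ is an imaginary quadratic field over which there exists an elliptic curve with everywhere good reduction and rational $j$-invariant. Then $$I_D(X) \gg \frac{X}{(\log X)^{1-1/2^r}}.$$
   Context: Let $\mathcal{R}=\{A\in\mathbb{Z} : \text{if } 2\mid A \text{ then } 16\mid A \text{ or } 16\mid A-4;\ \text{if } 3\mid A \text{ then } 27\mid A-12\}$. A square-free integer $D$ is called good if there exist $A\in\mathcal{R}$ and $t\in\mathbb{Z}$ with $Dt^2 = A^3-1728$. For good $D$, set $\epsilon_D = 1$ if $D\equiv 1 \pmod 4$ and $\epsilon_D=-1$ otherwise. An elliptic curve $E/K$ has everywhere good reduction if it has good reduction at every prime of $\mathcal{O}_K$. *)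

theory Defs
  imports Complex_Main "HOL-Computational_Algebra.Computational_Algebra"
begin

definition setR :: "int set" where
  "setR = {A. (2 dvd A \<longrightarrow> (16 dvd A \<or> 16 dvd (A - 4))) \<and> (3 dvd A \<longrightarrow> 27 dvd (A - 12))}"

definition good :: "int \<Rightarrow> bool" where
  "good D \<longleftrightarrow> squarefree D \<and> (\<exists>A\<in>setR. \<exists>t::int. D * t^2 = A^3 - 1728)"

definition eps :: "int \<Rightarrow> int" where
  "eps D = (if D mod 4 = 1 then 1 else -1)"

definition quad_field :: "int \<Rightarrow> complex set" where
  "quad_field d = {of_rat a + of_rat b * csqrt (of_int d) | a b. True}"

definition alg_int :: "complex \<Rightarrow> bool" where
  "alg_int x \<longleftrightarrow> (\<exists>p :: int poly. lead_coeff p = 1 \<and> poly (map_poly of_int p) x = 0)"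

definition ring_of_integers :: "complex set \<Rightarrow> complex set" where
  "ring_of_integers K = {x \<in> K. alg_int x}"

definition nonzero_prime_ideal :: "complex set \<Rightarrow> complex set \<Rightarrow> bool" where
  "nonzero_prime_ideal OK P \<longleftrightarrow>
     P \<subseteq> OK \<and> 0 \<in> P \<and> (\<forall>x\<in>P. \<forall>y\<in>P. x + y \<in> P) \<and>
     (\<forall>x\<in>P. \<forall>a\<in>OK. a * x \<in> P) \<and>
     P \<noteq> OK \<and> P \<noteq> {0} \<and>
     (\<forall>x\<in>OK. \<forall>y\<in>OK. x * y \<in> P \<longrightarrow> x \<in> P \<or> y \<in> P)"

definition localization :: "complex set \<Rightarrow> complex set \<Rightarrow> complex set" where
  "localization OK P = {a / b | a b. a \<in> OK \<and> b \<in> OK \<and> b \<notin> P}"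

text \<open>A Weierstrass equation y^2 + a1 xy + a3 y = x^3 + a2 x^2 + a4 x + a6,
  given by its coefficient tuple (a1, a2, a3, a4, a6).\<close>
type_synonym weq = "complex \<times> complex \<times> complex \<times> complex \<times> complex"

fun disc :: "weq \<Rightarrow> complex" where
  "disc (a1, a2, a3, a4, a6) =
     (let b2 = a1^2 + 4*a2; b4 = 2*a4 + a1*a3; b6 = a3^2 + 4*a6;
          b8 = a1^2*a6 + 4*a2*a6 - a1*a3*a4 + a2*a3^2 - a4^2
      in 9*b2*b4*b6 - b2^2*b8 - 8*b4^3 - 27*b6^2)"

fun c4 :: "weq \<Rightarrow> complex" where
  "c4 (a1, a2, a3, a4, a6) =
     (let b2 = a1^2 + 4*a2; b4 = 2*a4 + a1*a3 in b2^2 - 24*b4)"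

definition j_inv :: "weq \<Rightarrow> complex" where
  "j_inv E = c4 E ^ 3 / disc E"

definition coeffs_in :: "weq \<Rightarrow> complex set \<Rightarrow> bool" where
  "coeffs_in E S \<longleftrightarrow> (case E of (a1, a2, a3, a4, a6) \<Rightarrow>
      a1 \<in> S \<and> a2 \<in> S \<and> a3 \<in> S \<and> a4 \<in> S \<and> a6 \<in> S)"

definition ell_curve_over :: "complex set \<Rightarrow> weq \<Rightarrow> bool" where
  "ell_curve_over K E \<longleftrightarrow> coeffs_in E K \<and> disc E \<noteq> 0"

text \<open>Standard change of variables x = u^2 x' + r, y = u^3 y' + s u^2 x' + t
  (Silverman, Table 3.1).\<close>
fun change_coords :: "complex \<Rightarrow> complex \<Rightarrow> complex \<Rightarrow> complex \<Rightarrow> weq \<Rightarrow> weq" where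
  "change_coords u r s t (a1, a2, a3, a4, a6) =
     ((a1 + 2*s) / u,
      (a2 - s*a1 + 3*r - s^2) / u^2,
      (a3 + r*a1 + 2*t) / u^3,
      (a4 - s*a3 + 2*r*a2 - (t + r*s)*a1 + 3*r^2 - 2*s*t) / u^4,
      (a6 + r*a4 + r^2*a2 + r^3 - t*a3 - t^2 - r*t*a1) / u^6)"

definition good_reduction_at :: "complex set \<Rightarrow> complex set \<Rightarrow> weq \<Rightarrow> bool" where
  "good_reduction_at K P E \<longleftrightarrow>
     (\<exists>u\<in>K. \<exists>r\<in>K. \<exists>s\<in>K. \<exists>t\<in>K. u \<noteq> 0 \<and>
        (let E' = change_coords u r s t E;
             R = localization (ring_of_integers K) P
         in coeffs_in E' R \<and> disc E' \<in> R \<and> inverse (disc E') \<in> R))"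

definition everywhere_good_reduction :: "complex set \<Rightarrow> weq \<Rightarrow> bool" where
  "everywhere_good_reduction K E \<longleftrightarrow>
     (\<forall>P. nonzero_prime_ideal (ring_of_integers K) P \<longrightarrow> good_reduction_at K P E)"

definition I_count :: "int \<Rightarrow> real \<Rightarrow> nat" where
  "I_count D X = card {q::int. real_of_int \<bar>q\<bar> \<le> X \<and> squarefree (D * q) \<and> D * q < 0 \<and>
      (\<exists>E. ell_curve_over (quad_field (D * q)) E \<and>
           everywhere_good_reduction (quad_field (D * q)) E \<and>
           j_inv E \<in> \<rat>)}"

end

theory Submission
  imports Defs "HOL-Number_Theory.Number_Theory"
begin

text \<open>
  Put \<open>N = \<bar>D\<bar>\<close> and \<open>\<epsilon> D = N\<close>, and take \<open>q = - sgn D * n\<close> with \<open>n > 0\<close>, so that the field is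
  \<open>K = \<rat>(\<theta>)\<close> with \<open>\<theta>\<^sup>2 = - N n\<close>. From an integral zero of \<open>N x\<^sup>2 + n y\<^sup>2 = z\<^sup>2\<close> form
  \<open>\<beta> = N x + y \<theta>\<close>, of norm \<open>N z\<^sup>2\<close>, and \<open>\<gamma> = \<beta>\<^sup>2 / N\<close>, of norm \<open>z\<^sup>4\<close>. If \<open>D t\<^sup>2 = A\<^sup>3 - 1728\<close>, the
  curve with \<open>c\<^sub>4 = \<epsilon> A \<gamma>\<close> and \<open>c\<^sub>6 = t \<gamma> \<beta>\<close> has discriminant \<open>\<epsilon> \<gamma>\<^sup>3\<close> and \<open>j = A\<^sup>3\<close>. Away from 2 the
  ideal \<open>(\<gamma>)\<close> is a fourth power, hence the discriminant is locally a twelfth power; at 2 and 3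
  the conditions defining \<open>\<R>\<close> yield integral models, provided that \<open>n\<close> is 3 modulo 4 (\<open>N\<close> odd)
  or \<open>1 - N\<close> modulo 8 (\<open>N\<close> even).

  By Legendre's theorem the conic has a zero as soon as \<open>N\<close> is a square modulo the primes of \<open>n\<close>
  and \<open>n\<close> is a square modulo the primes of \<open>N\<close>. The first condition selects the primes on which a
  single quadratic character is 1; as \<open>L(1, \<chi>) \<noteq> 0\<close>, Mertens' theorem holds for them with density
  1/2 (density 1 if \<open>N = 1\<close>), which suffices because \<open>1 - 1 / 2\<^sup>r \<ge> 1/2\<close> for \<open>r \<ge> 1\<close>. The count of
  squarefree products of such primes follows by comparing \<open>\<Sum> ln n\<close> over them with \<open>\<Sum> 1 / n\<close>. The
  remaining conditions only depend on \<open>n\<close> modulo \<open>8 N\<close>, and a fixed multiplier for each residue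
  class moves \<open>n\<close> into the required class.
\<close>

section \<open>Legendre's theorem on ternary forms\<close>

text \<open>Over K(sqrt D) the curve with c4 = A and c6 = t sqrt D has discriminant 1, because A^3 -
  D t^2 = 1728, but it is not defined over K. Twisting by d = \<epsilon> \<beta> / sqrt D multiplies
  c4 by d^2 and c6 by d^3. The results lie in K and are exactly \<epsilon> A \<gamma> and t \<gamma>
  \<beta>. The danger of a twist is new bad reduction at the primes dividing \<beta>. The conic
  prevents this: away from 2 the ideal (\<beta>) is the square of an ideal times the ramified ideal
  whose square is (N). So solubility of the conic is the condition for a harmless twist to exist.
  The sign condition identifies \<epsilon> D with |D|, so that the field is imaginary while the
  conic, having positive coefficients N and n, has real points. The number N^2 + N + 1 meets three
  local demands at once: it is 1 modulo N, it lies in the class wanted at 2, and N is a square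
  modulo each of its primes. Hence all residue classes are taken relative to it.\<close>

lemma squarefree_mult_imp_coprime:
  fixes a b :: "'a :: semiring_gcd"
  assumes "squarefree (a * b)"
  shows "coprime a b"
proof (rule coprimeI)
  fix c assume "c dvd a" "c dvd b"
  hence "c\<^sup>2 dvd a * b" unfolding power2_eq_square by (rule mult_dvd_mono)
  thus "is_unit c" using assms squarefreeD by blast
qed

lemma squarefree_int_iff: "squarefree (int n) \<longleftrightarrow> squarefree n"
proof
  assume *: "squarefree (int n)"
  show "squarefree n"
  proof (rule squarefreeI)
    fix x assume "x\<^sup>2 dvd n"
    hence "(int x)\<^sup>2 dvd int n" by (metis int_dvd_int_iff of_nat_power)
    hence "is_unit (int x)" using * squarefreeD by blast
    thus "is_unit x" by simp
  qed
next
  assume *: "squarefree n"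
  show "squarefree (int n)"
  proof (rule squarefreeI)
    fix x :: int assume "x\<^sup>2 dvd int n"
    hence "int ((nat \<bar>x\<bar>)\<^sup>2) dvd int n" by simp
    hence "(nat \<bar>x\<bar>)\<^sup>2 dvd n" by (simp only: int_dvd_int_iff)
    hence "is_unit (nat \<bar>x\<bar>)" using * squarefreeD by blast
    thus "is_unit x" by auto
  qed
qed

lemma square_mod_squarefree:
  fixes a :: int and k :: nat
  assumes "squarefree k" "\<And>p. prime p \<Longrightarrow> p dvd k \<Longrightarrow> \<exists>s. [s\<^sup>2 = a] (mod int p)"
  shows "\<exists>s. [s\<^sup>2 = a] (mod int k)"
  using assms
proof (induction k rule: less_induct)
  case (less k)
  have "k \<noteq> 0" using less.prems(1) not_squarefree_0 by metis
  show ?case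
  proof (cases "k = 1")
    case False
    then obtain p where p: "prime p" "p dvd k" using prime_factor_nat by blast
    then obtain l where l: "k = p * l" by blast
    have "coprime p l"
      using less.prems(1) unfolding l by (rule squarefree_mult_imp_coprime)
    have "l < k" using l p(1) \<open>k \<noteq> 0\<close> prime_gt_1_nat by auto
    moreover have "squarefree l" using less.prems(1) l squarefree_mono by (metis dvd_triv_right)
    ultimately obtain s where s: "[s\<^sup>2 = a] (mod int l)"
      using less.IH[of l] less.prems(2) l by auto
    obtain r where r: "[r\<^sup>2 = a] (mod int p)" using less.prems(2) p by blast
    obtain q where q: "[q = r] (mod int p)" "[q = s] (mod int l)"
      using binary_chinese_remainder_int[of "int p" "int l" r s] \<open>coprime p l\<close> by auto
    have "[q\<^sup>2 = a] (mod int p)" "[q\<^sup>2 = a] (mod int l)"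
      using cong_trans[OF cong_pow[OF q(1)] r] cong_trans[OF cong_pow[OF q(2)] s] by auto
    hence "[q\<^sup>2 = a] (mod (int p * int l))"
      using \<open>coprime p l\<close> by (auto intro: coprime_cong_mult)
    thus ?thesis unfolding l by auto
  qed auto
qed

lemma square_bracket: obtains k :: nat where "k\<^sup>2 \<le> n" "n < (k + 1)\<^sup>2"
proof -
  define k where "k = (GREATEST k. k\<^sup>2 \<le> n)"
  have b: "\<And>y. y\<^sup>2 \<le> n \<Longrightarrow> y \<le> n" by (meson le_trans power2_nat_le_imp_le)
  have "k\<^sup>2 \<le> n" unfolding k_def by (rule GreatestI_nat[of _ 0 n]) (use b in auto)
  moreover have "n < (k + 1)\<^sup>2"
  proof (rule ccontr)
    assume "\<not> n < (k + 1)\<^sup>2"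
    hence "k + 1 \<le> k" unfolding k_def by (intro Greatest_le_nat[of _ _ n]) (use b in auto)
    thus False by simp
  qed
  ultimately show ?thesis using that by blast
qed

lemma squarefree_not_square:
  fixes w :: int
  assumes "squarefree k" "k = w\<^sup>2" "k > 1"
  shows False
proof -
  have "is_unit w" by (rule squarefreeD[OF assms(1)]) (simp add: assms(2))
  hence "\<bar>w\<bar> = 1" by simp
  hence "w\<^sup>2 = 1" by (metis power2_abs power_one)
  thus False using assms(2,3) by simp
qed

text \<open>Legendre's theorem for \<open>z\<^sup>2 = N x\<^sup>2 + n y\<^sup>2\<close>. The pigeonhole principle gives a small nonzero
  triple for which \<open>z\<^sup>2 - N x\<^sup>2 - n y\<^sup>2\<close> is divisible by \<open>N n\<close>, hence is \<open>0\<close> or \<open>- N n\<close>; in the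
  second case composition turns the triple into a zero of the form.\<close>

lemma legendre_ternary:
  fixes N n :: nat
  assumes sf: "squarefree (N * n)"
    and N: "\<And>p. prime p \<Longrightarrow> p dvd n \<Longrightarrow> \<exists>s. [s\<^sup>2 = int N] (mod int p)"
    and n: "\<And>p. prime p \<Longrightarrow> p dvd N \<Longrightarrow> \<exists>s. [s\<^sup>2 = int n] (mod int p)"
  shows "\<exists>x y z. z \<noteq> 0 \<and> int N * x\<^sup>2 + int n * y\<^sup>2 = z\<^sup>2"
proof (cases "n = 1")
  case True
  thus ?thesis by (intro exI[of _ 0] exI[of _ 1]) auto
next
  \<comment> \<open>Excluding n = 1 makes n and N n non-squares, which rules out i = -2 and i = 1
    below.\<close>
  case False
  have "N \<noteq> 0" "n \<noteq> 0" using sf not_squarefree_0 by (metis mult_zero_left, metis mult_zero_right)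
  have cop: "coprime N n" using sf by (rule squarefree_mult_imp_coprime)
  have sfn: "squarefree n" "squarefree N" using sf squarefree_multD by blast+
  obtain s where s: "[s\<^sup>2 = int N] (mod int n)" using square_mod_squarefree[OF sfn(1) N] by blast
  obtain s' where s': "[s'\<^sup>2 = int n] (mod int N)" using square_mod_squarefree[OF sfn(2) n] by blast
  obtain k1 where k1: "k1\<^sup>2 \<le> n" "n < (k1 + 1)\<^sup>2" by (rule square_bracket)
  obtain k2 where k2: "k2\<^sup>2 \<le> N" "N < (k2 + 1)\<^sup>2" by (rule square_bracket)
  obtain k3 where k3: "k3\<^sup>2 \<le> N * n" "N * n < (k3 + 1)\<^sup>2" by (rule square_bracket)
  \<comment> \<open>The square of the number of points of this box exceeds n * N * (N n) = (n N)^2,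
    so two points agree under \<open>f\<close>, which takes at most n N values. All coordinates
    start at 0, so differences obey the same bounds.\<close>
  define S where "S = {0..int k1} \<times> {0..int k2} \<times> {0..int k3}"
  define f where "f = (\<lambda>(x, y, z). ((z - s * x) mod int n, (z - s' * y) mod int N))"
  have "\<not> inj_on f S"
  proof
    assume "inj_on f S"
    moreover have "f ` S \<subseteq> {0..<int n} \<times> {0..<int N}"
      using \<open>N \<noteq> 0\<close> \<open>n \<noteq> 0\<close> by (auto simp: f_def)
    ultimately have "card S \<le> card ({0..<int n} \<times> {0..<int N})"
      by (intro card_inj_on_le) auto
    hence "(k1 + 1) * (k2 + 1) * (k3 + 1) \<le> n * N"
      by (simp add: S_def card_cartesian_product nat_add_distrib algebra_simps)
    hence "((k1 + 1) * (k2 + 1) * (k3 + 1))\<^sup>2 \<le> (n * N)\<^sup>2" by (rule power_mono) simp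
    moreover have "n * N * (N * n) < (k1 + 1)\<^sup>2 * (k2 + 1)\<^sup>2 * (k3 + 1)\<^sup>2"
      using k1 k2 k3 by (intro mult_strict_mono) auto
    moreover have "n * N * (N * n) = (n * N)\<^sup>2" by (simp add: power2_eq_square)
    ultimately show False unfolding power_mult_distrib[of "(k1 + 1) * (k2 + 1)"]
      power_mult_distrib[of "k1 + 1"] by linarith
  qed
  then obtain x1 y1 z1 x2 y2 z2 where p: "(x1, y1, z1) \<in> S" "(x2, y2, z2) \<in> S"
    "(x1, y1, z1) \<noteq> (x2, y2, z2)" "f (x1, y1, z1) = f (x2, y2, z2)"
    unfolding inj_on_def by (metis prod_cases3)
  define x y z where "x = x1 - x2" and "y = y1 - y2" and "z = z1 - z2"
  have nz: "x \<noteq> 0 \<or> y \<noteq> 0 \<or> z \<noteq> 0" using p(3) by (auto simp: x_def y_def z_def)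
  have bnd: "\<bar>x\<bar> \<le> int k1" "\<bar>y\<bar> \<le> int k2" "\<bar>z\<bar> \<le> int k3"
    using p(1,2) by (auto simp: S_def x_def y_def z_def)
  have sq: "x\<^sup>2 \<le> int n" "y\<^sup>2 \<le> int N" "z\<^sup>2 \<le> int N * int n"
  proof -
    have aux: "w\<^sup>2 \<le> int l" if "\<bar>w\<bar> \<le> int k" "k\<^sup>2 \<le> l" for w k l
    proof -
      have "\<bar>w\<bar>\<^sup>2 \<le> (int k)\<^sup>2" using that(1) by (intro power_mono) auto
      also have "\<dots> \<le> int l" using that(2) by (metis of_nat_le_iff of_nat_power)
      finally show ?thesis by simp
    qed
    show "x\<^sup>2 \<le> int n" "y\<^sup>2 \<le> int N" "z\<^sup>2 \<le> int N * int n"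
      using aux[OF bnd(1) k1(1)] aux[OF bnd(2) k2(1)] aux[OF bnd(3) k3(1)] by auto
  qed
  have "[z1 - s * x1 = z2 - s * x2] (mod int n)" "[z1 - s' * y1 = z2 - s' * y2] (mod int N)"
    using p(4) by (auto simp: f_def cong_def)
  hence c: "[z = s * x] (mod int n)" "[z = s' * y] (mod int N)"
    by (auto simp: cong_iff_dvd_diff x_def y_def z_def algebra_simps)
  define Q where "Q = z\<^sup>2 - int N * x\<^sup>2 - int n * y\<^sup>2"
  have "[z\<^sup>2 = int N * x\<^sup>2] (mod int n)"
    using cong_trans[OF cong_pow[OF c(1), of 2]] cong_mult[OF s cong_refl[of "x\<^sup>2"]]
    by (simp add: power_mult_distrib)
  hence "int n dvd Q" unfolding Q_def cong_iff_dvd_diff by (simp add: dvd_diff)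
  moreover have "[z\<^sup>2 = int n * y\<^sup>2] (mod int N)"
    using cong_trans[OF cong_pow[OF c(2), of 2]] cong_mult[OF s' cong_refl[of "y\<^sup>2"]]
    by (simp add: power_mult_distrib)
  hence "int N dvd (z\<^sup>2 - int n * y\<^sup>2) - int N * x\<^sup>2" unfolding cong_iff_dvd_diff by (simp add: dvd_diff)
  hence "int N dvd Q" by (simp add: Q_def algebra_simps)
  ultimately have "int N * int n dvd Q" using cop by (simp add: divides_mult)
  then obtain i where i: "Q = int N * int n * i" by blast
  have Nn: "int N * int n > 0" using \<open>N \<noteq> 0\<close> \<open>n \<noteq> 0\<close> by simp
  have xN: "int N * x\<^sup>2 \<le> int N * int n" "int n * y\<^sup>2 \<le> int N * int n"
    using mult_left_mono[OF sq(1), of "int N"] mult_left_mono[OF sq(2), of "int n"]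
    by (auto simp: mult.commute)
  have pos: "0 \<le> int N * x\<^sup>2" "0 \<le> int n * y\<^sup>2" by auto
  have "Q \<le> int N * int n" using sq(3) pos unfolding Q_def by linarith
  moreover have "Q \<ge> - 2 * (int N * int n)"
    using xN zero_le_power2[of z] unfolding Q_def by linarith
  ultimately have "int N * int n * i \<le> int N * int n * 1" "int N * int n * (- 2) \<le> int N * int n * i"
    using i by auto
  hence "i \<le> 1" "- 2 \<le> i" using Nn by (simp_all only: mult_le_cancel_left_pos)
  \<comment> \<open>i = 1 leaves no room for x and y, so z^2 = N n, although N n > 1 is
    squarefree.\<close>
  moreover have "i \<noteq> 1"
  proof
    assume "i = 1"
    hence "Q = int N * int n" using i by simp
    hence "z\<^sup>2 = int N * int n" using sq(3) pos unfolding Q_def by linarith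
    moreover have "squarefree (int (N * n))" using sf by (simp only: squarefree_int_iff)
    moreover have "N * n > 1" using False \<open>N \<noteq> 0\<close> \<open>n \<noteq> 0\<close>
      by (metis One_nat_def Suc_lessI mult_eq_1_iff nat_0_less_mult_iff neq0_conv)
    hence "int (N * n) > 1" by linarith
    ultimately show False using squarefree_not_square[of "int (N * n)" z] by simp
  qed
  \<comment> \<open>i = -2 forces every bound to be attained, in particular x^2 = n, although n > 1
    is squarefree.\<close>
  moreover have "i \<noteq> - 2"
  proof
    assume "i = - 2"
    hence "Q = - 2 * (int N * int n)" using i by simp
    hence "int N * x\<^sup>2 = int N * int n"
      using xN zero_le_power2[of z] unfolding Q_def by linarith
    hence "int n = x\<^sup>2" using \<open>N \<noteq> 0\<close> by simp
    moreover have "squarefree (int n)" using sfn by (simp only: squarefree_int_iff)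
    ultimately show False using squarefree_not_square[of "int n" x] False \<open>n \<noteq> 0\<close> by simp
  qed
  ultimately consider "i = 0" | "i = - 1" by linarith
  thus ?thesis
  proof cases
    case 1
    hence eq: "int N * x\<^sup>2 + int n * y\<^sup>2 = z\<^sup>2" using i unfolding Q_def by simp
    have "z \<noteq> 0"
    proof
      assume "z = 0"
      hence "int N * x\<^sup>2 + int n * y\<^sup>2 = 0" using eq by simp
      hence "int N * x\<^sup>2 = 0" "int n * y\<^sup>2 = 0" using pos by linarith+
      thus False using \<open>N \<noteq> 0\<close> \<open>n \<noteq> 0\<close> nz \<open>z = 0\<close> by auto
    qed
    with eq show ?thesis by blast
  next
    case 2
    hence eq: "int N * x\<^sup>2 + int n * y\<^sup>2 = z\<^sup>2 + int N * int n" using i unfolding Q_def by simp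
    \<comment> \<open>Norms in Q(\<theta>) with \<theta>^2 = -N n: the product (N x + y \<theta>) (z
      - \<theta>) is N (x z + n y) + (y z - N x) \<theta>, and z - \<theta> has norm z^2 + N
      n.\<close>
    have "int N * (x * z + int n * y)\<^sup>2 + int n * (y * z - int N * x)\<^sup>2
        = (z\<^sup>2 + int N * int n) * (int N * x\<^sup>2 + int n * y\<^sup>2)"
      by (simp add: power2_eq_square algebra_simps)
    hence "int N * (x * z + int n * y)\<^sup>2 + int n * (y * z - int N * x)\<^sup>2 = (z\<^sup>2 + int N * int n)\<^sup>2"
      unfolding eq by (simp add: power2_eq_square)
    moreover have "z\<^sup>2 + int N * int n \<noteq> 0" using Nn by (smt (verit) zero_le_power2)
    ultimately show ?thesis by blast
  qed
qed

text \<open>Only gcd x y has to be removed, since it divides z as well. The factor g is recorded so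
  that an odd z leads to an odd z'.\<close>

lemma conic_primitive:
  fixes N n x y z :: int
  assumes "N * x\<^sup>2 + n * y\<^sup>2 = z\<^sup>2" "z \<noteq> 0"
  obtains g x' y' z' where "coprime x' y'" "N * x'\<^sup>2 + n * y'\<^sup>2 = z'\<^sup>2" "z = g * z'"
proof -
  have g: "gcd x y \<noteq> 0" using assms by auto
  obtain x' y' where xy: "x = x' * gcd x y" "y = y' * gcd x y" "coprime x' y'"
    using gcd_coprime_exists[OF g] by blast
  have z2: "z\<^sup>2 = (gcd x y)\<^sup>2 * (N * x'\<^sup>2 + n * y'\<^sup>2)"
  proof -
    have "N * (x' * d)\<^sup>2 + n * (y' * d)\<^sup>2 = d\<^sup>2 * (N * x'\<^sup>2 + n * y'\<^sup>2)" for d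
      by (simp add: power_mult_distrib algebra_simps)
    thus ?thesis using assms(1) xy(1,2) by metis
  qed
  hence "(gcd x y)\<^sup>2 dvd z\<^sup>2" by simp
  hence "gcd x y dvd z" by (simp add: pow_divides_pow_iff)
  then obtain z' where z': "z = gcd x y * z'" by blast
  hence "(gcd x y)\<^sup>2 * z'\<^sup>2 = (gcd x y)\<^sup>2 * (N * x'\<^sup>2 + n * y'\<^sup>2)"
    using z2 by (metis power_mult_distrib)
  hence "N * x'\<^sup>2 + n * y'\<^sup>2 = z'\<^sup>2" using g by auto
  thus ?thesis using that xy(3) z' by blast
qed

text \<open>A prime p dividing z and N x yields p^2 dvd n if p dvd x, and p^2 dvd N otherwise; both
  contradict squarefreeness.\<close>

lemma conic_coprime:
  fixes N n x y z :: int
  assumes "N * x\<^sup>2 + n * y\<^sup>2 = z\<^sup>2" "coprime x y" "squarefree (N * n)"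
  shows "coprime z (N * x)"
proof (rule ccontr)
  have cop: "coprime N n" using assms(3) by (rule squarefree_mult_imp_coprime)
  have sf: "squarefree N" "squarefree n" using assms(3) squarefree_multD by blast+
  assume "\<not> coprime z (N * x)"
  then obtain p where p: "prime p" "p dvd z" "p dvd N * x"
  proof (cases "gcd z (N * x) = 0")
    case True
    \<comment> \<open>Both numbers vanish here, so any prime serves.\<close>
    thus ?thesis using that[of 2] by auto
  next
    case False
    moreover have "\<not> is_unit (gcd z (N * x))" using \<open>\<not> coprime z (N * x)\<close> by auto
    ultimately obtain p where "prime p" "p dvd gcd z (N * x)" using prime_divisor_exists by blast
    thus ?thesis using that by simp
  qed
  have z2: "p\<^sup>2 dvd z\<^sup>2" using p(2) by simp
  show False
  proof (cases "p dvd x")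
    case True
    have "n * y\<^sup>2 = z\<^sup>2 - N * x\<^sup>2" using assms(1) by simp
    moreover have "p\<^sup>2 dvd z\<^sup>2 - N * x\<^sup>2" using z2 True by (intro dvd_diff dvd_mult) auto
    ultimately have "p\<^sup>2 dvd n * y\<^sup>2" by simp
    moreover have "coprime (p\<^sup>2) (y\<^sup>2)"
      using True assms(2) p(1) by (meson coprime_common_divisor coprime_power_left_iff
          coprime_power_right_iff not_prime_unit prime_imp_coprime)
    ultimately have "p\<^sup>2 dvd n" by (simp add: coprime_dvd_mult_left_iff)
    thus False using sf(2) p(1) squarefreeD not_prime_unit by blast
  next
    case False
    hence "p dvd N" using p prime_dvd_mult_iff by blast
    hence "p dvd z\<^sup>2 - N * x\<^sup>2" using p(2) by (intro dvd_diff) (auto simp: power2_eq_square)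
    hence "p dvd n * y\<^sup>2" using assms(1) by (metis add_diff_cancel_left')
    moreover have "\<not> p dvd n" using \<open>p dvd N\<close> cop p(1) coprime_common_divisor not_prime_unit by blast
    ultimately have "p dvd y" using p(1) prime_dvd_mult_iff prime_dvd_power by blast
    hence "p\<^sup>2 dvd z\<^sup>2 - n * y\<^sup>2" using z2 by (intro dvd_diff dvd_mult) auto
    moreover have "z\<^sup>2 - n * y\<^sup>2 = N * x\<^sup>2" using assms(1) by simp
    ultimately have "p\<^sup>2 dvd N * x\<^sup>2" by simp
    moreover have "coprime (p\<^sup>2) (x\<^sup>2)" using False p(1) by (simp add: prime_imp_coprime)
    ultimately have "p\<^sup>2 dvd N" by (simp add: coprime_dvd_mult_left_iff)
    thus False using sf(1) p(1) squarefreeD not_prime_unit by blast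
  qed
qed

text \<open>If \<open>z\<close> is even, reflecting the solution in the vector \<open>(1, 0, 1)\<close> makes it odd.\<close>

lemma conic_odd_solution:
  fixes N n x y z :: int
  assumes sf: "squarefree (N * n)" and "odd n" "N * x\<^sup>2 + n * y\<^sup>2 = z\<^sup>2" "z \<noteq> 0"
  obtains x' y' z' where "N * x'\<^sup>2 + n * y'\<^sup>2 = z'\<^sup>2" "coprime z' (2 * N * x')" "z' \<noteq> 0"
proof -
  note solves = that
  have *: thesis if eq: "N * x\<^sup>2 + n * y\<^sup>2 = z\<^sup>2" and "odd z" for x y z
  proof -
    have "z \<noteq> 0" using that by auto
    then obtain g x' y' z' where c: "coprime x' y'" "N * x'\<^sup>2 + n * y'\<^sup>2 = z'\<^sup>2" "z = g * z'"
      using conic_primitive[OF eq] by metis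
    have "odd z'" using c(3) \<open>odd z\<close> by simp
    have "coprime z' (N * x')" by (rule conic_coprime[OF c(2,1) sf])
    hence "coprime z' (2 * N * x')" using \<open>odd z'\<close> by (simp add: mult.assoc)
    moreover have "z' \<noteq> 0" using \<open>odd z'\<close> by auto
    ultimately show thesis using solves[OF c(2)] by blast
  qed
  obtain g u v w where c: "coprime u v" "N * u\<^sup>2 + n * v\<^sup>2 = w\<^sup>2" "z = g * w"
    using conic_primitive[OF assms(3,4)] by metis
  show thesis
  proof (cases "odd w")
    case True
    thus ?thesis using * c(2) by blast
  next
    case False
    have "coprime w (N * u)" by (rule conic_coprime[OF c(2,1) sf])
    hence "odd (N * u)" using False by (meson coprime_common_divisor odd_one)
    then obtain j where j: "N = 2 * j + 1" by (auto elim: oddE)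
    have "odd u" using \<open>odd (N * u)\<close> by simp
    \<comment> \<open>For the form N X^2 + n Y^2 - Z^2 the vector (1, 0, 1) has value N - 1 = 2 j
      and its bilinear product with (u, v, w) is l. Cleared of the denominator j, the reflected
      point is (j u - l, j v, j w - l). Its last entry is odd because w is even and l is
      odd.\<close>
    define l where "l = N * u - w"
    have "odd l" using \<open>odd (N * u)\<close> False by (simp add: l_def)
    have "N * (j * u - l)\<^sup>2 + n * (j * v)\<^sup>2 - (j * w - l)\<^sup>2
        = j\<^sup>2 * (N * u\<^sup>2 + n * v\<^sup>2 - w\<^sup>2) - l * (2 * j * (N * u - w) - (N - 1) * l)"
      by (simp add: power2_eq_square algebra_simps)
    also have "\<dots> = 0" using c(2) unfolding l_def j by simp
    finally have "N * (j * u - l)\<^sup>2 + n * (j * v)\<^sup>2 = (j * w - l)\<^sup>2" by simp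
    moreover have "odd (j * w - l)" using False \<open>odd l\<close> by simp
    ultimately show ?thesis using * by blast
  qed
qed

section \<open>Quadratic fields and localizations\<close>

lemma quad_field_iff:
  "w \<in> quad_field m \<longleftrightarrow> (\<exists>a b. w = of_rat a + of_rat b * csqrt (of_int m))"
  by (auto simp: quad_field_def)

lemma of_rat_in_quad_field [intro]: "of_rat a \<in> quad_field m"
  unfolding quad_field_iff by (rule exI[of _ a], rule exI[of _ 0]) simp

lemma of_int_in_quad_field [intro]: "of_int k \<in> quad_field m"
  using of_rat_in_quad_field[of "of_int k" m] by simp

lemma csqrt_in_quad_field [intro]: "csqrt (of_int m) \<in> quad_field m"
  unfolding quad_field_iff by (rule exI[of _ 0], rule exI[of _ 1]) simp

lemma quad_field_add [intro]:
  assumes "v \<in> quad_field m" "w \<in> quad_field m"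
  shows "v + w \<in> quad_field m"
proof -
  obtain a b where v: "v = of_rat a + of_rat b * csqrt (of_int m)"
    using assms(1) unfolding quad_field_iff by blast
  obtain c d where w: "w = of_rat c + of_rat d * csqrt (of_int m)"
    using assms(2) unfolding quad_field_iff by blast
  have "v + w = of_rat (a + c) + of_rat (b + d) * csqrt (of_int m)"
    by (simp add: v w of_rat_add algebra_simps)
  thus ?thesis unfolding quad_field_iff by blast
qed

lemma quad_field_mult [intro]:
  assumes "v \<in> quad_field m" "w \<in> quad_field m"
  shows "v * w \<in> quad_field m"
proof -
  obtain a b where v: "v = of_rat a + of_rat b * csqrt (of_int m)"
    using assms(1) unfolding quad_field_iff by blast
  obtain c d where w: "w = of_rat c + of_rat d * csqrt (of_int m)"
    using assms(2) unfolding quad_field_iff by blast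
  have "v * w = of_rat (a * c + b * d * of_int m) + of_rat (a * d + b * c) * csqrt (of_int m)"
    using power2_csqrt[of "of_int m"]
    by (simp add: v w of_rat_add of_rat_mult algebra_simps power2_eq_square)
  thus ?thesis unfolding quad_field_iff by blast
qed

lemma quad_field_power [intro]: "w \<in> quad_field m \<Longrightarrow> w ^ k \<in> quad_field m"
  by (induction k) (auto simp: of_int_in_quad_field[of 1 m, simplified])

lemma quad_field_numeral [simp, intro]:
  "0 \<in> quad_field m" "1 \<in> quad_field m" "numeral k \<in> quad_field m"
  using of_int_in_quad_field[of 0 m] of_int_in_quad_field[of 1 m]
    of_int_in_quad_field[of "numeral k" m] by auto

lemma quad_field_uminus [intro]: "w \<in> quad_field m \<Longrightarrow> - w \<in> quad_field m"
  using quad_field_mult[OF of_int_in_quad_field[of "-1" m], of w] by simp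

lemma quad_field_divide_int [intro]:
  assumes "w \<in> quad_field m" shows "w / of_int k \<in> quad_field m"
proof -
  have "w / of_int k = w * of_rat (1 / of_int k)"
    by (simp add: of_rat_divide)
  thus ?thesis using assms by auto
qed

lemma quad_field_divide_numeral [intro]:
  assumes "w \<in> quad_field m" shows "w / numeral k \<in> quad_field m"
  using quad_field_divide_int[OF assms, of "numeral k"] by simp

lemma alg_int_quadratic:
  assumes "w ^ 2 = of_int c * w + of_int d"
  shows "alg_int w"
proof -
  have "poly (map_poly of_int [:- d, - c, 1:]) w = 0"
    using assms by (simp add: map_poly_pCons algebra_simps power2_eq_square)
  moreover have "lead_coeff [:- d, - c, 1:] = 1" by simp
  ultimately show ?thesis unfolding alg_int_def by blast
qed

text \<open>An explicit subring of the ring of integers takes the place of the latter, so that all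
  integrality checks become checks on two integer coordinates.\<close>

locale quad_order =
  fixes m :: int and T :: "complex set"
  assumes of_int_T [simp, intro]: "\<And>k. of_int k \<in> T"
    and T_add [intro]: "\<And>v w. v \<in> T \<Longrightarrow> w \<in> T \<Longrightarrow> v + w \<in> T"
    and T_mult [intro]: "\<And>v w. v \<in> T \<Longrightarrow> w \<in> T \<Longrightarrow> v * w \<in> T"
    and T_subset: "T \<subseteq> ring_of_integers (quad_field m)"
    and csqrt_T: "csqrt (of_int m) \<in> T"
begin

lemma T_numeral [simp, intro]: "0 \<in> T" "1 \<in> T" "numeral k \<in> T"
  using of_int_T[of 0] of_int_T[of 1] of_int_T[of "numeral k"] by auto

lemma T_power [intro]: "w \<in> T \<Longrightarrow> w ^ k \<in> T"
  by (induction k) auto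

lemma T_quad_field: "w \<in> T \<Longrightarrow> w \<in> quad_field m"
  using T_subset by (auto simp: ring_of_integers_def)

end

lemma quad_order_generated:
  assumes w: "w \<in> quad_field m" "w ^ 2 = of_int c * w + of_int d"
    and s: "csqrt (of_int m) = of_int k + of_int l * w"
  shows "quad_order m {of_int a + of_int b * w | a b. True}"
proof
  let ?T = "{of_int a + of_int b * w | a b. True}"
  have TI: "of_int a + of_int b * w \<in> ?T" for a b by blast
  show "of_int k \<in> ?T" for k using TI[of k 0] by simp
  show "csqrt (of_int m) \<in> ?T" using TI[of k l] s by simp
  show "u + v \<in> ?T" if uv: "u \<in> ?T" "v \<in> ?T" for u v
  proof -
    obtain a b a' b' where "u = of_int a + of_int b * w" "v = of_int a' + of_int b' * w"
      using uv by blast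
    hence "u + v = of_int (a + a') + of_int (b + b') * w" by (simp add: algebra_simps)
    thus ?thesis using TI by metis
  qed
  show "u * v \<in> ?T" if uv: "u \<in> ?T" "v \<in> ?T" for u v
  proof -
    obtain a b a' b' where "u = of_int a + of_int b * w" "v = of_int a' + of_int b' * w"
      using uv by blast
    hence "u * v = of_int a * of_int a' + (of_int a * of_int b' + of_int b * of_int a') * w
                   + of_int b * of_int b' * w ^ 2"
      by (simp add: algebra_simps power2_eq_square)
    also have "\<dots> = of_int (a * a' + b * b' * d) + of_int (a * b' + b * a' + b * b' * c) * w"
      by (simp add: w(2) algebra_simps)
    finally show ?thesis using TI by metis
  qed
  show "?T \<subseteq> ring_of_integers (quad_field m)"
  proof
    fix u assume "u \<in> ?T"
    then obtain a b where u: "u = of_int a + of_int b * w" by blast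
    have "u ^ 2 = of_int a ^ 2 + 2 * of_int a * of_int b * w + of_int b ^ 2 * w ^ 2"
      by (simp add: u power2_sum power_mult_distrib algebra_simps)
    also have "\<dots> = of_int (2 * a + b * c) * u + of_int (b\<^sup>2 * d - a\<^sup>2 - a * b * c)"
      unfolding w(2) u by (simp add: algebra_simps power2_eq_square)
    finally have "alg_int u" by (rule alg_int_quadratic)
    moreover have "u \<in> quad_field m" unfolding u using w(1) by auto
    ultimately show "u \<in> ring_of_integers (quad_field m)"
      by (simp add: ring_of_integers_def)
  qed
qed

lemma quad_order_csqrt: "quad_order m {of_int a + of_int b * csqrt (of_int m) | a b. True}"
  by (rule quad_order_generated[where c = 0 and d = m and k = 0 and l = 1]) auto

lemma quad_order_half:
  assumes "m mod 4 = 1"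
  shows "quad_order m {of_int a + of_int b * ((1 + csqrt (of_int m)) / 2) | a b. True}"
proof (rule quad_order_generated[where c = 1 and d = "(m - 1) div 4" and k = "-1" and l = 2])
  have "m = 1 + 4 * ((m - 1) div 4)"
    using assms by presburger
  hence m: "of_int m = (1 + 4 * of_int ((m - 1) div 4) :: complex)"
    by (metis of_int_1 of_int_add of_int_mult of_int_numeral)
  show "((1 + csqrt (of_int m)) / 2)\<^sup>2 =
        of_int 1 * ((1 + csqrt (of_int m)) / 2) + of_int ((m - 1) div 4)"
    by (simp add: power_divide power2_sum field_simps, subst m, simp)
qed (auto simp: field_simps)

text \<open>P is a prime of the full ring of integers, whereas the fractions in \<open>R\<close> are
  formed from T. By \<open>R_subset\<close> these are integral at P in the sense of the definition,
  so models over \<open>R\<close> suffice.\<close>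

locale quad_order_prime = quad_order +
  fixes P :: "complex set"
  assumes prime_P: "nonzero_prime_ideal (ring_of_integers (quad_field m)) P"
begin

abbreviation "R \<equiv> localization T P"

lemma in_OK: "w \<in> T \<Longrightarrow> w \<in> ring_of_integers (quad_field m)"
  using T_subset by auto

lemma P_add: "v \<in> P \<Longrightarrow> w \<in> P \<Longrightarrow> v + w \<in> P"
  using prime_P by (auto simp: nonzero_prime_ideal_def)

lemma P_mult: "v \<in> P \<Longrightarrow> w \<in> T \<Longrightarrow> w * v \<in> P"
  using prime_P in_OK by (auto simp: nonzero_prime_ideal_def)

lemma one_notin_P: "1 \<notin> P"
proof
  assume "1 \<in> P"
  hence "a \<in> P" if "a \<in> ring_of_integers (quad_field m)" for a
    using prime_P that by (force simp: nonzero_prime_ideal_def)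
  thus False using prime_P by (auto simp: nonzero_prime_ideal_def)
qed

lemma P_primeD: "v * w \<in> P \<Longrightarrow> v \<in> T \<Longrightarrow> w \<in> T \<Longrightarrow> v \<in> P \<or> w \<in> P"
  using prime_P in_OK by (auto simp: nonzero_prime_ideal_def)

lemma P_powerD: "v ^ k \<in> P \<Longrightarrow> v \<in> T \<Longrightarrow> v \<in> P"
proof (induction k)
  case (Suc k)
  thus ?case using P_primeD[of v "v ^ k"] by auto
qed (use one_notin_P in auto)

lemma zero_in_P: "0 \<in> P"
  using prime_P by (auto simp: nonzero_prime_ideal_def)

lemma coprime_notin_P:
  assumes "coprime a b" "of_int a \<in> P"
  shows "of_int b \<notin> P"
proof
  assume b: "of_int b \<in> P"
  obtain u v where "u * a + v * b = 1"
    using assms(1) by (metis bezout_int coprime_imp_gcd_eq_1)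
  hence "of_int u * of_int a + of_int v * of_int b = (1 :: complex)"
    by (metis of_int_1 of_int_add of_int_mult)
  moreover have "of_int u * of_int a + of_int v * of_int b \<in> P"
    using P_add P_mult assms(2) b of_int_T by blast
  ultimately show False using one_notin_P by simp
qed

lemma RI: "a \<in> T \<Longrightarrow> b \<in> T \<Longrightarrow> b \<notin> P \<Longrightarrow> a / b \<in> R"
  unfolding localization_def by blast

lemma T_R [intro]: "a \<in> T \<Longrightarrow> a \<in> R"
  using RI[of a 1] one_notin_P by auto

lemma R_divide_T: assumes "v \<in> R" "b \<in> T" "b \<notin> P" shows "v / b \<in> R"
proof -
  obtain a c where v: "v = a / c" "a \<in> T" "c \<in> T" "c \<notin> P"
    using assms(1) unfolding localization_def by blast
  hence "c * b \<notin> P" using P_primeD assms by blast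
  with v assms show ?thesis using RI[of a "c * b"] by auto
qed

lemma R_mult [intro]: assumes "v \<in> R" "w \<in> R" shows "v * w \<in> R"
proof -
  obtain a b where w: "w = a / b" "a \<in> T" "b \<in> T" "b \<notin> P"
    using assms(2) unfolding localization_def by blast
  obtain a' b' where v: "v = a' / b'" "a' \<in> T" "b' \<in> T" "b' \<notin> P"
    using assms(1) unfolding localization_def by blast
  have "b' * b \<notin> P" using P_primeD v w by blast
  with v w show ?thesis using RI[of "a' * a" "b' * b"] by auto
qed

lemma R_uminus [intro]: "w \<in> R \<Longrightarrow> - w \<in> R"
  using R_mult[of "of_int (- 1)" w] T_R[OF of_int_T[of "- 1"]] by simp

lemma R_power [intro]: "w \<in> R \<Longrightarrow> w ^ k \<in> R"
  by (induction k) auto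

lemma R_subset: "R \<subseteq> localization (ring_of_integers (quad_field m)) P"
  using in_OK unfolding localization_def by blast

end

text \<open>This is the classical relation 1728 \<Delta> = c4^3 - c6^2.\<close>

lemma c_invariants_disc:
  "1728 * disc (a1, a2, a3, a4, a6) =
     ((a1\<^sup>2 + 4 * a2)\<^sup>2 - 24 * (2 * a4 + a1 * a3)) ^ 3
     - (- ((a1\<^sup>2 + 4 * a2) ^ 3) + 36 * (a1\<^sup>2 + 4 * a2) * (2 * a4 + a1 * a3)
        - 216 * (a3\<^sup>2 + 4 * a6))\<^sup>2"
proof -
  define b2 where "b2 = a1\<^sup>2 + 4 * a2"
  define b4 where "b4 = 2 * a4 + a1 * a3"
  define b6 where "b6 = a3\<^sup>2 + 4 * a6"
  define b8 where "b8 = a1\<^sup>2 * a6 + 4 * a2 * a6 - a1 * a3 * a4 + a2 * a3\<^sup>2 - a4\<^sup>2"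
  have "4 * b8 = b2 * b6 - b4\<^sup>2"
    unfolding b2_def b4_def b6_def b8_def by Groebner_Basis.algebra
  hence "1728 * (9 * b2 * b4 * b6 - b2\<^sup>2 * b8 - 8 * b4 ^ 3 - 27 * b6\<^sup>2) =
      (b2\<^sup>2 - 24 * b4) ^ 3 - (- (b2 ^ 3) + 36 * b2 * b4 - 216 * b6)\<^sup>2"
    by Groebner_Basis.algebra
  thus ?thesis by (simp add: Let_def b2_def b4_def b6_def b8_def)
qed

text \<open>The short equation with a4 = -C4/48 and a6 = -C6/864 has invariants C4 and C6. Any model
  with invariants C4 / u^4 and C6 / u^6 is a change of coordinates of it, so only two polynomial
  identities and a unit condition remain. The translation r, s, t has to lie in K but need not be
  integral.\<close>

lemma (in quad_order_prime) good_reduction_atI: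
  assumes u: "u \<in> quad_field m" "u \<noteq> 0"
    and K: "a1 \<in> quad_field m" "a2 \<in> quad_field m" "a3 \<in> quad_field m"
    and R: "a1 \<in> R" "a2 \<in> R" "a3 \<in> R" "a4 \<in> R" "a6 \<in> R"
    and C: "C4 ^ 3 - C6\<^sup>2 = 1728 * \<Delta>"
    and C4: "C4 = u ^ 4 * ((a1\<^sup>2 + 4 * a2)\<^sup>2 - 24 * (2 * a4 + a1 * a3))"
    and C6: "C6 = u ^ 6 * (- ((a1\<^sup>2 + 4 * a2) ^ 3)
                + 36 * (a1\<^sup>2 + 4 * a2) * (2 * a4 + a1 * a3) - 216 * (a3\<^sup>2 + 4 * a6))"
    and D: "\<Delta> / u ^ 12 \<in> R" "u ^ 12 / \<Delta> \<in> R"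
  shows "good_reduction_at (quad_field m) P (0, 0, 0, - C4 / 48, - C6 / 864)"
proof -
  \<comment> \<open>These values are forced by a1, a2 and a3; the right a4 and a6 then follow from
    C4 and C6.\<close>
  define r where "r = u\<^sup>2 * (a1\<^sup>2 + 4 * a2) / 12"
  define s where "s = u * a1 / 2"
  define t where "t = u ^ 3 * a3 / 2"
  have in_K: "r \<in> quad_field m" "s \<in> quad_field m" "t \<in> quad_field m"
    unfolding r_def s_def t_def using u(1) K by (auto intro!: quad_field_divide_numeral)
  define E where "E = (a1, a2, a3, a4, a6)"
  have E: "change_coords u r s t (0, 0, 0, - C4 / 48, - C6 / 864) = E"
    using u(2) unfolding r_def s_def t_def C4 C6 E_def
    by (simp add: field_simps) Groebner_Basis.algebra
  have "1728 * (disc E * u ^ 12) = C4 ^ 3 - C6\<^sup>2"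
    unfolding E_def mult.assoc[symmetric] c_invariants_disc C4 C6 by Groebner_Basis.algebra
  hence "disc E * u ^ 12 = \<Delta>" using C by simp
  hence dE: "disc E = \<Delta> / u ^ 12" using u(2) by (simp add: field_simps)
  hence "inverse (disc E) = u ^ 12 / \<Delta>" by simp
  hence "disc E \<in> R" "inverse (disc E) \<in> R" "coeffs_in E R"
    using D dE R by (simp_all add: E_def coeffs_in_def)
  hence "disc E \<in> localization (ring_of_integers (quad_field m)) P"
    "inverse (disc E) \<in> localization (ring_of_integers (quad_field m)) P"
    "coeffs_in E (localization (ring_of_integers (quad_field m)) P)"
    using R_subset by (auto simp: coeffs_in_def E_def)
  thus ?thesis unfolding good_reduction_at_def Let_def using in_K u E by metis
qed

section \<open>Twisted curves and their local integral models\<close>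

definition conic_beta :: "int \<Rightarrow> int \<Rightarrow> int \<Rightarrow> int \<Rightarrow> complex" where
  "conic_beta N n x y = of_int (N * x) + of_int y * csqrt (of_int (- (N * n)))"

text \<open>This is \<beta>^2 / N with the division carried out, which shows that it lies in
  Z[\<theta>]. Replacing y by -y gives the conjugates of \<beta> and \<gamma>.\<close>

definition conic_gamma :: "int \<Rightarrow> int \<Rightarrow> int \<Rightarrow> int \<Rightarrow> complex" where
  "conic_gamma N n x y =
     of_int (N * x\<^sup>2 - n * y\<^sup>2) + of_int (2 * x * y) * csqrt (of_int (- (N * n)))"

lemma csqrt_square_conic:
  "csqrt (of_int (- (N * n))) * csqrt (of_int (- (N * n))) = - (of_int N * of_int n)"
  using power2_csqrt[of "of_int (- (N * n))"] by (simp add: power2_eq_square)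

lemma conic_beta_square: "(conic_beta N n x y)\<^sup>2 = of_int N * conic_gamma N n x y"
  using csqrt_square_conic[of N n]
  unfolding conic_beta_def conic_gamma_def of_int_add of_int_diff of_int_mult of_int_power
  by (simp only: of_int_numeral) Groebner_Basis.algebra

lemma conic_beta_norm:
  assumes "N * x\<^sup>2 + n * y\<^sup>2 = z\<^sup>2"
  shows "conic_beta N n x y * conic_beta N n x (- y) = of_int (N * z\<^sup>2)"
  using csqrt_square_conic[of N n]
  unfolding conic_beta_def assms[symmetric] of_int_add of_int_mult of_int_power of_int_minus
  by Groebner_Basis.algebra

lemma conic_gamma_norm:
  assumes "N * x\<^sup>2 + n * y\<^sup>2 = z\<^sup>2"
  shows "conic_gamma N n x y * conic_gamma N n x (- y) = of_int (z ^ 4)"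
proof -
  have z: "z ^ 4 = (N * x\<^sup>2 + n * y\<^sup>2)\<^sup>2" unfolding assms by simp
  show ?thesis
    using csqrt_square_conic[of N n]
    unfolding conic_gamma_def z of_int_add of_int_diff of_int_mult of_int_power of_int_minus
    by (simp only: of_int_numeral) Groebner_Basis.algebra
qed

lemma conic_gamma_trace:
  assumes "N * x\<^sup>2 + n * y\<^sup>2 = z\<^sup>2"
  shows "conic_gamma N n x y + conic_gamma N n x (- y) = of_int (4 * N * x\<^sup>2 - 2 * z\<^sup>2)"
  unfolding conic_gamma_def assms[symmetric] by (simp add: algebra_simps)

definition twisted_curve :: "int \<Rightarrow> int \<Rightarrow> int \<Rightarrow> int \<Rightarrow> int \<Rightarrow> int \<Rightarrow> int \<Rightarrow> weq" where
  "twisted_curve e A t N n x y =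
     (0, 0, 0, - (of_int (e * A) * conic_gamma N n x y) / 48,
      - (of_int t * conic_gamma N n x y * conic_beta N n x y) / 864)"

text \<open>The c6 identity of the model used in \<open>good_reduction_unit\<close>. The curve
  equation and h^2 = N g turn the cube into (A^3 - 1728) t g h / A^3, and 2592 - 864 = 1728
  compensates the defect.\<close>

lemma unit_model_c6:
  fixes e t g h A N :: complex
  assumes e: "e * e = 1" and h: "h\<^sup>2 = N * g" and A: "A \<noteq> 0" and c: "e * N * t\<^sup>2 = A ^ 3 - 1728"
  shows "t * g * h = - ((- (e * t) * h / A) ^ 3) + 36 * (- (e * t) * h / A) * (2 * (- 36 * e * g / A\<^sup>2))
           - 864 * (t * g * h / A ^ 3)"
proof -
  have "- ((- (e * t) * h / A) ^ 3) = (e * e) * e * t ^ 3 * (h * h\<^sup>2) / A ^ 3"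
    by (simp add: power3_eq_cube power2_eq_square mult_ac)
  also have "\<dots> = (e * N * t\<^sup>2) * (t * g * h) / A ^ 3"
    unfolding e h by (simp add: power3_eq_cube power2_eq_square mult_ac)
  finally have 1: "- ((- (e * t) * h / A) ^ 3) = (A ^ 3 - 1728) * (t * g * h) / A ^ 3" unfolding c .
  have "36 * (- (e * t) * h / A) * (2 * (- 36 * e * g / A\<^sup>2)) = 2592 * (e * e) * (t * g * h) / A ^ 3"
    by (simp add: power3_eq_cube power2_eq_square mult_ac)
  hence 2: "36 * (- (e * t) * h / A) * (2 * (- 36 * e * g / A\<^sup>2)) = 2592 * (t * g * h) / A ^ 3"
    unfolding e by simp
  have "(A ^ 3 - 1728) * v / A ^ 3 + 2592 * v / A ^ 3 - 864 * (v / A ^ 3) = v" for v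
    using A by (simp add: field_simps)
  from this[of "t * g * h"] show ?thesis unfolding 1 2 by (rule sym)
qed

lemma twisted_invariants:
  assumes e2: "e * e = 1" and curve: "e * N * t\<^sup>2 = A ^ 3 - 1728"
  shows "(of_int (e * A) * conic_gamma N n x y) ^ 3
           - (of_int t * conic_gamma N n x y * conic_beta N n x y)\<^sup>2
         = 1728 * (of_int e * conic_gamma N n x y ^ 3)"
proof -
  have e3: "of_int e ^ 3 = (of_int e :: complex)"
    using e2 by (metis mult_1 of_int_power power3_eq_cube)
  have "N * t\<^sup>2 = e * (A ^ 3 - 1728)"
    unfolding curve[symmetric] using e2 by (simp flip: mult.assoc)
  hence "of_int (N * t\<^sup>2) = (of_int (e * (A ^ 3 - 1728)) :: complex)" by (simp only:)
  hence c: "of_int N * of_int t ^ 2 = of_int e * (of_int A ^ 3 - 1728 :: complex)" by simp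
  have "(of_int t * conic_gamma N n x y * conic_beta N n x y)\<^sup>2
        = (of_int N * of_int t ^ 2) * conic_gamma N n x y ^ 3"
    unfolding power_mult_distrib conic_beta_square by (simp add: power2_eq_square power3_eq_cube)
  thus ?thesis unfolding c by (simp add: power_mult_distrib e3 algebra_simps)
qed

locale twist = quad_order_prime +
  fixes e A t N n x y z :: int
  assumes m_eq: "m = - (N * n)"
    and conic: "N * x\<^sup>2 + n * y\<^sup>2 = z\<^sup>2"
    and cop: "coprime z (2 * N * x)"
    and z_nz: "z \<noteq> 0" and N_nz: "N \<noteq> 0"
    and e2: "e * e = 1"
    and curve: "e * N * t\<^sup>2 = A ^ 3 - 1728"
begin

abbreviation "\<beta> \<equiv> conic_beta N n x y"
abbreviation "\<gamma> \<equiv> conic_gamma N n x y"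
abbreviation "\<beta>' \<equiv> conic_beta N n x (- y)"
abbreviation "\<gamma>' \<equiv> conic_gamma N n x (- y)"

lemma csqrt_T': "csqrt (of_int (- (N * n))) \<in> T"
  using csqrt_T by (simp only: m_eq)

lemma beta_T: "\<beta> \<in> T" "\<beta>' \<in> T" "\<gamma> \<in> T" "\<gamma>' \<in> T"
  unfolding conic_beta_def conic_gamma_def using csqrt_T' by blast+

lemma z_odd: "odd z"
  using cop by (meson coprime_mult_right_iff coprime_right_2_iff_odd)

lemma gamma_nz: "\<gamma> \<noteq> 0" "\<gamma>' \<noteq> 0"
  using conic_gamma_norm[OF conic] z_nz by auto

lemma beta_nz: "\<beta> \<noteq> 0" "\<beta>' \<noteq> 0"
  using conic_beta_norm[OF conic] z_nz N_nz by auto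

section \<open>Primes dividing \<gamma>\<close>

lemma z_in_PD:
  assumes "\<gamma> \<in> P"
  shows "of_int z \<in> P"
proof -
  have "\<gamma>' * \<gamma> \<in> P" using assms P_mult beta_T by blast
  hence "of_int z ^ 4 \<in> P" using conic_gamma_norm[OF conic] by (simp add: mult.commute)
  thus ?thesis using P_powerD by blast
qed

text \<open>Otherwise P contains the trace of \<gamma>, which is 4 N x^2 modulo z, and also z. These
  are coprime because z is coprime to 2 N x.\<close>

lemma gamma'_notin:
  assumes "\<gamma> \<in> P"
  shows "\<gamma>' \<notin> P"
proof
  assume "\<gamma>' \<in> P"
  hence "\<gamma> + \<gamma>' \<in> P" using assms P_add by blast
  hence "of_int (4 * N * x\<^sup>2 - 2 * z\<^sup>2) + of_int (2 * z) * of_int z \<in> P"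
    unfolding conic_gamma_trace[OF conic] using P_add P_mult z_in_PD[OF assms] by blast
  moreover have "of_int (4 * N * x\<^sup>2 - 2 * z\<^sup>2) + of_int (2 * z) * of_int z
                 = (of_int (4 * N * x\<^sup>2) :: complex)"
    by (simp add: power2_eq_square)
  moreover have "coprime z (4 * N * x\<^sup>2)"
  proof -
    have "coprime z 2" "coprime z N" "coprime z x" using cop by (auto simp: coprime_mult_right_iff)
    moreover have "4 = (2 * 2 :: int)" by simp
    ultimately show ?thesis by (metis coprime_mult_right_iff coprime_power_right_iff)
  qed
  ultimately show False using coprime_notin_P z_in_PD[OF assms] by metis
qed

lemma beta'_notin:
  assumes "\<gamma> \<in> P"
  shows "\<beta>' \<notin> P"
proof
  assume "\<beta>' \<in> P"
  hence "of_int N * \<gamma>' \<in> P"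
    using P_mult[of \<beta>' \<beta>'] beta_T by (simp add: conic_beta_square[symmetric] power2_eq_square)
  moreover have "of_int N \<notin> P"
    using coprime_notin_P[of z N] z_in_PD[OF assms] cop by (auto simp: coprime_mult_right_iff)
  ultimately show False using P_primeD gamma'_notin[OF assms] beta_T by blast
qed

text \<open>Away from 2, the ideal of \<open>\<gamma>\<close> is the fourth power of an ideal that is locally
  generated by 1 or by \<open>z\<close>.\<close>

lemma scaling:
  obtains u g h where "u \<in> quad_field m" "u \<noteq> 0" "\<gamma> = u ^ 4 * g" "\<beta> = u\<^sup>2 * h"
    "g \<in> R" "1 / g \<in> R" "g \<noteq> 0" "h \<in> R" "h \<in> quad_field m" "h\<^sup>2 = of_int N * g"
proof (cases "\<gamma> \<in> P")
  case False
  have "1 / \<gamma> \<in> R" using RI[of 1 \<gamma>] False beta_T by auto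
  thus ?thesis
    using that[of 1 \<gamma> \<beta>] beta_T gamma_nz conic_beta_square T_quad_field by auto
next
  case True
  \<comment> \<open>The conjugates are units at P up to divisors of N, and N is a unit as well. So
    the norm equations \<gamma> \<gamma>' = z^4 and \<beta> \<beta>' = N z^2 allow u = z.\<close>
  have g: "\<gamma> = of_int z ^ 4 * (1 / \<gamma>')"
    using conic_gamma_norm[OF conic] gamma_nz by (simp add: field_simps)
  have h: "\<beta> = (of_int z)\<^sup>2 * (of_int N / \<beta>')"
    using conic_beta_norm[OF conic] beta_nz by (simp add: field_simps)
  \<comment> \<open>An integer denominator makes membership in K visible.\<close>
  have "of_int N / \<beta>' = \<beta> / of_int (z\<^sup>2)"
    using h z_nz by (simp add: field_simps)
  hence hK: "of_int N / \<beta>' \<in> quad_field m"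
    using quad_field_divide_int[OF T_quad_field[OF beta_T(1)]] by metis
  have "1 / (1 / \<gamma>') \<in> R" using beta_T by auto
  moreover have "1 / \<gamma>' \<in> R" using RI gamma'_notin[OF True] beta_T by auto
  moreover have "of_int N / \<beta>' \<in> R" using RI beta'_notin[OF True] beta_T by auto
  moreover have "(of_int N / \<beta>')\<^sup>2 = of_int N * (1 / \<gamma>')"
    using conic_beta_square[of N n x "- y"] N_nz gamma_nz beta_nz
    by (simp add: field_simps power2_eq_square)
  ultimately show ?thesis
    using that[of "of_int z" "1 / \<gamma>'" "of_int N / \<beta>'"] g h hK gamma_nz z_nz by auto
qed

lemma e_T: "of_int e * of_int e = (1 :: complex)"
  using e2 by (metis of_int_1 of_int_mult)

lemma e_nz: "of_int e \<noteq> (0 :: complex)" using e_T by auto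

lemma disc_unit:
  assumes "\<gamma> = u ^ 4 * g" "u \<noteq> 0" "g \<in> R" "1 / g \<in> R" "g \<noteq> 0"
  shows "of_int e * \<gamma> ^ 3 / u ^ 12 \<in> R" "u ^ 12 / (of_int e * \<gamma> ^ 3) \<in> R"
proof -
  have "of_int e * \<gamma> ^ 3 / u ^ 12 = of_int e * g ^ 3"
    using assms(1,2) by (simp add: field_simps)
  thus "of_int e * \<gamma> ^ 3 / u ^ 12 \<in> R" using assms(3) by auto
  have "u ^ 12 / (of_int e * \<gamma> ^ 3) = of_int e * (1 / g) ^ 3"
    using assms(1,2,5) e_T e_nz by (simp add: field_simps)
  thus "u ^ 12 / (of_int e * \<gamma> ^ 3) \<in> R" using assms(4) by auto
qed

lemma good_reduction_twistI:
  assumes u: "u \<in> quad_field m" "u \<noteq> 0" "\<gamma> = u ^ 4 * g" "\<beta> = u\<^sup>2 * h"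
    and g: "g \<in> R" "1 / g \<in> R" "g \<noteq> 0"
    and K: "a1 \<in> quad_field m" "a2 \<in> quad_field m" "a3 \<in> quad_field m"
    and R: "a1 \<in> R" "a2 \<in> R" "a3 \<in> R" "a4 \<in> R" "a6 \<in> R"
    and C4: "of_int (e * A) * g = (a1\<^sup>2 + 4 * a2)\<^sup>2 - 24 * (2 * a4 + a1 * a3)"
    and C6: "of_int t * g * h = - ((a1\<^sup>2 + 4 * a2) ^ 3)
                + 36 * (a1\<^sup>2 + 4 * a2) * (2 * a4 + a1 * a3) - 216 * (a3\<^sup>2 + 4 * a6)"
  shows "good_reduction_at (quad_field m) P (twisted_curve e A t N n x y)"
  unfolding twisted_curve_def
proof (rule good_reduction_atI[OF u(1,2) K R twisted_invariants[OF e2 curve]])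
  show "of_int (e * A) * \<gamma> = u ^ 4 * ((a1\<^sup>2 + 4 * a2)\<^sup>2 - 24 * (2 * a4 + a1 * a3))"
    unfolding C4[symmetric] u(3) by simp
  show "of_int t * \<gamma> * \<beta> = u ^ 6 * (- ((a1\<^sup>2 + 4 * a2) ^ 3)
                + 36 * (a1\<^sup>2 + 4 * a2) * (2 * a4 + a1 * a3) - 216 * (a3\<^sup>2 + 4 * a6))"
    unfolding C6[symmetric] u(3,4) by (simp add: power_numeral_reduce)
qed (use disc_unit[OF u(3,2) g] in auto)

section \<open>Integral models prime by prime\<close>

lemma numeral_notin_P:
  assumes "2 \<notin> P"
  shows "16 \<notin> P" "32 \<notin> P" "4 \<notin> P"
  using P_powerD[of 2 4] P_powerD[of 2 5] P_powerD[of 2 2] assms T_numeral by auto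

text \<open>Since 48 = 16 * 3 and 864 = 32 * 27, the short model is integral away from 2 and 3;
  above 3 the factors 3 of A and 27 of t cancel the remaining denominators.\<close>

lemma good_reduction_short:
  assumes "2 \<notin> P" "3 \<notin> P \<or> (3 dvd A \<and> 27 dvd t)"
  shows "good_reduction_at (quad_field m) P (twisted_curve e A t N n x y)"
proof -
  obtain u g h where u: "u \<in> quad_field m" "u \<noteq> 0" "\<gamma> = u ^ 4 * g" "\<beta> = u\<^sup>2 * h"
    and g: "g \<in> R" "1 / g \<in> R" "g \<noteq> 0" and h: "h \<in> R" "h \<in> quad_field m" "h\<^sup>2 = of_int N * g"
    by (rule scaling)
  have "of_int A / 48 \<in> R \<and> of_int t / 864 \<in> R"
  proof (cases "3 \<in> P")
    case False
    hence "27 \<notin> P" using P_powerD[of 3 3] by auto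
    hence "48 \<notin> P" "864 \<notin> P"
      using P_primeD[of 16 3] P_primeD[of 32 27] numeral_notin_P[OF assms(1)] False by auto
    thus ?thesis using RI by auto
  next
    case True
    then obtain A' t' where "A = 3 * A'" "t = 27 * t'" using assms by blast
    thus ?thesis using RI[of "of_int A'" 16] RI[of "of_int t'" 32] numeral_notin_P[OF assms(1)]
      by auto
  qed
  hence "of_int (- e) * (of_int A / 48) * g \<in> R" "of_int (- 1) * (of_int t / 864) * g * h \<in> R"
    using g h by blast+
  thus ?thesis
    using T_R[of 0]
    by (intro good_reduction_twistI[OF u g, of 0 0 0 "of_int (- e) * (of_int A / 48) * g"
          "of_int (- 1) * (of_int t / 864) * g * h"]) auto
qed

text \<open>The model with \<open>b\<^sub>2 = - c\<^sub>6 / c\<^sub>4\<close>, which is integral when \<open>c\<^sub>4\<close> is a unit.\<close>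

lemma good_reduction_unit:
  assumes u: "u \<in> quad_field m" "u \<noteq> 0" "\<gamma> = u ^ 4 * g" "\<beta> = u\<^sup>2 * h"
    and g: "g \<in> R" "1 / g \<in> R" "g \<noteq> 0" and h: "h \<in> R" "h\<^sup>2 = of_int N * g"
    and A: "of_int A \<notin> P"
    and a1: "a1 \<in> T" and a2: "a2 \<in> R" "a2 \<in> quad_field m"
    and b2: "a1\<^sup>2 + 4 * a2 = - of_int (e * t) * h / of_int A"
  shows "good_reduction_at (quad_field m) P (twisted_curve e A t N n x y)"
\<comment> \<open>With c4 = e A g, c6 = t g h and \<Delta> = e g^3 these coefficients are a4 = -36
  \<Delta> / c4^2 and a6 = c6 \<Delta> / c4^3, as forced by b2 = -c6 / c4 and a3 = 0.\<close>
proof (rule good_reduction_twistI[OF u g, of a1 a2 0 "of_int (- 36 * e) * g / of_int A ^ 2"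
      "of_int t * g * h / of_int A ^ 3"])
  have "of_int A ^ 2 \<notin> P" "of_int A ^ 3 \<notin> P" using A P_powerD by blast+
  thus "of_int (- 36 * e) * g / of_int A ^ 2 \<in> R" "of_int t * g * h / of_int A ^ 3 \<in> R"
    using g h by (auto intro!: R_divide_T simp del: of_int_mult)
  have A0: "of_int A \<noteq> (0 :: complex)" using A zero_in_P by auto
  have "of_int (e * N * t\<^sup>2) = (of_int (A ^ 3 - 1728) :: complex)" by (simp only: curve)
  hence c: "of_int e * of_int N * of_int t ^ 2 = (of_int A ^ 3 - 1728 :: complex)" by simp
  hence "of_int e * (of_int e * of_int N * of_int t ^ 2)
         = (of_int e * (of_int A ^ 3 - 1728) :: complex)" by simp
  moreover have "of_int e * (of_int e * of_int N * of_int t ^ 2) = (of_int N * of_int t ^ 2 :: complex)"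
    by (metis e_T mult.assoc mult_1)
  ultimately have c': "of_int N * of_int t ^ 2 + of_int e * 1728 = (of_int e * of_int A ^ 3 :: complex)"
    by (simp add: right_diff_distrib)
  have "(- of_int (e * t) * h / of_int A)\<^sup>2 = of_int N * of_int t ^ 2 * g / of_int A ^ 2"
    using e_T by (simp add: power_divide power_mult_distrib h(2) power2_eq_square[of "of_int e"])
  hence "(- of_int (e * t) * h / of_int A)\<^sup>2 - 24 * (2 * (of_int (- 36 * e) * g / of_int A ^ 2) + a1 * 0)
     = (of_int N * of_int t ^ 2 + of_int e * 1728) * g / of_int A ^ 2"
    using A0 by (simp add: field_simps)
  thus "of_int (e * A) * g =
      (a1\<^sup>2 + 4 * a2)\<^sup>2 - 24 * (2 * (of_int (- 36 * e) * g / of_int A ^ 2) + a1 * 0)"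
    unfolding b2 c' using A0 by (simp add: field_simps power2_eq_square power3_eq_cube)
  show "of_int t * g * h = - ((a1\<^sup>2 + 4 * a2) ^ 3)
      + 36 * (a1\<^sup>2 + 4 * a2) * (2 * (of_int (- 36 * e) * g / of_int A ^ 2) + a1 * 0)
      - 216 * (0\<^sup>2 + 4 * (of_int t * g * h / of_int A ^ 3))"
    unfolding b2 using unit_model_c6[OF e_T h(2) A0 c] by simp
qed (use a1 a2 T_quad_field in auto)

text \<open>Both A and 4 are units at P, so a1 = 0 and a2 = b2 / 4 are allowed.\<close>

lemma good_reduction_unit_3:
  assumes "2 \<notin> P" "3 \<in> P" "\<not> 3 dvd A"
  shows "good_reduction_at (quad_field m) P (twisted_curve e A t N n x y)"
proof -
  obtain u g h where u: "u \<in> quad_field m" "u \<noteq> 0" "\<gamma> = u ^ 4 * g" "\<beta> = u\<^sup>2 * h"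
    and g: "g \<in> R" "1 / g \<in> R" "g \<noteq> 0" and h: "h \<in> R" "h \<in> quad_field m" "h\<^sup>2 = of_int N * g"
    by (rule scaling)
  have "prime (3 :: int)" by simp
  hence "coprime 3 A" using assms(3) prime_imp_coprime by blast
  hence A: "of_int A \<notin> P" using coprime_notin_P[of 3 A] assms(2) by simp
  hence "4 * of_int A \<notin> P"
    using P_primeD[of 4 "of_int A"] numeral_notin_P[OF assms(1)] by auto
  hence "of_int (- (e * t)) * h / (4 * of_int A) \<in> R"
    using R_mult[OF T_R[OF of_int_T[of "- (e * t)"]] h(1)] by (intro R_divide_T) auto
  moreover have "of_int (- (e * t)) * h / of_int (4 * A) \<in> quad_field m"
    using h by (intro quad_field_divide_int) auto
  ultimately show ?thesis
    by (intro good_reduction_unit[OF u g h(1,3) A, of 0 "of_int (- (e * t)) * h / of_int (4 * A)"])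
      auto
qed

text \<open>A is a unit at P, so b2 = -c6 / c4 is available; with a1 = 1 it gives a2 = (b2 - 1) / 4
  = -w / A. Since z is odd, \<gamma> is a unit above 2 and u = 1 is taken.\<close>

lemma good_reduction_two_odd:
  assumes "2 \<in> P" "odd A" and w: "of_int (e * t) * \<beta> + of_int A = 4 * w" "w \<in> T"
  shows "good_reduction_at (quad_field m) P (twisted_curve e A t N n x y)"
proof -
  have g: "\<gamma> \<notin> P"
    using coprime_notin_P[of 2 z] assms(1) z_odd z_in_PD by auto
  have g': "\<gamma> \<in> R" "1 / \<gamma> \<in> R" "\<gamma> \<noteq> 0" using g RI[of 1 \<gamma>] beta_T gamma_nz by auto
  have A: "of_int A \<notin> P" using coprime_notin_P[of 2 A] assms(1,2) by simp
  have "of_int (- 1) * w / of_int A \<in> R" using A w by (intro R_divide_T) auto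
  moreover have "of_int (- 1) * w / of_int A \<in> quad_field m"
    using w T_quad_field by (intro quad_field_divide_int) blast
  moreover have "of_int A \<noteq> (0 :: complex)" using A zero_in_P by auto
  hence "1\<^sup>2 + 4 * (of_int (- 1) * w / of_int A) = - of_int (e * t) * \<beta> / of_int A"
    using w(1) by (simp add: divide_simps) (simp add: algebra_simps)
  ultimately show ?thesis
    using beta_T conic_beta_square[of N n x y] T_numeral
    by (intro good_reduction_unit[of 1 \<gamma> \<beta>, OF _ _ _ _ g', where ?a1.0 = 1]) (auto simp: A)
qed

text \<open>The reduction is supersingular, with a1 = a2 = 0 and a3 = 1. Solving c4 for a4 and c6
  for a6 gives -e k \<gamma> / 3 and -w / 27.\<close>

lemma good_reduction_two_16:
  assumes "2 \<in> P" "A = 16 * k" "t = 8 * t'" and w: "of_int t' * \<gamma> * \<beta> + 27 = 4 * w" "w \<in> T"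
  shows "good_reduction_at (quad_field m) P (twisted_curve e A t N n x y)"
proof -
  have g: "\<gamma> \<notin> P"
    using coprime_notin_P[of 2 z] assms(1) z_odd z_in_PD by auto
  have g': "\<gamma> \<in> R" "1 / \<gamma> \<in> R" "\<gamma> \<noteq> 0" using g RI[of 1 \<gamma>] beta_T gamma_nz by auto
  have three: "3 \<notin> P" using coprime_notin_P[of 2 3] assms(1) by simp
  hence "27 \<notin> P" using P_powerD[of 3 3] by auto
  show ?thesis
  proof (rule good_reduction_twistI[of 1 \<gamma> \<beta>, OF _ _ _ _ g', of 0 0 1 "of_int (- e * k) * \<gamma> / 3"
        "of_int (- 1) * w / 27"])
    show "of_int (- e * k) * \<gamma> / 3 \<in> R" "of_int (- 1) * w / 27 \<in> R"
      using three \<open>27 \<notin> P\<close> w beta_T by (auto intro!: R_divide_T simp del: of_int_mult)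
    have "w = (of_int t' * \<gamma> * \<beta> + 27) / 4" using w(1) by simp
    thus "of_int t * \<gamma> * \<beta> = - ((0\<^sup>2 + 4 * 0) ^ 3)
       + 36 * (0\<^sup>2 + 4 * 0) * (2 * (of_int (- e * k) * \<gamma> / 3) + 0 * 1)
       - 216 * (1\<^sup>2 + 4 * (of_int (- 1) * w / 27))"
      using assms(3) by (simp add: field_simps)
  qed (use assms(2) T_R[of 0] T_R[of 1] in auto)
qed

text \<open>For even \<open>N\<close> the model has \<open>a\<^sub>1 = \<theta>\<close>, \<open>a\<^sub>2 = 0\<close>, \<open>a\<^sub>3 = 1\<close>, so that \<open>b\<^sub>2 = m\<close>; the two
  equations say that the resulting \<open>3 a\<^sub>4\<close> and \<open>27 a\<^sub>6\<close> are integral.\<close>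

lemma good_reduction_two_ramified:
  assumes "2 \<in> P"
    and a4: "of_int (m\<^sup>2) - of_int (e * A) * \<gamma> - 24 * csqrt (of_int m) = 16 * v" "v \<in> T"
    and a6: "of_int (m ^ 3) - 3 * of_int (m * e * A) * \<gamma>
               - 2 * of_int t * \<gamma> * \<beta> - 432 = 64 * w" "w \<in> T"
  shows "good_reduction_at (quad_field m) P (twisted_curve e A t N n x y)"
proof -
  have g: "\<gamma> \<notin> P"
    using coprime_notin_P[of 2 z] assms(1) z_odd z_in_PD by auto
  have g': "\<gamma> \<in> R" "1 / \<gamma> \<in> R" "\<gamma> \<noteq> 0" using g RI[of 1 \<gamma>] beta_T gamma_nz by auto
  have three: "3 \<notin> P" using coprime_notin_P[of 2 3] assms(1) by simp
  hence "27 \<notin> P" using P_powerD[of 3 3] by auto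
  define \<theta> where "\<theta> = csqrt (of_int m)"
  have th: "\<theta>\<^sup>2 = of_int m" by (simp add: \<theta>_def)
  \<comment> \<open>Here b4 = 2 a4 + \<theta>. The c4 equation gives 24 b4 = m^2 - e A \<gamma>,
    that is, 48 a4 = 16 v. Inserted in c6 it gives 1728 a6 = 64 w.\<close>
  have v: "v = ((of_int m)\<^sup>2 - of_int (e * A) * \<gamma> - 24 * \<theta>) / 16" using a4 by (simp add: \<theta>_def)
  have w: "w = (of_int m ^ 3 - 3 * of_int m * of_int (e * A) * \<gamma>
               - 2 * of_int t * \<gamma> * \<beta> - 432) / 64" using a6 by (simp add: field_simps)
  show ?thesis
  proof (rule good_reduction_twistI[of 1 \<gamma> \<beta>, OF _ _ _ _ g', of \<theta> 0 1 "v / 3" "w / 27"])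
    show "v / 3 \<in> R" "w / 27 \<in> R"
      using three \<open>27 \<notin> P\<close> a4 a6 by (auto intro!: R_divide_T)
    show "of_int (e * A) * \<gamma> = (\<theta>\<^sup>2 + 4 * 0)\<^sup>2 - 24 * (2 * (v / 3) + \<theta> * 1)"
      unfolding th v by (simp add: field_simps)
    show "of_int t * \<gamma> * \<beta> = - ((\<theta>\<^sup>2 + 4 * 0) ^ 3)
       + 36 * (\<theta>\<^sup>2 + 4 * 0) * (2 * (v / 3) + \<theta> * 1) - 216 * (1\<^sup>2 + 4 * (w / 27))"
      unfolding th v w by (simp add: field_simps power_numeral_reduce)
  qed (use T_R[of 0] T_R[of 1] csqrt_T \<theta>_def in auto)
qed

end

section \<open>Curves with everywhere good reduction\<close>

text \<open>After removing gcd a t, the square of what is left of a must divide d, so it is a unit.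
  The lemma extracts the factors 27 and 8 of t from the curve equation.\<close>

lemma squarefree_square_dvd_cancel:
  fixes a d t :: int
  assumes "squarefree d" "a\<^sup>2 dvd d * t\<^sup>2"
  shows "a dvd t"
proof (cases "a = 0")
  case True
  thus ?thesis using assms by (cases "t = 0") auto
next
  case False
  obtain b s where b: "a = gcd a t * b" "t = gcd a t * s" "coprime b s"
    using False gcd_coprime_exists[of a t] by (metis gcd_eq_0_iff mult.commute)
  have g: "gcd a t \<noteq> 0" using False by simp
  have "(gcd a t)\<^sup>2 * b\<^sup>2 dvd (gcd a t)\<^sup>2 * (d * s\<^sup>2)"
    using assms(2) b(1,2) by (metis mult.left_commute power_mult_distrib)
  hence "b\<^sup>2 dvd d * s\<^sup>2" using g False by (auto simp: dvd_mult_cancel_left)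
  moreover have "coprime (b\<^sup>2) (s\<^sup>2)" using b(3) by simp
  ultimately have "b\<^sup>2 dvd d" by (simp add: coprime_dvd_mult_left_iff)
  hence "is_unit b" using assms(1) squarefreeD by blast
  thus ?thesis using b(1) by (metis dvd_trans gcd_dvd2 is_unit_mult_iff mult_dvd_mono mult.right_neutral dvd_refl)
qed

lemma disc_twisted_curve:
  assumes "(of_int (e * A) * conic_gamma N n x y) ^ 3
           - (of_int t * conic_gamma N n x y * conic_beta N n x y)\<^sup>2 = 1728 * \<Delta>"
  shows "disc (twisted_curve e A t N n x y) = \<Delta>"
proof -
  have "1728 * disc (twisted_curve e A t N n x y) = 1728 * \<Delta>"
    unfolding twisted_curve_def c_invariants_disc assms[symmetric] by (simp add: mult_ac)
  thus ?thesis by simp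
qed

lemma c4_twisted_curve: "c4 (twisted_curve e A t N n x y) = of_int (e * A) * conic_gamma N n x y"
  by (simp add: twisted_curve_def Let_def)

text \<open>Primes not above 2 are settled by the short model or, above 3 with A prime to 3, by the
  model with c4 a unit. The primes above 2 stay a hypothesis, because the order and the model there
  depend on the parity of D.\<close>

lemma twisted_curve_everywhere_good:
  assumes T: "quad_order m T"
    and m: "m = - (N * n)"
    and conic: "N * x\<^sup>2 + n * y\<^sup>2 = z\<^sup>2" "coprime z (2 * N * x)" "z \<noteq> 0" "N \<noteq> 0"
    and e: "e * e = 1"
    and curve: "e * N * t\<^sup>2 = A ^ 3 - 1728"
    and three: "3 dvd A \<Longrightarrow> 27 dvd t"
    and two: "\<And>P. twist m T P e A t N n x y z \<Longrightarrow> 2 \<in> P \<Longrightarrow>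
                good_reduction_at (quad_field m) P (twisted_curve e A t N n x y)"
  shows "\<exists>E. ell_curve_over (quad_field m) E \<and> everywhere_good_reduction (quad_field m) E
             \<and> j_inv E \<in> \<rat>"
proof -
  let ?E = "twisted_curve e A t N n x y"
  have tw: "twist m T P e A t N n x y z"
    if "nonzero_prime_ideal (ring_of_integers (quad_field m)) P" for P
    using assms that unfolding twist_def quad_order_prime_def quad_order_prime_axioms_def
      twist_axioms_def by blast
  have good: "everywhere_good_reduction (quad_field m) ?E"
    unfolding everywhere_good_reduction_def
  proof (intro allI impI)
    fix P assume P: "nonzero_prime_ideal (ring_of_integers (quad_field m)) P"
    interpret twist m T P e A t N n x y z using tw[OF P] .
    show "good_reduction_at (quad_field m) P ?E"
      using two[OF tw[OF P]] good_reduction_short good_reduction_unit_3 three by blast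
  qed
  have th: "csqrt (of_int (- (N * n))) \<in> quad_field m" unfolding m by blast
  have norm: "conic_gamma N n x y * conic_gamma N n x (- y) = of_int (z ^ 4)"
    by (rule conic_gamma_norm[OF conic(1)])
  hence g0: "conic_gamma N n x y \<noteq> 0" using conic(3) by auto
  have e': "of_int e * of_int e = (1 :: complex)" using e by (metis of_int_1 of_int_mult)
  have e3: "of_int e ^ 3 = (of_int e :: complex)" using e' by (simp add: power3_eq_cube)
  have "disc ?E = of_int e * conic_gamma N n x y ^ 3"
    by (rule disc_twisted_curve[OF twisted_invariants[OF e curve]])
  moreover from this have "disc ?E \<noteq> 0" using g0 e' by auto
  moreover have "(of_int (e * A) * conic_gamma N n x y) ^ 3
                 = of_int A ^ 3 * (of_int e * conic_gamma N n x y ^ 3)"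
    by (simp only: of_int_mult power_mult_distrib e3) (simp add: mult_ac)
  ultimately have "j_inv ?E = of_int A ^ 3" "disc ?E \<noteq> 0"
    unfolding j_inv_def c4_twisted_curve by auto
  moreover have "coeffs_in ?E (quad_field m)"
    using th unfolding twisted_curve_def coeffs_in_def conic_gamma_def conic_beta_def
    by (auto intro!: quad_field_divide_numeral quad_field_uminus quad_field_mult quad_field_add
        simp del: of_int_mult of_int_minus of_int_diff)
  ultimately have "ell_curve_over (quad_field m) ?E" "j_inv ?E \<in> \<rat>"
    by (auto simp: ell_curve_over_def)
  with good show ?thesis by blast
qed

lemma conic_gamma_beta:
  "conic_gamma N n x y * conic_beta N n x y =
     of_int (N * x * (N * x\<^sup>2 - 3 * n * y\<^sup>2))
     + of_int (y * (3 * N * x\<^sup>2 - n * y\<^sup>2)) * csqrt (of_int (- (N * n)))"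
  using csqrt_square_conic[of N n]
  unfolding conic_beta_def conic_gamma_def of_int_add of_int_diff of_int_mult of_int_power
  by (simp only: of_int_numeral) Groebner_Basis.algebra

lemma odd_square_mod_8: "odd x \<Longrightarrow> [x\<^sup>2 = 1] (mod (8 :: int))"
proof -
  assume "odd x"
  then obtain i where x: "x = 2 * i + 1" by (elim oddE)
  obtain j where "i * (i + 1) = 2 * j" by (metis dvdE even_mult_iff even_plus_one_iff)
  hence "x\<^sup>2 = 1 + 8 * j" unfolding x by (simp add: power2_eq_square algebra_simps)
  thus ?thesis by (simp add: cong_def)
qed

lemma odd_square_mod_4: "odd x \<Longrightarrow> [x\<^sup>2 = 1] (mod (4 :: int))"
  using cong_dvd_modulus[OF odd_square_mod_8, of x 4] by simp

text \<open>The equation \<open>D t\<^sup>2 = A\<^sup>3 - 1728\<close> leaves the sign of \<open>t\<close> free; it is fixed by a congruence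
  modulo 4 at the prime 2.\<close>

lemma choose_sign_mod_4:
  fixes a b :: int
  assumes "odd a" "odd b"
  obtains s where "s = 1 \<or> s = -1" "4 dvd s * a + b"
proof (cases "4 dvd a + b")
  case True
  thus ?thesis using that[of 1] by simp
next
  case False
  have "4 dvd - a + b" using assms False by presburger
  thus ?thesis using that[of "-1"] by simp
qed

section \<open>Verification of the conditions at 2 and 3\<close>

context
  fixes D A t N n x y z :: int
  assumes D: "squarefree D" and A: "A \<in> setR" and curve: "D * t\<^sup>2 = A ^ 3 - 1728"
    and sgn_D: "sgn D = eps D" and N: "N = \<bar>D\<bar>"
    and conic: "N * x\<^sup>2 + n * y\<^sup>2 = z\<^sup>2" "coprime z (2 * N * x)" "z \<noteq> 0"
begin

lemma D_eq: "D = eps D * N" using sgn_D N by (metis abs_sgn mult.commute mult_sgn_abs)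

lemma eps_square: "eps D * eps D = 1" by (simp add: eps_def)

lemma curve': "eps D * N * t\<^sup>2 = A ^ 3 - 1728" using curve D_eq by metis

text \<open>As 1728 = 12^3, the congruence A = 12 modulo 27 makes A^3 - 1728 divisible by
  27^2.\<close>

lemma three_dvd: "3 dvd A \<Longrightarrow> 27 dvd t"
proof -
  assume "3 dvd A"
  hence "27 dvd A - 12" using A by (auto simp: setR_def)
  then obtain k where "A = 12 + 27 * k" by (metis diff_add_cancel add.commute dvdE)
  hence "A ^ 3 - 1728 = 27\<^sup>2 * (k * (16 + 36 * k + 27 * k\<^sup>2))"
    by (simp add: power3_eq_cube power2_eq_square algebra_simps)
  hence "27\<^sup>2 dvd D * t\<^sup>2" unfolding curve by simp
  thus ?thesis by (rule squarefree_square_dvd_cancel[OF D])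
qed

lemma t_eq_8:
  assumes "4 dvd A"
  obtains t' where "t = 8 * t'"
proof -
  obtain k where "A = 4 * k" using assms by blast
  hence "A ^ 3 - 1728 = 8\<^sup>2 * (k ^ 3 - 27)"
    by (simp add: power3_eq_cube power2_eq_square algebra_simps)
  hence "8\<^sup>2 dvd D * t\<^sup>2" unfolding curve by simp
  hence "8 dvd t" by (rule squarefree_square_dvd_cancel[OF D])
  thus ?thesis using that by blast
qed

lemma A_cases: "odd A \<or> (\<exists>k. A = 16 * k) \<or> (\<exists>k. A = 4 + 16 * k)"
proof -
  have "odd A \<or> 16 dvd A \<or> 16 dvd A - 4" using A by (auto simp: setR_def)
  thus ?thesis by (metis add.commute diff_add_cancel dvdE)
qed

lemma A_16_imp: assumes "A = 16 * k" "t = 8 * t'" shows "odd (D * t'\<^sup>2)"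
proof -
  have "64 * (D * t'\<^sup>2) = 64 * (64 * k ^ 3 - 27)"
    using curve unfolding assms by (simp add: power3_eq_cube power2_eq_square algebra_simps)
  hence "D * t'\<^sup>2 = 64 * k ^ 3 - 27" by simp
  thus ?thesis by simp
qed

lemma A_4_imp:
  assumes "A = 4 + 16 * k" "t = 8 * t'"
  shows "D * t'\<^sup>2 = 2 * (32 * k ^ 3 + 24 * k\<^sup>2 + 6 * k - 13)"
proof -
  have "64 * (D * t'\<^sup>2) = 64 * (2 * (32 * k ^ 3 + 24 * k\<^sup>2 + 6 * k - 13))"
    using curve unfolding assms by (simp add: power3_eq_cube power2_eq_square algebra_simps)
  thus ?thesis by simp
qed

text \<open>The remaining class A = 4 + 16 k is impossible for odd D: there D t^2 / 64 is twice an
  odd number.\<close>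

lemma odd_D_cases:
  assumes "odd D"
  shows "odd A \<and> odd t \<or> (\<exists>k t'. A = 16 * k \<and> t = 8 * t' \<and> odd t')"
proof -
  consider "odd A" | k where "A = 16 * k" | k where "A = 4 + 16 * k" using A_cases by blast
  thus ?thesis
  proof cases
    case 1
    hence "odd (D * t\<^sup>2)" unfolding curve by simp
    thus ?thesis using 1 by simp
  next
    case 2
    hence "4 dvd A" by (simp add: dvd_mult2)
    then obtain t' where "t = 8 * t'" by (rule t_eq_8)
    with 2 show ?thesis using A_16_imp[OF 2 \<open>t = 8 * t'\<close>] by auto
  next
    case 3
    hence "4 dvd A" by presburger
    then obtain t' where t': "t = 8 * t'" by (rule t_eq_8)
    have "even t'" using A_4_imp[OF 3 t'] assms by (metis dvd_triv_left even_mult_iff even_power)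
    then obtain t'' where "t' = 2 * t''" by blast
    hence "2 * (D * t''\<^sup>2) = 32 * k ^ 3 + 24 * k\<^sup>2 + 6 * k - 13"
      using A_4_imp[OF 3 t'] by (simp add: power2_eq_square)
    hence "even (32 * k ^ 3 + 24 * k\<^sup>2 + 6 * k - 13)" by (metis dvd_triv_left)
    thus ?thesis by simp
  qed
qed

text \<open>Now m = 1 modulo 4, so Z[\<omega>] is available. Modulo 4 both \<beta> and \<gamma>
  \<beta> turn out to be odd rational integers, so the divisibility by 4 demanded by the models at 2
  is a matter of the sign of t.\<close>

lemma egr_curve_odd:
  assumes "odd D" "n mod 4 = 3"
  shows "\<exists>E. ell_curve_over (quad_field (- (N * n))) E \<and>
             everywhere_good_reduction (quad_field (- (N * n))) E \<and> j_inv E \<in> \<rat>"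
proof -
  define m where "m = - (N * n)"
  define \<omega> where "\<omega> = (1 + csqrt (of_int m)) / 2"
  define T where "T = {of_int a + of_int b * \<omega> | a b. True}"
  have TI: "of_int a + of_int b * \<omega> \<in> T" for a b unfolding T_def by blast
  have th: "csqrt (of_int (- (N * n))) = 2 * \<omega> - 1" by (simp add: \<omega>_def m_def add_divide_distrib)
  \<comment> \<open>This is what the sign \<epsilon> is made for: \<epsilon> D is 1 modulo 4 for odd
    D.\<close>
  have N4: "N mod 4 = 1"
  proof (cases "D mod 4 = 1")
    case True
    thus ?thesis using D_eq by (simp add: eps_def)
  next
    case False
    hence "N = - D" using D_eq by (simp add: eps_def)
    thus ?thesis using False assms(1) by presburger
  qed
  have m4: "m mod 4 = 1"
    using mod_mult_eq[of N 4 n] N4 assms(2) unfolding m_def by (simp add: zmod_zminus1_eq_if)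
  have T: "quad_order m T" unfolding T_def \<omega>_def by (rule quad_order_half[OF m4])
  have z: "odd z" using conic(2) by (meson coprime_mult_right_iff coprime_right_2_iff_odd)
  have "odd N" "odd n" using N4 assms(2) by presburger+
  \<comment> \<open>An odd y would force an even x and then z^2 = n = 3 modulo 4.\<close>
  have "even y"
  proof (rule ccontr)
    assume "odd y"
    have "even x" using z \<open>odd y\<close> \<open>odd N\<close> \<open>odd n\<close> conic(1)
      by (metis even_add even_mult_iff even_power pos2)
    then obtain x' where "x = 2 * x'" by blast
    hence "4 dvd N * x\<^sup>2" by (simp add: power2_eq_square)
    moreover have "[y\<^sup>2 = 1] (mod 4)" "[z\<^sup>2 = 1] (mod 4)"
      using odd_square_mod_4 \<open>odd y\<close> z by auto
    hence "[n * y\<^sup>2 = 3 * 1] (mod 4)"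
      using assms(2) by (intro cong_mult) (auto simp: cong_def)
    ultimately have "[z\<^sup>2 = 0 + 3 * 1] (mod 4)" unfolding conic(1)[symmetric]
      by (intro cong_add) (auto simp: cong_0_iff)
    with \<open>[z\<^sup>2 = 1] (mod 4)\<close> show False by (simp add: cong_def)
  qed
  then obtain y' where y: "y = 2 * y'" by blast
  have "odd x" using z \<open>even y\<close> conic(1)
    by (metis even_add even_mult_iff even_power pos2)
  \<comment> \<open>Since y = 2 y', the coefficient of \<omega> is divisible by 4; only the rational
    part is left to adjust. The same happens for \<open>gb\<close>.\<close>
  have beta: "conic_beta N n x y = of_int (N * x - y) + 4 * of_int y' * \<omega>"
    unfolding conic_beta_def th by (simp add: y algebra_simps)
  define a where "a = N * x * (N * x\<^sup>2 - 3 * n * y\<^sup>2)"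
  define b where "b = y' * (3 * N * x\<^sup>2 - n * y\<^sup>2)"
  have gb: "conic_gamma N n x y * conic_beta N n x y = of_int (a - 2 * b) + 4 * of_int b * \<omega>"
    unfolding conic_gamma_beta th by (simp add: y a_def b_def algebra_simps)
  have "odd a" using \<open>odd N\<close> \<open>odd x\<close> y unfolding a_def by simp
  have N0: "N \<noteq> 0" using \<open>odd N\<close> by auto
  consider "odd A" "odd t" | k t' where "A = 16 * k" "t = 8 * t'" "odd t'"
    using odd_D_cases[OF assms(1)] by blast
  thus ?thesis unfolding m_def[symmetric]
  proof cases
    case 1
    have "odd (eps D * t * (N * x - y))"
      using 1 \<open>odd N\<close> \<open>odd x\<close> \<open>even y\<close> by (simp add: eps_def)
    then obtain s where s: "s = 1 \<or> s = -1" "4 dvd s * (eps D * t * (N * x - y)) + A"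
      using choose_sign_mod_4 1(1) by blast
    then obtain j where j: "s * (eps D * t * (N * x - y)) + A = 4 * j" by blast
    have s2: "(s * t)\<^sup>2 = t\<^sup>2" using s(1) by auto
    define w where "w = of_int j + of_int (eps D * (s * t) * y') * \<omega>"
    have "of_int (s * (eps D * t * (N * x - y)) + A) = (of_int (4 * j) :: complex)"
      by (simp only: j)
    hence w: "of_int (eps D * (s * t)) * conic_beta N n x y + of_int A = 4 * w"
      unfolding beta w_def by (simp add: algebra_simps)
    show "\<exists>E. ell_curve_over (quad_field m) E \<and> everywhere_good_reduction (quad_field m) E
             \<and> j_inv E \<in> \<rat>"
    proof (rule twisted_curve_everywhere_good[OF T m_def conic N0 eps_square])
      show "eps D * N * (s * t)\<^sup>2 = A ^ 3 - 1728" unfolding s2 by (rule curve')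
      show "27 dvd s * t" if "3 dvd A" using three_dvd[OF that] by simp
      fix P assume "twist m T P (eps D) A (s * t) N n x y z" "2 \<in> P"
      thus "good_reduction_at (quad_field m) P (twisted_curve (eps D) A (s * t) N n x y)"
        using twist.good_reduction_two_odd 1(1) w TI w_def by blast
    qed
  next
    case 2
    have "odd (t' * (a - 2 * b))" using 2 \<open>odd a\<close> by simp
    then obtain s where s: "s = 1 \<or> s = -1" "4 dvd s * (t' * (a - 2 * b)) + 27"
      using choose_sign_mod_4[of "t' * (a - 2 * b)" 27] by (metis odd_numeral)
    then obtain j where j: "s * (t' * (a - 2 * b)) + 27 = 4 * j" by blast
    have s2: "(s * t)\<^sup>2 = t\<^sup>2" using s(1) by auto
    define w where "w = of_int j + of_int ((s * t') * b) * \<omega>"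
    have "of_int (s * (t' * (a - 2 * b)) + 27) = (of_int (4 * j) :: complex)"
      by (simp only: j)
    hence w: "of_int (s * t') * conic_gamma N n x y * conic_beta N n x y + 27 = 4 * w"
      unfolding mult.assoc gb w_def by (simp add: algebra_simps)
    have st: "s * t = 8 * (s * t')" using 2 by simp
    show "\<exists>E. ell_curve_over (quad_field m) E \<and> everywhere_good_reduction (quad_field m) E
             \<and> j_inv E \<in> \<rat>"
    proof (rule twisted_curve_everywhere_good[OF T m_def conic N0 eps_square])
      show "eps D * N * (s * t)\<^sup>2 = A ^ 3 - 1728" unfolding s2 by (rule curve')
      show "27 dvd s * t" if "3 dvd A" using three_dvd[OF that] by simp
      fix P assume "twist m T P (eps D) A (s * t) N n x y z" "2 \<in> P"
      thus "good_reduction_at (quad_field m) P (twisted_curve (eps D) A (s * t) N n x y)"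
        using twist.good_reduction_two_16 2(1) st w TI w_def by blast
    qed
  qed
qed

text \<open>Here m is twice an odd number and the order is Z[\<theta>]. The two integrality
  equations of the ramified model are checked coordinate by coordinate: \<open>v1\<close>,
  \<open>v2\<close> for a4 and \<open>w1\<close>, \<open>w2\<close> for a6. The inputs are A = 4 +
  16 k, N' = 1 + 2 k modulo 4, the class of n modulo 8 and the sign of t.\<close>

lemma egr_curve_even:
  assumes "even D" "[n = 1 - N] (mod 8)"
  shows "\<exists>E. ell_curve_over (quad_field (- (N * n))) E \<and>
             everywhere_good_reduction (quad_field (- (N * n))) E \<and> j_inv E \<in> \<rat>"
proof -
  define m where "m = - (N * n)"
  define \<theta> where "\<theta> = csqrt (of_int m)"
  define T where "T = {of_int a + of_int b * \<theta> | a b. True}"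
  have TI: "of_int a + of_int b * \<theta> \<in> T" for a b unfolding T_def by blast
  have th: "csqrt (of_int (- (N * n))) = \<theta>" by (simp add: \<theta>_def m_def)
  have T: "quad_order m T" unfolding T_def \<theta>_def by (rule quad_order_csqrt)
  have z: "odd z" using conic(2) by (meson coprime_mult_right_iff coprime_right_2_iff_odd)
  have "D mod 4 \<noteq> 1" using assms(1) by presburger
  hence eps: "eps D = -1" by (simp add: eps_def)
  obtain N' where N': "N = 2 * N'" using assms(1) N by (metis dvdE dvd_abs_iff)
  have "squarefree (2 * N')" using D N N' by (cases "D \<ge> 0") auto
  hence "odd N'" using squarefree_mult_imp_coprime[of 2 N'] by simp
  have N0: "N \<noteq> 0" using \<open>odd N'\<close> N' by auto
  have n8: "[n = 1 - 2 * N'] (mod 8)" using assms(2) N' by simp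
  hence n4: "[n = 3] (mod 4)" using \<open>odd N'\<close> unfolding cong_def by presburger
  hence "odd n" unfolding cong_def by presburger
  have "odd (N * x\<^sup>2 + n * y\<^sup>2)" unfolding conic(1) using z by simp
  hence "odd y" using N' by simp
  note y8 = odd_square_mod_8[OF \<open>odd y\<close>]
  \<comment> \<open>An even x would give n = z^2 = 1 modulo 8, but n is 3 modulo 4.\<close>
  have "odd x"
  proof (rule ccontr)
    assume "\<not> odd x"
    then obtain x' where "x = 2 * x'" by auto
    hence "N * x\<^sup>2 = 8 * (N' * x'\<^sup>2)" by (simp add: N' power2_eq_square)
    hence "[N * x\<^sup>2 = 0] (mod 8)" by (simp add: cong_0_iff)
    hence "[N * x\<^sup>2 + n * y\<^sup>2 = 0 + n * 1] (mod 8)" using y8 by (intro cong_add cong_mult) auto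
    hence "[1 = n] (mod 8)" unfolding conic(1) using odd_square_mod_8[OF z]
      by (metis add_0 cong_sym cong_trans mult_1_right)
    hence "[1 = n] (mod 4)" using cong_dvd_modulus[of 1 n 8 4] by simp
    thus False using n4 by (auto simp: cong_def)
  qed
  note x8 = odd_square_mod_8[OF \<open>odd x\<close>]
  have x4: "[x\<^sup>2 = 1] (mod 4)" and y4: "[y\<^sup>2 = 1] (mod 4)"
    using odd_square_mod_4 \<open>odd x\<close> \<open>odd y\<close> by auto
  consider "odd A" | k where "A = 16 * k" | k where "A = 4 + 16 * k" using A_cases by blast
  \<comment> \<open>The other two classes of A make D times a square odd.\<close>
  then obtain k t' where A4: "A = 4 + 16 * k" and t': "t = 8 * t'"
  proof cases
    case 1
    hence "odd (D * t\<^sup>2)" unfolding curve by simp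
    thus thesis using assms(1) by simp
  next
    case (2 k)
    hence "4 dvd A" by (simp add: dvd_mult2)
    then obtain t' where "t = 8 * t'" by (rule t_eq_8)
    with A_16_imp[OF 2 this] show thesis using assms(1) by simp
  next
    case (3 k)
    hence "4 dvd A" by presburger
    then obtain t' where "t = 8 * t'" by (rule t_eq_8)
    with 3 show thesis using that by blast
  qed
  \<comment> \<open>The given equation divided by -128. It shows that t' is odd and determines N'
    modulo 4 in terms of k.\<close>
  have Nt: "N' * t'\<^sup>2 = 13 - (32 * k ^ 3 + 24 * k\<^sup>2 + 6 * k)"
  proof -
    have "D = - 2 * N'" using D_eq eps N' by simp
    hence "2 * (N' * t'\<^sup>2) = 2 * (13 - (32 * k ^ 3 + 24 * k\<^sup>2 + 6 * k))"
      using A_4_imp[OF A4 t'] by simp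
    thus ?thesis by simp
  qed
  hence "odd (N' * t'\<^sup>2)" by simp
  hence "odd t'" by simp
  have Nk: "[N' = 1 + 2 * k] (mod 4)"
  proof -
    have "[t'\<^sup>2 = 1] (mod 4)"
      using odd_square_mod_4[OF \<open>odd t'\<close>] .
    hence "[N' * t'\<^sup>2 = N' * 1] (mod 4)" by (intro cong_mult) auto
    moreover have "13 - (32 * k ^ 3 + 24 * k\<^sup>2 + 6 * k) - (1 + 2 * k)
        = 4 * (3 - 8 * k ^ 3 - 6 * k\<^sup>2 - 2 * k)" by simp
    hence "[13 - (32 * k ^ 3 + 24 * k\<^sup>2 + 6 * k) = 1 + 2 * k] (mod 4)"
      unfolding cong_iff_dvd_diff by simp
    ultimately show ?thesis unfolding Nt by (metis cong_sym cong_trans mult_1_right)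
  qed
  define \<mu> where "\<mu> = N' * n"
  have m: "m = - 2 * \<mu>" by (simp add: m_def \<mu>_def N')
  have "odd \<mu>" using \<open>odd N'\<close> \<open>odd n\<close> by (simp add: \<mu>_def)
  have "[\<mu> = (1 + 2 * k) * 3] (mod 4)" unfolding \<mu>_def by (intro cong_mult Nk n4)
  hence \<mu>: "4 dvd \<mu> + 2 * k + 1" unfolding cong_def by presburger
  \<comment> \<open>The sign is dictated by \<open>w2\<close>: after division by -16 y, the
    \<theta>-coordinate is -(s t' + \<mu> x) modulo 4.\<close>
  obtain s where s: "s = 1 \<or> s = -1" "4 dvd s * t' + \<mu> * x"
    using choose_sign_mod_4[of t' "\<mu> * x"] \<open>odd t'\<close> \<open>odd \<mu>\<close> \<open>odd x\<close> by auto
  define u where "u = s * t'"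
  have u: "s * t = 8 * u" by (simp add: u_def t')
  have s2: "(s * t)\<^sup>2 = t\<^sup>2" using s(1) by auto
  define G where "G = N * x\<^sup>2 - n * y\<^sup>2"
  define a where "a = N * x * (N * x\<^sup>2 - 3 * n * y\<^sup>2)"
  define b where "b = y * (3 * N * x\<^sup>2 - n * y\<^sup>2)"
  have gamma: "conic_gamma N n x y = of_int G + of_int (2 * x * y) * \<theta>"
    unfolding conic_gamma_def th G_def ..
  have gb: "conic_gamma N n x y * conic_beta N n x y = of_int a + of_int b * \<theta>"
    unfolding conic_gamma_beta th a_def b_def ..
  \<comment> \<open>The class of n enters here: G = N - n = 2 N - 1 modulo 8, and N is 2 modulo
    4.\<close>
  have G8: "[G = 3] (mod 8)"
  proof -
    have "[G = N * 1 - n * 1] (mod 8)" unfolding G_def by (intro cong_diff cong_mult x8 y8) auto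
    moreover have "[N * 1 - n * 1 = 2 * N' - (1 - 2 * N')] (mod 8)"
      using n8 N' by (intro cong_diff) auto
    moreover obtain i where "N' = 2 * i + 1" using \<open>odd N'\<close> by (elim oddE)
    hence "2 * N' - (1 - 2 * N') = 3 + 8 * i" by simp
    hence "[2 * N' - (1 - 2 * N') = 3] (mod 8)" by (simp add: cong_iff_dvd_diff)
    ultimately show ?thesis using cong_trans by blast
  qed
  have v1: "16 dvd m\<^sup>2 + A * G"
  proof -
    have "[\<mu>\<^sup>2 = 1] (mod 4)" using odd_square_mod_4[OF \<open>odd \<mu>\<close>] .
    moreover have "[(1 + 4 * k) * G = 1 * 3] (mod 4)"
      using G8 cong_dvd_modulus[of G 3 8 4] by (intro cong_mult) (auto simp: cong_def)
    ultimately have "[\<mu>\<^sup>2 + (1 + 4 * k) * G = 1 + 1 * 3] (mod 4)" by (rule cong_add)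
    hence "4 dvd \<mu>\<^sup>2 + (1 + 4 * k) * G" by (simp add: cong_def mod_eq_0_iff_dvd)
    then obtain i where "\<mu>\<^sup>2 + (1 + 4 * k) * G = 4 * i" by blast
    hence "m\<^sup>2 + A * G = 16 * i" unfolding m A4 by (simp add: power2_eq_square algebra_simps)
    thus ?thesis by simp
  qed
  have v2: "16 dvd 2 * x * y * A - 24"
  proof -
    have "even (x * y * (1 + 4 * k) - 3)" using \<open>odd x\<close> \<open>odd y\<close> by simp
    then obtain i where "x * y * (1 + 4 * k) - 3 = 2 * i" by blast
    hence "2 * x * y * A - 24 = 16 * i" unfolding A4 by (simp add: algebra_simps)
    thus ?thesis by simp
  qed
  have w2: "64 dvd 6 * m * A * x * y - 2 * (s * t) * b"
  proof -
    have "[3 * N * x\<^sup>2 - n * y\<^sup>2 = 3 * N * 1 - n * 1] (mod 4)"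
      by (intro cong_diff cong_mult x4 y4) auto
    moreover have "[3 * N * 1 - n * 1 = 3 * N * 1 - 3 * 1] (mod 4)"
      by (intro cong_diff cong_mult n4) auto
    moreover obtain i where "N' = 2 * i + 1" using \<open>odd N'\<close> by (elim oddE)
    hence "3 * N * 1 - 3 * 1 - (- 1) = 4 * (3 * i + 1)" using N' by simp
    hence "[3 * N * 1 - 3 * 1 = - 1] (mod 4)" unfolding cong_iff_dvd_diff by (metis dvd_triv_left)
    ultimately have "[3 * N * x\<^sup>2 - n * y\<^sup>2 = - 1] (mod 4)" using cong_trans by blast
    hence "[u * (3 * N * x\<^sup>2 - n * y\<^sup>2) = u * - 1] (mod 4)" by (intro cong_mult) auto
    moreover have "[3 * (\<mu> * x) * (1 + 4 * k) = - 1 * (\<mu> * x) * 1] (mod 4)"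
      by (intro cong_mult) (auto simp: cong_def)
    ultimately have "[3 * (\<mu> * x) * (1 + 4 * k) + u * (3 * N * x\<^sup>2 - n * y\<^sup>2)
                      = - 1 * (\<mu> * x) * 1 + u * - 1] (mod 4)" by (intro cong_add)
    moreover have "4 dvd - (u + \<mu> * x)" using s(2) unfolding u_def by (simp only: dvd_minus_iff)
    hence "4 dvd - 1 * (\<mu> * x) * 1 + u * - 1" by (simp add: algebra_simps)
    ultimately have "4 dvd 3 * (\<mu> * x) * (1 + 4 * k) + u * (3 * N * x\<^sup>2 - n * y\<^sup>2)"
      using cong_dvd_iff by blast
    then obtain i where i: "3 * (\<mu> * x) * (1 + 4 * k) + u * (3 * N * x\<^sup>2 - n * y\<^sup>2) = 4 * i" by blast
    have "6 * m * A * x * y - 2 * (s * t) * b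
       = - 16 * y * (3 * (\<mu> * x) * (1 + 4 * k) + u * (3 * N * x\<^sup>2 - n * y\<^sup>2))"
      unfolding m A4 u b_def by (simp add: algebra_simps)
    also have "\<dots> = 64 * (- y * i)" unfolding i by simp
    finally show ?thesis by simp
  qed
  \<comment> \<open>Division by -8 leaves a congruence modulo 8 in \<mu> and k alone, since odd
    squares are 1, G is 3 and four times an odd number is 4.\<close>
  have w1: "64 dvd m ^ 3 + 3 * m * A * G - 2 * (s * t) * a - 432"
  proof -
    have "[\<mu> * \<mu>\<^sup>2 = \<mu> * 1] (mod 8)" by (intro cong_mult odd_square_mod_8[OF \<open>odd \<mu>\<close>]) auto
    moreover have "[3 * \<mu> * (1 + 4 * k) * G = 3 * \<mu> * (1 + 4 * k) * 3] (mod 8)"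
      by (intro cong_mult G8) auto
    moreover have "[4 * (u * N' * x * (N * x\<^sup>2 - 3 * n * y\<^sup>2)) = 4] (mod 8)"
    proof -
      have "odd (u * N' * x * (N * x\<^sup>2 - 3 * n * y\<^sup>2))"
        using s(1) \<open>odd t'\<close> \<open>odd N'\<close> \<open>odd x\<close> \<open>odd y\<close> \<open>odd n\<close> N' unfolding u_def by auto
      then obtain i where "u * N' * x * (N * x\<^sup>2 - 3 * n * y\<^sup>2) = 2 * i + 1" by (elim oddE)
      hence "4 * (u * N' * x * (N * x\<^sup>2 - 3 * n * y\<^sup>2)) - 4 = 8 * i" by simp
      thus ?thesis unfolding cong_iff_dvd_diff by (metis dvd_triv_left)
    qed
    ultimately have "[\<mu> * \<mu>\<^sup>2 + 3 * \<mu> * (1 + 4 * k) * G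
         + 4 * (u * N' * x * (N * x\<^sup>2 - 3 * n * y\<^sup>2)) + 54
         = \<mu> * 1 + 3 * \<mu> * (1 + 4 * k) * 3 + 4 + 54] (mod 8)" by (intro cong_add cong_refl)
    moreover have "8 dvd \<mu> * 1 + 3 * \<mu> * (1 + 4 * k) * 3 + 4 + 54"
    proof -
      obtain i where i: "\<mu> + 2 * k + 1 = 4 * i" using \<mu> by blast
      have "even (k * (k + 1))" by simp
      then obtain l where l: "k * (k + 1) = 2 * l" by blast
      have mu: "\<mu> = 4 * i - 2 * k - 1" using i by simp
      have "\<mu> * 1 + 3 * \<mu> * (1 + 4 * k) * 3 + 4 + 54
         = 8 * (5 * i + 18 * i * k - 2 * k + 6) - 72 * (k * (k + 1)) + 32 * k"
        unfolding mu by (simp add: algebra_simps)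
      also have "\<dots> = 8 * (5 * i + 18 * i * k - 2 * k + 6 - 18 * l + 4 * k)" unfolding l by simp
      finally show ?thesis by (metis dvd_triv_left)
    qed
    ultimately have "8 dvd \<mu> * \<mu>\<^sup>2 + 3 * \<mu> * (1 + 4 * k) * G
         + 4 * (u * N' * x * (N * x\<^sup>2 - 3 * n * y\<^sup>2)) + 54"
      using cong_dvd_iff by blast
    then obtain i where i: "\<mu> * \<mu>\<^sup>2 + 3 * \<mu> * (1 + 4 * k) * G
         + 4 * (u * N' * x * (N * x\<^sup>2 - 3 * n * y\<^sup>2)) + 54 = 8 * i" by blast
    have "m ^ 3 + 3 * m * A * G - 2 * (s * t) * a - 432 = - 8 * (\<mu> * \<mu>\<^sup>2 + 3 * \<mu> * (1 + 4 * k) * G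
         + 4 * (u * N' * x * (N * x\<^sup>2 - 3 * n * y\<^sup>2)) + 54)"
      unfolding m A4 u a_def by (simp add: N' power2_eq_square power3_eq_cube algebra_simps)
    also have "\<dots> = 64 * (- i)" unfolding i by simp
    finally show ?thesis by simp
  qed
  obtain v1' v2' where v': "m\<^sup>2 + A * G = 16 * v1'" "2 * x * y * A - 24 = 16 * v2'"
    using v1 v2 by blast
  obtain w1' w2' where w': "m ^ 3 + 3 * m * A * G - 2 * (s * t) * a - 432 = 64 * w1'"
    "6 * m * A * x * y - 2 * (s * t) * b = 64 * w2'"
    using w1 w2 by blast
  define v where "v = of_int v1' + of_int v2' * \<theta>"
  define w where "w = of_int w1' + of_int w2' * \<theta>"
  have a4: "of_int (m\<^sup>2) - of_int (eps D * A) * conic_gamma N n x y - 24 * csqrt (of_int m) = 16 * v"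
  proof -
    have "of_int (m\<^sup>2) - of_int (eps D * A) * conic_gamma N n x y - 24 * csqrt (of_int m)
        = of_int (m\<^sup>2 + A * G) + of_int (2 * x * y * A - 24) * \<theta>"
      unfolding gamma \<theta>_def[symmetric] eps by (simp add: algebra_simps)
    thus ?thesis unfolding v' v_def by (simp add: algebra_simps)
  qed
  have a6: "of_int (m ^ 3) - 3 * of_int (m * eps D * A) * conic_gamma N n x y
     - 2 * of_int (s * t) * conic_gamma N n x y * conic_beta N n x y - 432 = 64 * w"
  proof -
    have "of_int (m ^ 3) - 3 * of_int (m * eps D * A) * conic_gamma N n x y
     - 2 * of_int (s * t) * conic_gamma N n x y * conic_beta N n x y - 432
     = of_int (m ^ 3) - 3 * of_int (m * eps D * A) * conic_gamma N n x y
     - 2 * of_int (s * t) * (conic_gamma N n x y * conic_beta N n x y) - 432"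
      by (simp add: mult.assoc)
    also have "\<dots> = of_int (m ^ 3 + 3 * m * A * G - 2 * (s * t) * a - 432)
         + of_int (6 * m * A * x * y - 2 * (s * t) * b) * \<theta>"
      unfolding gb unfolding gamma eps by (simp add: algebra_simps)
    finally show ?thesis unfolding w' w_def by (simp add: algebra_simps)
  qed
  show ?thesis unfolding m_def[symmetric]
  proof (rule twisted_curve_everywhere_good[OF T m_def conic N0 eps_square])
    show "eps D * N * (s * t)\<^sup>2 = A ^ 3 - 1728" unfolding s2 by (rule curve')
    show "27 dvd s * t" if "3 dvd A" using three_dvd[OF that] by simp
    fix P assume "twist m T P (eps D) A (s * t) N n x y z" "2 \<in> P"
    thus "good_reduction_at (quad_field m) P (twisted_curve (eps D) A (s * t) N n x y)"
      using twist.good_reduction_two_ramified a4 a6 TI v_def w_def by blast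
  qed
qed

end

section \<open>Chebyshev and Mertens estimates\<close>

text \<open>Double counting of n = d k. F depends on both d and n because the lemma serves ln n!,
  Lambert series and the sum of \<chi>(n) ln n / n.\<close>

lemma sum_divisors_swap:
  fixes F :: "nat \<Rightarrow> nat \<Rightarrow> real"
  shows "(\<Sum>n=1..x. \<Sum>d | d dvd n. F d n) = (\<Sum>d=1..x. \<Sum>k=1..x div d. F d (d * k))"
proof -
  have "(\<Sum>n=1..x. \<Sum>d | d dvd n. F d n) = (\<Sum>(n, d)\<in>(SIGMA n:{1..x}. {d. d dvd n}). F d n)"
    by (subst sum.Sigma) auto
  also have "\<dots> = (\<Sum>(d, k)\<in>(SIGMA d:{1..x}. {1..x div d}). F d (d * k))"
  proof (rule sum.reindex_bij_witness[where i = "\<lambda>(d, k). (d * k, d)" and j = "\<lambda>(n, d). (d, n div d)"])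
    show "(case a of (n, d) \<Rightarrow> (d, n div d)) \<in> (SIGMA d:{1..x}. {1..x div d})"
      if a_in: "a \<in> (SIGMA n:{1..x}. {d. d dvd n})" for a
    proof -
      obtain n d where a: "a = (n, d)" "1 \<le> n" "n \<le> x" "d dvd n" using a_in by (cases a) auto
      hence "1 \<le> d" "d \<le> n" by (auto simp: Suc_le_eq dvd_pos_nat dvd_imp_le)
      moreover from this have "1 \<le> n div d" by (simp add: Suc_le_eq div_greater_zero_iff)
      ultimately show ?thesis using a by (auto intro: div_le_mono)
    qed
    show "(case b of (d, k) \<Rightarrow> (d * k, d)) \<in> (SIGMA n:{1..x}. {d. d dvd n})"
      if "b \<in> (SIGMA d:{1..x}. {1..x div d})" for b
      using that by (auto simp: Suc_le_eq) (metis less_eq_div_iff_mult_less_eq mult.commute)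
  qed auto
  also have "\<dots> = (\<Sum>d=1..x. \<Sum>k=1..x div d. F d (d * k))"
    by (subst sum.Sigma) auto
  finally show ?thesis .
qed

lemma ln_fact_mangoldt: "ln (fact x :: real) = (\<Sum>d=1..x. mangoldt d * real (x div d))"
proof -
  have "ln (fact x :: real) = (\<Sum>n=1..x. ln (real n))"
    by (induction x) (auto simp: ln_mult)
  also have "\<dots> = (\<Sum>n=1..x. \<Sum>d | d dvd n. mangoldt d)"
    by (intro sum.cong refl) (subst mangoldt_sum, auto)
  also have "\<dots> = (\<Sum>d=1..x. \<Sum>k=1..x div d. mangoldt d)" by (rule sum_divisors_swap)
  finally show ?thesis by (simp add: mult.commute)
qed

section \<open>Chebyshev's upper bound and Mertens' first theorem\<close>

definition psi :: "nat \<Rightarrow> real" where "psi n = (\<Sum>d=1..n. mangoldt d)"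

lemma psi_mono: "m \<le> n \<Longrightarrow> psi m \<le> psi n"
  unfolding psi_def by (rule sum_mono2) (auto simp: mangoldt_nonneg)

text \<open>The difference of floors (2n/d) - 2 (n/d) is nonnegative, and 1 for n < d \<le> 2 n.
  Weighted by \<open>mangoldt\<close> it sums to the logarithm of the central binomial coefficient,
  which is at most 2^(2n).\<close>

lemma psi_double: "psi (2 * n) \<le> psi n + 2 * real n * ln 2"
proof (cases "n = 0")
  case False
  have "psi (2 * n) - psi n = (\<Sum>d\<in>{n<..2*n}. mangoldt d)"
  proof -
    have "{1..2*n} = {1..n} \<union> {n<..2*n}" by auto
    hence "psi (2 * n) = (\<Sum>d\<in>{1..n} \<union> {n<..2*n}. mangoldt d)" by (simp add: psi_def)
    also have "\<dots> = psi n + (\<Sum>d\<in>{n<..2*n}. mangoldt d)"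
      unfolding psi_def by (subst sum.union_disjoint) auto
    finally show ?thesis by simp
  qed
  also have "\<dots> \<le> (\<Sum>d\<in>{n<..2*n}. mangoldt d * (real (2 * n div d) - 2 * real (n div d)))"
  proof (rule sum_mono)
    fix d assume d: "d \<in> {n<..2*n}"
    hence "2 * n div d = 1" "n div d = 0"
      using div_nat_eqI[of d 1 "2 * n"] by auto
    thus "mangoldt d \<le> mangoldt d * (real (2 * n div d) - 2 * real (n div d))" by simp
  qed
  also have "\<dots> \<le> (\<Sum>d=1..2*n. mangoldt d * (real (2 * n div d) - 2 * real (n div d)))"
  proof (rule sum_mono2)
    fix d :: nat
    have "2 * (n div d) \<le> 2 * n div d"
      by (cases "d = 0") (auto simp: less_eq_div_iff_mult_less_eq)
    hence "real (2 * (n div d)) \<le> real (2 * n div d)" by (simp only: of_nat_le_iff)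
    thus "0 \<le> mangoldt d * (real (2 * n div d) - 2 * real (n div d))"
      by (intro mult_nonneg_nonneg) (auto simp: mangoldt_nonneg)
  qed auto
  also have "\<dots> = ln (fact (2 * n)) - 2 * (\<Sum>d=1..2*n. mangoldt d * real (n div d))"
    by (simp add: ln_fact_mangoldt sum_subtractf algebra_simps sum_distrib_left)
  also have "(\<Sum>d=1..2*n. mangoldt d * real (n div d)) = ln (fact n)"
    unfolding ln_fact_mangoldt by (rule sum.mono_neutral_right) auto
  also have "ln (fact (2 * n)) - 2 * ln (fact n) = ln (real ((2 * n) choose n))"
  proof -
    have "real ((2 * n) choose n) = fact (2 * n) / (fact n * fact n)"
      by (subst binomial_fact) (auto simp: mult_2)
    thus ?thesis by (simp add: ln_div ln_mult)
  qed
  also have "\<dots> \<le> ln (2 ^ (2 * n))"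
  proof -
    have "(2 * n) choose n \<le> 2 ^ (2 * n)" by (rule binomial_le_pow2)
    hence "real ((2 * n) choose n) \<le> 2 ^ (2 * n)" by (metis of_nat_le_iff of_nat_numeral of_nat_power)
    thus ?thesis by (subst ln_le_cancel_iff) auto
  qed
  also have "\<dots> = 2 * real n * ln 2" by (simp add: ln_realpow)
  finally show ?thesis by simp
qed (auto simp: psi_def)

text \<open>The constant 4 comes from odd n = 2 k + 1, where 4 (k + 1) + 2 (k + 1) must not exceed 4
  n; equality holds at k = 1.\<close>

lemma psi_le: "psi n \<le> 4 * real n"
proof (induction n rule: less_induct)
  case (less n)
  consider "n \<le> 1" | k where "k \<ge> 1" "n = 2 * k" | k where "k \<ge> 1" "n = 2 * k + 1"
  proof (cases "n \<le> 1")
    case False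
    hence "n div 2 \<ge> 1" "n = 2 * (n div 2) \<or> n = 2 * (n div 2) + 1" by presburger+
    thus ?thesis using that by blast
  qed
  thus ?case
  proof cases
    case 1
    hence "n = 0 \<or> n = 1" by auto
    thus ?thesis by (auto simp: psi_def)
  next
    case (2 k)
    hence "psi n \<le> psi k + 2 * real k * ln 2" using psi_double by simp
    also have "psi k \<le> 4 * real k" using 2 by (intro less) auto
    also have "2 * real k * ln 2 \<le> 2 * real k * 1"
      using ln_2_less_1 by (intro mult_left_mono) auto
    finally show ?thesis using 2 by simp
  next
    case (3 k)
    have "psi n \<le> psi (2 * (k + 1))" using 3 by (intro psi_mono) auto
    also have "\<dots> \<le> psi (k + 1) + 2 * real (k + 1) * ln 2" by (rule psi_double)
    also have "psi (k + 1) \<le> 4 * real (k + 1)" using 3 by (intro less) auto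
    also have "2 * real (k + 1) * ln 2 \<le> 2 * real (k + 1) * 1"
      using ln_2_less_1 by (intro mult_left_mono) auto
    finally show ?thesis using 3 by simp
  qed
qed

text \<open>Replacing the floor of n/d by n/d in the formula for ln n! adds between 0 and psi n
  \<le> 4 n, and ln n! lies between n ln n - n and n ln n.\<close>

lemma sum_mangoldt_bounds:
  assumes "n \<ge> 1"
  shows "ln (real n) - 1 \<le> (\<Sum>d=1..n. mangoldt d / real d)"
    and "(\<Sum>d=1..n. mangoldt d / real d) \<le> ln (real n) + 4"
proof -
  let ?S = "\<Sum>d=1..n. mangoldt d / real d"
  have "ln (fact n :: real) \<le> (\<Sum>d=1..n. mangoldt d * (real n / real d))"
    unfolding ln_fact_mangoldt
    by (intro sum_mono mult_left_mono) (auto simp: mangoldt_nonneg of_nat_div_le_of_nat)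
  also have "\<dots> = real n * ?S" by (simp add: sum_distrib_left mult_ac)
  finally have 1: "ln (fact n) \<le> real n * ?S" .
  have "real n * ?S - psi n = (\<Sum>d=1..n. mangoldt d * (real n / real d - 1))"
    by (simp add: sum_distrib_left psi_def sum_subtractf algebra_simps)
  also have "\<dots> \<le> ln (fact n)"
    unfolding ln_fact_mangoldt
  proof (intro sum_mono mult_left_mono)
    fix d assume "d \<in> {1..n}"
    hence "d > 0" by simp
    hence "n mod d < d" by simp
    moreover have "d * (n div d) + n mod d = n" by (rule mult_div_mod_eq)
    ultimately have "n < d * (n div d + 1)" unfolding distrib_left by linarith
    hence "real n < real (d * (n div d + 1))" by (simp only: of_nat_less_iff)
    thus "real n / real d - 1 \<le> real (n div d)" using \<open>d > 0\<close> by (simp add: field_simps)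
  qed (auto simp: mangoldt_nonneg)
  finally have 2: "real n * ?S \<le> ln (fact n) + psi n" by simp
  have "ln (fact n :: real) \<le> ln (real n ^ n)"
    using fact_le_power[of n, where ?'a = real] assms by (subst ln_le_cancel_iff) auto
  hence "ln (fact n :: real) \<le> real n * ln (real n)" using assms by (simp add: ln_realpow)
  with 2 psi_le[of n] have "real n * ?S \<le> real n * (ln (real n) + 4)" by (simp add: algebra_simps)
  thus "?S \<le> ln (real n) + 4" using assms by simp
  have "real n * ln (real n) - real n \<le> ln (fact n)"
  proof -
    have "m \<ge> 1 \<Longrightarrow> real m * ln (real m) - real m \<le> ln (fact m)" for m
    proof (induction m rule: dec_induct)
      case (step m)
      have "ln (real (Suc m)) - ln (real m) \<le> 1 / real m"
        using step.hyps ln_diff_le[of "real (Suc m)" "real m"] by (simp add: field_simps)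
      hence "real m * (ln (real (Suc m)) - ln (real m)) \<le> real m * (1 / real m)"
        by (rule mult_left_mono) simp
      hence "real m * ln (real (Suc m)) - 1 \<le> real m * ln (real m)"
        using step.hyps by (simp add: algebra_simps)
      moreover have "ln (fact (Suc m) :: real) = ln (real (Suc m)) + ln (fact m)"
        by (simp add: ln_mult del: of_nat_Suc)
      ultimately show ?case using step.IH by (simp add: algebra_simps)
    qed auto
    thus ?thesis using assms .
  qed
  with 1 have "real n * (ln (real n) - 1) \<le> real n * ?S" by (simp add: algebra_simps)
  thus "ln (real n) - 1 \<le> ?S" using assms by simp
qed

lemma ln_le_twice_sqrt: "x > 0 \<Longrightarrow> ln x \<le> 2 * sqrt x"
  using ln_le_minus_one[of "sqrt x"] by (simp add: ln_sqrt)

text \<open>With a = sqrt (m - 1) and b = sqrt m each term is at most 6 (1/a - 1/b), which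
  telescopes. This uses ln m \<le> 2 b, b^2 - a^2 = 1 and b \<le> 3/2 a.\<close>

lemma sum_ln_over_square_bounded:
  "(\<Sum>m=2..n. ln (real m) / (real m * (real m - 1))) \<le> 6"
proof -
  have term_le: "ln (real m) / (real m * (real m - 1)) \<le> 6 * (1 / sqrt (real m - 1) - 1 / sqrt (real m))"
    if "m \<ge> 2" for m
  proof -
    define a where "a = sqrt (real m - 1)"
    define b where "b = sqrt (real m)"
    have ab: "a > 0" "b > 0" "a \<le> b" using that by (auto simp: a_def b_def)
    have sq: "real m - 1 = a\<^sup>2" "real m = b\<^sup>2" using that by (auto simp: a_def b_def)
    hence ba: "b\<^sup>2 - a\<^sup>2 = 1" by simp
    have "b\<^sup>2 \<le> 2 * a\<^sup>2" using sq that by linarith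
    hence "b \<le> sqrt (2 * a\<^sup>2)" using ab by (intro real_le_rsqrt) auto
    hence "b \<le> sqrt 2 * a" using ab by (simp add: real_sqrt_mult)
    also have "\<dots> \<le> 3 / 2 * a" using ab by (intro mult_right_mono real_le_lsqrt) (auto simp: power2_eq_square)
    finally have b: "2 * b \<le> 3 * a" by simp
    have "2 * a + 2 * b \<le> 2 * a + 3 * a" using b by simp
    also have "\<dots> \<le> 6 * a" using ab by simp
    finally have "2 * (a + b) \<le> 6 * a" by simp
    hence *: "2 * (a + b) / (a\<^sup>2 * b * (a + b)) \<le> 6 * a / (a\<^sup>2 * b * (a + b))"
      using ab by (intro divide_right_mono) auto
    have "ln (real m) / (real m * (real m - 1)) \<le> (2 * b) / (b\<^sup>2 * a\<^sup>2)"
      using ln_le_twice_sqrt[of "real m"] that unfolding sq[symmetric] b_def[symmetric]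
      by (intro divide_right_mono) auto
    also have "\<dots> = 2 / (a\<^sup>2 * b)" using ab by (simp add: power2_eq_square)
    also have "\<dots> = 2 * (a + b) / (a\<^sup>2 * b * (a + b))"
      by (rule mult_divide_mult_cancel_right[symmetric]) (use ab in auto)
    also note *
    also have "6 * a / (a\<^sup>2 * b * (a + b)) = 6 * ((b\<^sup>2 - a\<^sup>2) / (a * b * (a + b)))"
      unfolding ba using ab by (simp add: power2_eq_square)
    also have "b\<^sup>2 - a\<^sup>2 = (b - a) * (a + b)" by (simp add: power2_eq_square algebra_simps)
    also have "(b - a) * (a + b) / (a * b * (a + b)) = (b - a) / (a * b)" using ab by simp
    also have "6 * \<dots> = 6 * (1 / a - 1 / b)" using ab by (simp add: diff_divide_distrib)
    finally show ?thesis by (simp add: a_def b_def)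
  qed
  show ?thesis
  proof (cases "n \<ge> 1")
    case True
    have "(\<Sum>m=2..n. ln (real m) / (real m * (real m - 1)))
        \<le> (\<Sum>m=2..n. 6 * (1 / sqrt (real m - 1) - 1 / sqrt (real m)))"
      by (intro sum_mono term_le) auto
    also have "\<dots> = 6 - 6 / sqrt (real n)"
      using True by (induction n rule: dec_induct) (auto simp: algebra_simps)
    also have "\<dots> \<le> 6" by simp
    finally show ?thesis .
  qed auto
qed

lemma geometric_tail_le:
  fixes x :: real
  assumes "x > 1"
  shows "(\<Sum>k=2..n. 1 / x ^ k) \<le> 1 / (x * (x - 1))"
proof (cases "n \<ge> 1")
  case True
  have "(\<Sum>k=2..n. 1 / x ^ k) = 1 / (x * (x - 1)) - 1 / (x ^ n * (x - 1))"
    using True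
  proof (induction n rule: dec_induct)
    case (step n)
    have "{2..Suc n} = insert (Suc n) {2..n}" using step by auto
    moreover have "1 / x ^ Suc n = 1 / (x ^ n * (x - 1)) - 1 / (x ^ Suc n * (x - 1))"
    proof -
      define w where "w = x - 1"
      have w: "w > 0" "x = w + 1" using assms by (auto simp: w_def)
      have "1 / (v * y) = 1 / (y * w) - 1 / (v * y * w)"
        if "v \<noteq> 0" "y \<noteq> 0" "v - 1 = w" for v y
      proof -
        have "1 / (y * w) - 1 / (v * y * w) = (v - 1) / (v * y * w)"
          using that(1,2) w(1) by (simp add: field_simps)
        thus ?thesis using w(1) that(3) by simp
      qed
      from this[of x "x ^ n"] show ?thesis using assms w by simp
    qed
    ultimately show ?case using step by simp
  qed (use assms in auto)
  also have "\<dots> \<le> 1 / (x * (x - 1))" using assms by simp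
  finally show ?thesis .
qed (use assms in auto)

text \<open>The difference consists of proper prime powers, whose total weight is at most the sum of
  ln p / (p (p - 1)). The weight g will be 1 or \<chi>.\<close>

lemma mangoldt_sum_primes:
  fixes g :: "nat \<Rightarrow> real"
  assumes "\<And>d. \<bar>g d\<bar> \<le> 1"
  shows "\<bar>(\<Sum>d=1..n. g d * mangoldt d / real d)
            - (\<Sum>p | prime p \<and> p \<le> n. g p * ln (real p) / real p)\<bar> \<le> 6"
proof -
  let ?B = "{d\<in>{1..n}. primepow d \<and> \<not> prime d}"
  have "(\<Sum>d=1..n. g d * mangoldt d / real d) =
     (\<Sum>d\<in>{p. prime p \<and> p \<le> n} \<union> ?B. g d * mangoldt d / real d)"
    by (rule sum.mono_neutral_right) (auto simp: mangoldt_def prime_ge_Suc_0_nat)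
  also have "\<dots> = (\<Sum>p | prime p \<and> p \<le> n. g p * mangoldt p / real p)
                  + (\<Sum>d\<in>?B. g d * mangoldt d / real d)"
    by (rule sum.union_disjoint) auto
  also have "(\<Sum>p | prime p \<and> p \<le> n. g p * mangoldt p / real p)
           = (\<Sum>p | prime p \<and> p \<le> n. g p * ln (real p) / real p)"
    by (intro sum.cong) auto
  finally have eq: "(\<Sum>d=1..n. g d * mangoldt d / real d)
            - (\<Sum>p | prime p \<and> p \<le> n. g p * ln (real p) / real p)
       = (\<Sum>d\<in>?B. g d * mangoldt d / real d)" by simp
  have "\<bar>\<Sum>d\<in>?B. g d * mangoldt d / real d\<bar> \<le> (\<Sum>d\<in>?B. \<bar>g d * mangoldt d / real d\<bar>)"
    by (rule sum_abs)
  also have "\<dots> \<le> (\<Sum>d\<in>?B. mangoldt d / real d)"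
    using assms by (intro sum_mono) (auto simp: abs_mult intro!: divide_right_mono
        mult_left_le_one_le mangoldt_nonneg)
  also have "\<dots> \<le> (\<Sum>d\<in>(\<lambda>(p, k). p ^ k) ` ({p. prime p \<and> p \<le> n} \<times> {2..n}). mangoldt d / real d)"
  proof (rule sum_mono2)
    show "?B \<subseteq> (\<lambda>(p, k). p ^ k) ` ({p. prime p \<and> p \<le> n} \<times> {2..n})"
    proof
      fix d assume d: "d \<in> ?B"
      then obtain p k where pk: "prime p" "k > 0" "d = p ^ k" by (auto simp: primepow_def)
      have "k \<noteq> 1" using d pk by auto
      hence "k \<ge> 2" using pk by simp
      have "p \<le> p ^ k" using pk prime_ge_1_nat[of p] by (intro self_le_power) auto
      moreover have "k < p ^ k" by (rule power_gt_expt[OF prime_gt_Suc_0_nat[OF pk(1)]])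
      ultimately show "d \<in> (\<lambda>(p, k). p ^ k) ` ({p. prime p \<and> p \<le> n} \<times> {2..n})"
        using d pk \<open>k \<ge> 2\<close> by (auto intro!: image_eqI[of _ _ "(p, k)"])
    qed
  qed (auto simp: mangoldt_nonneg)
  also have "\<dots> \<le> (\<Sum>(p, k)\<in>{p. prime p \<and> p \<le> n} \<times> {2..n}. mangoldt (p ^ k) / real (p ^ k))"
    using sum_image_le[of "{p. prime p \<and> p \<le> n} \<times> {2..n}" "\<lambda>d. mangoldt d / real d" "\<lambda>(p, k). p ^ k"]
    by (auto simp: mangoldt_nonneg case_prod_unfold)
  also have "\<dots> = (\<Sum>p | prime p \<and> p \<le> n. \<Sum>k=2..n. mangoldt (p ^ k) / real (p ^ k))"
    by (subst sum.cartesian_product) auto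
  also have "\<dots> = (\<Sum>p | prime p \<and> p \<le> n. ln (real p) * (\<Sum>k=2..n. 1 / real p ^ k))"
    unfolding sum_distrib_left by (intro sum.cong) auto
  also have "\<dots> \<le> (\<Sum>p | prime p \<and> p \<le> n. ln (real p) * (1 / (real p * (real p - 1))))"
    by (intro sum_mono mult_left_mono geometric_tail_le)
      (auto simp: prime_gt_Suc_0_nat prime_gt_0_nat prime_ge_Suc_0_nat)
  also have "\<dots> \<le> (\<Sum>m=2..n. ln (real m) * (1 / (real m * (real m - 1))))"
    by (intro sum_mono2) (auto simp: prime_ge_2_nat)
  also have "\<dots> \<le> 6" using sum_ln_over_square_bounded[of n] by simp
  finally show ?thesis unfolding eq .
qed

lemma mertens:
  assumes "n \<ge> 1"
  shows "\<bar>(\<Sum>p | prime p \<and> p \<le> n. ln (real p) / real p) - ln (real n)\<bar> \<le> 10"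
  using mangoldt_sum_primes[of "\<lambda>_. 1" n] sum_mangoldt_bounds[OF assms] by (simp add: abs_le_iff)

section \<open>Real characters and the nonvanishing of \<open>L(1, \<chi>)\<close>\<close>

text \<open>The vanishing sum over a period expresses that \<chi> is not principal; it bounds all
  partial sums by q. Realness makes the convolution of \<chi> with 1 nonnegative.\<close>

locale real_character =
  fixes \<chi> :: "nat \<Rightarrow> real" and q :: nat
  assumes q_pos: "q > 0"
    and chi_mult: "\<chi> (a * b) = \<chi> a * \<chi> b"
    and chi_1: "\<chi> 1 = 1"
    and chi_values: "\<chi> a \<in> {-1, 0, 1}"
    and chi_periodic: "\<chi> (a + q) = \<chi> a"
    and chi_sum: "(\<Sum>a<q. \<chi> a) = 0"
begin

lemma chi_abs_le: "\<bar>\<chi> a\<bar> \<le> 1"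
  using chi_values[of a] by auto

lemma chi_window: "(\<Sum>a=m..<m + q. \<chi> a) = 0"
proof (induction m)
  case 0
  thus ?case using chi_sum by (simp add: lessThan_atLeast0)
next
  case (Suc m)
  have "(\<Sum>a=m..<Suc (m + q). \<chi> a) = (\<Sum>a=m..<m + q. \<chi> a) + \<chi> (m + q)" by simp
  moreover have "(\<Sum>a=m..<Suc (m + q). \<chi> a) = \<chi> m + (\<Sum>a=Suc m..<Suc (m + q). \<chi> a)"
    by (rule sum.atLeast_Suc_lessThan) simp
  ultimately show ?case using Suc chi_periodic[of m] by simp
qed

lemma chi_sum_bound: "\<bar>\<Sum>a=m..<n. \<chi> a\<bar> \<le> real q"
proof (induction n rule: less_induct)
  case (less n)
  show ?case
  proof (cases "n < m + q")
    case True
    have "\<bar>\<Sum>a=m..<n. \<chi> a\<bar> \<le> (\<Sum>a=m..<n. 1)"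
      by (rule order_trans[OF sum_abs sum_mono]) (rule chi_abs_le)
    thus ?thesis using True by simp
  next
    case False
    have "(\<Sum>a=m..<n. \<chi> a) = (\<Sum>a=m..<n - q. \<chi> a) + (\<Sum>a=n - q..<n - q + q. \<chi> a)"
      using False by (subst sum.atLeastLessThan_concat) auto
    also have "\<dots> = (\<Sum>a=m..<n - q. \<chi> a)" by (simp only: chi_window)
    finally show ?thesis using less[of "n - q"] False q_pos by simp
  qed
qed

section \<open>Abel summation and convergence at s = 1\<close>

lemma abel_identity:
  fixes f :: "nat \<Rightarrow> real"
  assumes "m \<le> n"
  shows "(\<Sum>a=m..<n. \<chi> a * f a) = (\<Sum>a=m..<n. \<chi> a) * f n
           + (\<Sum>a=m..<n. (\<Sum>b=m..<Suc a. \<chi> b) * (f a - f (Suc a)))"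
  using assms by (induction n rule: dec_induct) (auto simp: algebra_simps)

lemma abel_bound:
  fixes f :: "nat \<Rightarrow> real"
  assumes "m \<le> n" and dec: "\<And>a. m \<le> a \<Longrightarrow> f (Suc a) \<le> f a" and nn: "\<And>a. m \<le> a \<Longrightarrow> 0 \<le> f a"
  shows "\<bar>\<Sum>a=m..<n. \<chi> a * f a\<bar> \<le> real q * f m"
proof -
  have "\<bar>\<Sum>a=m..<n. \<chi> a * f a\<bar> \<le> \<bar>(\<Sum>a=m..<n. \<chi> a) * f n\<bar>
           + \<bar>\<Sum>a=m..<n. (\<Sum>b=m..<Suc a. \<chi> b) * (f a - f (Suc a))\<bar>"
    unfolding abel_identity[OF assms(1)] by (rule abs_triangle_ineq)
  also have "\<bar>(\<Sum>a=m..<n. \<chi> a) * f n\<bar> \<le> real q * f n"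
    unfolding abs_mult using nn[OF assms(1)] chi_sum_bound[of m n] by (simp add: mult_right_mono)
  also have "\<bar>\<Sum>a=m..<n. (\<Sum>b=m..<Suc a. \<chi> b) * (f a - f (Suc a))\<bar>
     \<le> (\<Sum>a=m..<n. real q * (f a - f (Suc a)))"
  proof (rule order_trans[OF sum_abs], rule sum_mono)
    fix a assume "a \<in> {m..<n}"
    hence "0 \<le> f a - f (Suc a)" using dec[of a] by auto
    thus "\<bar>(\<Sum>b=m..<Suc a. \<chi> b) * (f a - f (Suc a))\<bar> \<le> real q * (f a - f (Suc a))"
      unfolding abs_mult using chi_sum_bound[of m "Suc a"] by (simp add: mult_right_mono)
  qed
  also have "(\<Sum>a=m..<n. real q * (f a - f (Suc a))) = real q * (f m - f n)"
    unfolding sum_distrib_left[symmetric] using assms(1)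
    by (induction n rule: dec_induct) auto
  finally show ?thesis by (simp add: algebra_simps)
qed

definition Lsum :: "nat \<Rightarrow> real" where "Lsum n = (\<Sum>k=1..n. \<chi> k / real k)"

lemma Lsum_diff:
  assumes "m \<le> n"
  shows "\<bar>Lsum n - Lsum m\<bar> \<le> real q / real (Suc m)"
proof -
  have "Lsum n - Lsum m = (\<Sum>k=Suc m..<Suc n. \<chi> k * (1 / real k))"
  proof -
    have "{1..n} = {1..m} \<union> {Suc m..<Suc n}" using assms by auto
    hence "Lsum n = (\<Sum>k\<in>{1..m} \<union> {Suc m..<Suc n}. \<chi> k / real k)" by (simp add: Lsum_def)
    also have "\<dots> = Lsum m + (\<Sum>k=Suc m..<Suc n. \<chi> k / real k)"
      unfolding Lsum_def by (rule sum.union_disjoint) auto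
    finally show ?thesis by simp
  qed
  also have "\<bar>\<dots>\<bar> \<le> real q * (1 / real (Suc m))"
    using assms by (intro abel_bound) (auto simp: field_simps)
  finally show ?thesis by simp
qed

lemma Lsum_convergent: "convergent Lsum"
proof (rule real_Cauchy_convergent, rule CauchyI')
  fix e :: real assume e: "e > 0"
  obtain M where M: "real q / e < real M" using reals_Archimedean2 by blast
  hence *: "real q < e * real (Suc M)" using e by (simp add: field_simps)
  show "\<exists>M. \<forall>m\<ge>M. \<forall>n>m. dist (Lsum m) (Lsum n) < e"
  proof (intro exI[of _ M] allI impI)
    fix m n assume mn: "M \<le> m" "m < n"
    have "dist (Lsum m) (Lsum n) \<le> real q / real (Suc m)"
      using Lsum_diff[of m n] mn by (simp add: dist_real_def abs_minus_commute)
    also have "\<dots> \<le> real q / real (Suc M)" using mn by (intro divide_left_mono) auto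
    also have "\<dots> < e" using * by (simp add: field_simps)
    finally show "dist (Lsum m) (Lsum n) < e" .
  qed
qed

definition L1 :: real where "L1 = lim Lsum"

lemma Lsum_L1: "\<bar>Lsum m - L1\<bar> \<le> real q / real (Suc m)"
proof -
  have "Lsum \<longlonglongrightarrow> L1" unfolding L1_def using Lsum_convergent by (simp add: convergent_LIMSEQ_iff)
  hence "(\<lambda>n. \<bar>Lsum n - Lsum m\<bar>) \<longlonglongrightarrow> \<bar>L1 - Lsum m\<bar>" by (intro tendsto_intros)
  hence "\<bar>L1 - Lsum m\<bar> \<le> real q / real (Suc m)"
    by (rule LIMSEQ_le_const2) (use Lsum_diff in blast)
  thus ?thesis by (simp add: abs_minus_commute)
qed

text \<open>The Dirichlet convolution of \<chi> with 1. Being nonnegative, and at least 1 at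
  squares, it makes its power series large near t = 1.\<close>

definition div_sum :: "nat \<Rightarrow> real" where "div_sum n = (\<Sum>d | d dvd n. \<chi> d)"

lemma chi_power: "\<chi> (a ^ k) = \<chi> a ^ k"
  by (induction k) (auto simp: chi_mult chi_1[unfolded One_nat_def])

lemma div_sum_prime_power_mult:
  assumes p: "prime p" "coprime p l" "l > 0"
  shows "div_sum (p ^ k * l) = (\<Sum>i\<le>k. \<chi> p ^ i) * div_sum l"
proof -
  have "div_sum (p ^ k * l) = (\<Sum>(i, d)\<in>{..k} \<times> {d. d dvd l}. \<chi> (p ^ i * d))"
    unfolding div_sum_def
  proof (rule sum.reindex_cong[where l = "\<lambda>(i, d). p ^ i * d"])
    show "inj_on (\<lambda>(i, d). p ^ i * d) ({..k} \<times> {d. d dvd l})"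
    proof (rule inj_onI, clarify)
      fix i d j e assume *: "d dvd l" "e dvd l" "p ^ i * d = p ^ j * e"
      have "\<not> p dvd l" using p(1,2) by (metis coprime_absorb_left not_prime_unit)
      hence nd: "\<not> p dvd d" "\<not> p dvd e" "d \<noteq> 0" "e \<noteq> 0"
        using *(1,2) p(3) by (auto dest: dvd_trans)
      have "multiplicity p (p ^ i * d) = i" "multiplicity p (p ^ j * e) = j"
        using p(1) nd by (auto simp: prime_elem_multiplicity_mult_distrib not_dvd_imp_multiplicity_0)
      hence "i = j" using *(3) by simp
      thus "i = j \<and> d = e" using *(3) p(1) by (auto simp: prime_gt_0_nat)
    qed
    show "{d. d dvd p ^ k * l} = (\<lambda>(i, d). p ^ i * d) ` ({..k} \<times> {d. d dvd l})"
    proof (intro equalityI subsetI)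
      fix d assume "d \<in> {d. d dvd p ^ k * l}"
      then obtain a b where "d = a * b" "a dvd p ^ k" "b dvd l" using division_decomp by blast
      moreover from this obtain i where "i \<le> k" "a = p ^ i" using p(1) divides_primepow_nat by blast
      ultimately show "d \<in> (\<lambda>(i, d). p ^ i * d) ` ({..k} \<times> {d. d dvd l})" by force
    qed (auto intro: mult_dvd_mono le_imp_power_dvd)
  qed auto
  also have "\<dots> = (\<Sum>i\<le>k. \<chi> p ^ i) * div_sum l"
    by (simp add: chi_mult chi_power div_sum_def sum_product sum.cartesian_product)
  finally show ?thesis .
qed

lemma geom_chi:
  "(\<Sum>i\<le>k. \<chi> p ^ i) \<ge> 0" "even k \<Longrightarrow> (\<Sum>i\<le>k. \<chi> p ^ i) \<ge> 1"
proof -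
  have a: "(\<Sum>i\<le>k. (-1 :: real) ^ i) = (if even k then 1 else 0)"
    by (induction k) auto
  have b: "(\<Sum>i\<le>k. (0 :: real) ^ i) = 1"
    by (induction k) auto
  show "(\<Sum>i\<le>k. \<chi> p ^ i) \<ge> 0" "even k \<Longrightarrow> (\<Sum>i\<le>k. \<chi> p ^ i) \<ge> 1"
    using chi_values[of p] a b by auto
qed

lemma prime_power_split:
  fixes n :: nat
  assumes "n > 1"
  obtains p k l where "prime p" "n = p ^ k * l" "coprime p l" "l > 0" "l < n" "k > 0"
proof -
  obtain p where p: "prime p" "p dvd n" using prime_factor_nat[of n] assms by auto
  define k where "k = multiplicity p n"
  obtain l where l: "n = p ^ k * l" "\<not> p dvd l"
    unfolding k_def using multiplicity_decompose'[of n p] assms p(1)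
    by (metis mult.commute not_gr_zero not_less_zero not_prime_unit zero_less_one less_trans)
  have "k > 0" unfolding k_def using p assms by (simp add: prime_multiplicity_gt_zero_iff)
  moreover have "l > 0" using l assms by (intro Nat.gr0I) auto
  moreover have "p ^ k > 1" by (rule one_less_power[OF prime_gt_1_nat[OF p(1)] \<open>k > 0\<close>])
  hence "l < n" using l(1) \<open>l > 0\<close> by simp
  moreover have "coprime p l" using p(1) l(2) by (simp add: prime_imp_coprime)
  ultimately show ?thesis using that p(1) l(1) by blast
qed

lemma div_sum_nonneg: "n > 0 \<Longrightarrow> div_sum n \<ge> 0"
proof (induction n rule: less_induct)
  case (less n)
  show ?case
  proof (cases "n = 1")
    case True
    thus ?thesis using chi_1 by (simp add: div_sum_def)
  next
    case False
    then obtain p k l where "prime p" "n = p ^ k * l" "coprime p l" "l > 0" "l < n" "k > 0"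
      using prime_power_split[of n] less.prems by (metis One_nat_def Suc_lessI)
    thus ?thesis using less.IH[of l] div_sum_prime_power_mult geom_chi(1) by simp
  qed
qed

lemma div_sum_square: "n > 0 \<Longrightarrow> div_sum (n\<^sup>2) \<ge> 1"
proof (induction n rule: less_induct)
  case (less n)
  show ?case
  proof (cases "n = 1")
    case True
    thus ?thesis using chi_1 by (simp add: div_sum_def)
  next
    case False
    then obtain p k l where p: "prime p" "n = p ^ k * l" "coprime p l" "l > 0" "l < n" "k > 0"
      using prime_power_split[of n] less.prems by (metis One_nat_def Suc_lessI)
    have "n\<^sup>2 = p ^ (2 * k) * l\<^sup>2"
      unfolding p(2) power_mult_distrib by (simp add: power_mult[symmetric] mult.commute)
    hence "div_sum (n\<^sup>2) = (\<Sum>i\<le>2 * k. \<chi> p ^ i) * div_sum (l\<^sup>2)"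
      using div_sum_prime_power_mult[of p "l\<^sup>2" "2 * k"] p by simp
    moreover have "1 * 1 \<le> (\<Sum>i\<le>2 * k. \<chi> p ^ i) * div_sum (l\<^sup>2)"
      using less.IH[of l] p geom_chi(2)[of "2 * k" p] by (intro mult_mono) auto
    ultimately show ?thesis by simp
  qed
qed

end

text \<open>The terms t^i and t^(n-1-i) are paired by the arithmetic-geometric mean
  inequality.\<close>

lemma sum_powers_ge:
  fixes t :: real
  assumes "0 < t" "t < 1"
  shows "(\<Sum>i<n. t ^ i)\<^sup>2 \<ge> (real n)\<^sup>2 * t ^ (n - 1)"
proof (cases "n = 0")
  case False
  have pair: "(\<Sum>i<n. t ^ i) + (\<Sum>i<n. t ^ (n - 1 - i)) \<ge> (\<Sum>i<n. 2 * sqrt (t ^ (n - 1)))"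
    unfolding sum.distrib[symmetric]
  proof (rule sum_mono)
    fix i assume "i \<in> {..<n}"
    hence "t ^ (n - 1) = t ^ i * t ^ (n - 1 - i)" by (simp add: power_add[symmetric])
    thus "2 * sqrt (t ^ (n - 1)) \<le> t ^ i + t ^ (n - 1 - i)"
      using arith_geo_mean_sqrt[of "t ^ i" "t ^ (n - 1 - i)"] assms by simp
  qed
  have "(\<Sum>i<n. t ^ (n - 1 - i)) = (\<Sum>i<n. t ^ i)"
    using sum.nat_diff_reindex[of "\<lambda>i. t ^ i" n] by simp
  with pair have "(\<Sum>i<n. t ^ i) \<ge> real n * sqrt (t ^ (n - 1))" by simp
  hence "(\<Sum>i<n. t ^ i)\<^sup>2 \<ge> (real n * sqrt (t ^ (n - 1)))\<^sup>2"
    using assms by (intro power_mono) auto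
  thus ?thesis using assms by (simp add: power_mult_distrib)
qed auto

text \<open>The comparison sequence of Monsky's proof that \<open>L(1, \<chi>) \<noteq> 0\<close>.\<close>

definition monsky :: "real \<Rightarrow> nat \<Rightarrow> real" where
  "monsky t n = 1 / (real n * (1 - t)) - t ^ n / (1 - t ^ n)"

text \<open>Put g n = 1 + t + ... + t^(n-1); then (1 - t) times \<open>monsky t n\<close> is 1/n -
  t^n / g n. Because g (n+1) - t g n = 1, its decrement is 1 / (n (n+1)) minus t^n / (g n g (n+1)),
  and \<open>sum_powers_ge\<close> bounds that product of g's below by n (n+1) t^n.\<close>

lemma monsky_props:
  assumes t: "0 < t" "t < 1" and n: "n \<ge> 1"
  shows "monsky t (Suc n) \<le> monsky t n" "monsky t n \<ge> 0"
proof -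
  define g where "g = (\<lambda>n. \<Sum>i<n. t ^ i)"
  have g: "1 - t ^ n = (1 - t) * g n" for n
    unfolding g_def by (rule one_diff_power_eq)
  have gpos: "g n > 0" if "n \<ge> 1" for n
    unfolding g_def using that t by (intro sum_pos) (auto simp: lessThan_empty_iff)
  have gn: "g n \<le> real n"
  proof -
    have "g n \<le> (\<Sum>i<n. 1)" unfolding g_def using t by (intro sum_mono power_le_one) auto
    thus ?thesis by simp
  qed
  have gt: "real n * t ^ n \<le> g n"
  proof -
    have "(\<Sum>i<n. t ^ n) \<le> g n" unfolding g_def using t by (intro sum_mono power_decreasing) auto
    thus ?thesis by simp
  qed
  have "monsky t n = (1 / real n - t ^ n / g n) / (1 - t)"
    unfolding monsky_def g by (simp add: diff_divide_distrib mult.commute)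
  moreover have "t ^ n / g n \<le> 1 / real n" using gt gpos[OF n] n by (simp add: field_simps)
  ultimately show "monsky t n \<ge> 0" using t by simp
  have "t ^ n / g n - t ^ Suc n / g (Suc n) = t ^ n / (g n * g (Suc n))"
  proof -
    have "g (Suc n) - t * g n = 1"
      using g[of n] by (simp add: g_def algebra_simps)
    have "t ^ n / g n - t ^ Suc n / g (Suc n) = t ^ n * (g (Suc n) - t * g n) / (g n * g (Suc n))"
      using gpos[OF n] gpos[of "Suc n"] by (simp add: field_simps)
    thus ?thesis using \<open>g (Suc n) - t * g n = 1\<close> by simp
  qed
  moreover have "t ^ n / (g n * g (Suc n)) \<le> 1 / (real n * real (Suc n))"
  proof -
    have "(real n * real (Suc n) * t ^ n)\<^sup>2 \<le> ((real n)\<^sup>2 * t ^ (n - 1)) * ((real (Suc n))\<^sup>2 * t ^ n)"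
    proof -
      have "t ^ n * t ^ n \<le> t ^ (n - 1) * t ^ n"
        using t by (intro mult_right_mono power_decreasing) auto
      hence "((real n)\<^sup>2 * (real (Suc n))\<^sup>2) * (t ^ n * t ^ n)
          \<le> ((real n)\<^sup>2 * (real (Suc n))\<^sup>2) * (t ^ (n - 1) * t ^ n)"
        by (intro mult_left_mono) auto
      thus ?thesis by (simp add: power2_eq_square mult_ac)
    qed
    also have "\<dots> \<le> (g n)\<^sup>2 * (g (Suc n))\<^sup>2"
      using sum_powers_ge[OF t, of n] sum_powers_ge[OF t, of "Suc n"] t
      unfolding g_def by (intro mult_mono) auto
    finally have "(real n * real (Suc n) * t ^ n)\<^sup>2 \<le> (g n * g (Suc n))\<^sup>2"
      by (simp add: power_mult_distrib)
    hence "real n * real (Suc n) * t ^ n \<le> g n * g (Suc n)"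
      by (rule power2_le_imp_le) (use gpos[OF n] gpos[of "Suc n"] in auto)
    moreover have "v / c \<le> 1 / a" if "a * v \<le> c" "a > 0" "c > 0" for a c v :: real
      using that by (simp add: field_simps)
    ultimately show ?thesis using gpos[OF n] gpos[of "Suc n"] n by simp
  qed
  moreover have "1 / (real n * real (Suc n)) = 1 / real n - 1 / real (Suc n)"
    using n by (simp add: field_simps)
  ultimately have "1 / real (Suc n) - t ^ Suc n / g (Suc n) \<le> 1 / real n - t ^ n / g n" by simp
  hence "(1 / real (Suc n) - t ^ Suc n / g (Suc n)) / (1 - t) \<le> (1 / real n - t ^ n / g n) / (1 - t)"
    using t by (intro divide_right_mono) auto
  thus "monsky t (Suc n) \<le> monsky t n"
    unfolding monsky_def g by (simp add: diff_divide_distrib mult.commute)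
qed

context real_character
begin

text \<open>Geometric expansion of t^n / (1 - t^n) turns the Lambert series of \<chi> into the power
  series of \<open>div_sum\<close>. With both cut at M, the expansion for n stops at exponent M div
  n, at a cost of at most t^M / (1 - t).\<close>

lemma lambert_lower:
  assumes t: "0 < t" "t < 1"
  shows "(\<Sum>j=1..M. div_sum j * t ^ j)
         \<le> (\<Sum>n=1..M. \<chi> n * (t ^ n / (1 - t ^ n))) + real M * t ^ M / (1 - t)"
proof -
  have "(\<Sum>j=1..M. div_sum j * t ^ j) = (\<Sum>j=1..M. \<Sum>d | d dvd j. \<chi> d * t ^ j)"
    by (simp add: div_sum_def sum_distrib_right)
  also have "\<dots> = (\<Sum>n=1..M. \<Sum>k=1..M div n. \<chi> n * t ^ (n * k))"
    by (rule sum_divisors_swap)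
  also have "\<dots> \<le> (\<Sum>n=1..M. \<chi> n * (t ^ n / (1 - t ^ n)) + t ^ M / (1 - t))"
  proof (rule sum_mono)
    fix n assume n: "n \<in> {1..M}"
    define u where "u = t ^ n"
    have u: "0 < u" "u \<le> t" "u < 1"
      using t n power_decreasing[of 1 n t] unfolding u_def by auto
    define K where "K = M div n"
    have "(\<Sum>k=1..K. u ^ k) * (1 - u) = u - u ^ Suc K"
      by (induction K) (auto simp: distrib_right, simp add: algebra_simps)
    hence "(\<Sum>k=1..K. u ^ k) = u / (1 - u) - u ^ Suc K / (1 - u)"
      using u by (simp add: nonzero_eq_divide_eq diff_divide_distrib[symmetric])
    hence "(\<Sum>k=1..K. \<chi> n * t ^ (n * k)) = \<chi> n * (u / (1 - u)) - \<chi> n * (u ^ Suc K / (1 - u))"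
      by (simp add: sum_distrib_left[symmetric] u_def power_mult right_diff_distrib)
    also have "- (\<chi> n * (u ^ Suc K / (1 - u))) \<le> \<bar>\<chi> n\<bar> * (u ^ Suc K / (1 - u))"
      unfolding mult_minus_left[symmetric] using u by (intro mult_right_mono) auto
    hence "\<chi> n * (u / (1 - u)) - \<chi> n * (u ^ Suc K / (1 - u))
        \<le> \<chi> n * (u / (1 - u)) + \<bar>\<chi> n\<bar> * (u ^ Suc K / (1 - u))" by simp
    also have "\<bar>\<chi> n\<bar> * (u ^ Suc K / (1 - u)) \<le> 1 * (t ^ M / (1 - t))"
    proof (intro mult_mono frac_le chi_abs_le)
      have "M \<le> n * Suc K"
      proof -
        have "M mod n < n" using n by simp
        moreover have "n * K + M mod n = M" unfolding K_def by (rule mult_div_mod_eq)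
        ultimately show ?thesis unfolding mult_Suc_right by linarith
      qed
      thus "u ^ Suc K \<le> t ^ M"
        unfolding u_def power_mult[symmetric] using t by (intro power_decreasing) auto
    qed (use u t in auto)
    finally show "(\<Sum>k=1..M div n. \<chi> n * t ^ (n * k)) \<le> \<chi> n * (t ^ n / (1 - t ^ n)) + t ^ M / (1 - t)"
      by (simp add: K_def u_def)
  qed
  also have "\<dots> = (\<Sum>n=1..M. \<chi> n * (t ^ n / (1 - t ^ n))) + real M * t ^ M / (1 - t)"
    by (simp add: sum.distrib)
  finally show ?thesis .
qed

text \<open>The Lambert term is \<chi>(n) / (n (1 - t)) minus \<chi>(n) times
  \<open>monsky t n\<close>. The first part has small partial sums because L1 = 0. The second is
  bounded by q uniformly in t, as \<open>monsky t\<close> decreases from 1.\<close>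

lemma lambert_upper:
  assumes t: "0 < t" "t < 1" and "L1 = 0"
  shows "(\<Sum>n=1..M. \<chi> n * (t ^ n / (1 - t ^ n))) \<le> real q + real q / (real (Suc M) * (1 - t))"
proof -
  have "(\<Sum>n=1..M. \<chi> n * (t ^ n / (1 - t ^ n)))
      = Lsum M / (1 - t) - (\<Sum>n=1..<Suc M. \<chi> n * monsky t n)"
  proof -
    have "(\<Sum>n=1..<Suc M. \<chi> n * monsky t n)
       = (\<Sum>n=1..M. (\<chi> n / real n) * (1 / (1 - t)) - \<chi> n * (t ^ n / (1 - t ^ n)))"
      by (intro sum.cong) (auto simp: monsky_def right_diff_distrib)
    also have "\<dots> = Lsum M * (1 / (1 - t)) - (\<Sum>n=1..M. \<chi> n * (t ^ n / (1 - t ^ n)))"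
      unfolding Lsum_def sum_subtractf sum_distrib_right ..
    finally show ?thesis by simp
  qed
  also have "\<dots> \<le> \<bar>Lsum M\<bar> / (1 - t) + \<bar>\<Sum>n=1..<Suc M. \<chi> n * monsky t n\<bar>"
  proof -
    have "Lsum M / (1 - t) \<le> \<bar>Lsum M\<bar> / (1 - t)" using t by (intro divide_right_mono) auto
    thus ?thesis by linarith
  qed
  also have "\<bar>\<Sum>n=1..<Suc M. \<chi> n * monsky t n\<bar> \<le> real q * monsky t 1"
    using monsky_props[OF t] by (intro abel_bound) auto
  also have "monsky t 1 = 1" using t by (simp add: monsky_def diff_divide_distrib[symmetric])
  also have "\<bar>Lsum M\<bar> / (1 - t) \<le> (real q / real (Suc M)) / (1 - t)"
    using Lsum_L1[of M] assms(3) t by (intro divide_right_mono) auto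
  finally show ?thesis by simp
qed

lemma L1_nonzero: "L1 \<noteq> 0"
proof
  assume L: "L1 = 0"
  \<comment> \<open>For large M the two bounds give K/2 \<le> q, which this K contradicts. The value
    of t keeps t^(K^2) \<ge> 1/2 by Bernoulli's inequality, so that each square up to K^2
    contributes at least 1/2.\<close>
  define K where "K = 4 * q + 4"
  define t where "t = 1 - 1 / (2 * (real K)\<^sup>2)"
  have K1: "(real K)\<^sup>2 \<ge> 1" by (simp add: K_def)
  have "real K > 0" by (simp add: K_def)
  hence K2: "1 / (2 * (real K)\<^sup>2) \<le> 1 / (2 * 1)" using K1 by (intro divide_left_mono) auto
  have "1 / (2 * (real K)\<^sup>2) > 0" using \<open>real K > 0\<close> by simp
  hence t: "0 < t" "t < 1"
    unfolding t_def using K2 by linarith+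
  have tK: "t ^ (K\<^sup>2) \<ge> 1 / 2"
  proof -
    have "1 + real (K\<^sup>2) * (- 1 / (2 * (real K)\<^sup>2)) \<le> (1 + (- 1 / (2 * (real K)\<^sup>2))) ^ (K\<^sup>2)"
      using K2 by (intro Bernoulli_inequality) simp
    thus ?thesis using \<open>real K > 0\<close> by (simp add: t_def)
  qed
  have low: "real K / 2 \<le> (\<Sum>j=1..M. div_sum j * t ^ j)" if "M \<ge> K\<^sup>2" for M
  proof -
    have "real K / 2 = (\<Sum>k=1..K. 1 / 2)" by simp
    also have "\<dots> \<le> (\<Sum>k=1..K. div_sum (k\<^sup>2) * t ^ (k\<^sup>2))"
    proof (rule sum_mono)
      fix k assume k: "k \<in> {1..K}"
      have "1 / 2 \<le> t ^ (K\<^sup>2)" by (rule tK)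
      also have "\<dots> \<le> t ^ (k\<^sup>2)" using t k by (intro power_decreasing power_mono) auto
      also have "\<dots> = 1 * t ^ (k\<^sup>2)" by simp
      also have "\<dots> \<le> div_sum (k\<^sup>2) * t ^ (k\<^sup>2)"
        using k t by (intro mult_right_mono div_sum_square) auto
      finally show "1 / 2 \<le> div_sum (k\<^sup>2) * t ^ (k\<^sup>2)" .
    qed
    also have "\<dots> = (\<Sum>j\<in>(\<lambda>k. k\<^sup>2) ` {1..K}. div_sum j * t ^ j)"
      by (subst sum.reindex) (auto simp: inj_on_def power2_eq_iff_nonneg)
    also have "\<dots> \<le> (\<Sum>j=1..M. div_sum j * t ^ j)"
    proof (rule sum_mono2)
      show "(\<lambda>k. k\<^sup>2) ` {1..K} \<subseteq> {1..M}"
      proof clarify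
        fix k assume "k \<in> {1..K}"
        hence "k\<^sup>2 \<le> K\<^sup>2" by (intro power_mono) auto
        from order_trans[OF this that] show "k\<^sup>2 \<in> {1..M}" using \<open>k \<in> {1..K}\<close> by simp
      qed
    qed (use t div_sum_nonneg in auto)
    finally show ?thesis .
  qed
  have bound: "real K / 2 \<le> real q + (real q / (1 - t)) * (1 / real (Suc M)) + (real M * t ^ M) / (1 - t)"
    if "M \<ge> K\<^sup>2" for M
  proof -
    have "real q / (1 - t) * (1 / real (Suc M)) = real q / (real (Suc M) * (1 - t))"
      by (simp add: mult.commute)
    thus ?thesis
      using low[OF that] lambert_lower[OF t, of M] lambert_upper[OF t L, of M] by linarith
  qed
  have "(\<lambda>M. real q + (real q / (1 - t)) * (1 / real (Suc M)) + (real M * t ^ M) / (1 - t))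
      \<longlonglongrightarrow> real q + (real q / (1 - t)) * 0 + 0 / (1 - t)"
  proof (intro tendsto_add tendsto_mult tendsto_const tendsto_divide)
    show "(\<lambda>M. 1 / real (Suc M)) \<longlonglongrightarrow> 0" by (rule LIMSEQ_Suc[OF lim_1_over_n])
    show "(\<lambda>M. real M * t ^ M) \<longlonglongrightarrow> 0" using powser_times_n_limit_0[of t] t by simp
  qed (use t in auto)
  hence "real K / 2 \<le> real q + (real q / (1 - t)) * 0 + 0 / (1 - t)"
    by (rule LIMSEQ_le_const) (use bound in blast)
  thus False by (simp add: K_def)
qed

end

section \<open>Mertens' estimate twisted by \<chi>\<close>

lemma ln_div_antimono:
  assumes "a \<ge> 3"
  shows "ln (real (Suc a)) / real (Suc a) \<le> ln (real a) / real a"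
proof -
  have a: "real a > 0" using assms by simp
  have "ln (real (Suc a)) - ln (real a) \<le> (real (Suc a) - real a) / real a"
    using a by (intro ln_diff_le) auto
  hence "real a * (ln (real (Suc a)) - ln (real a)) \<le> real a * ((real (Suc a) - real a) / real a)"
    using a by (intro mult_left_mono) auto
  also have "\<dots> = 1" using a by simp
  also have "1 \<le> ln (real a)"
    using a assms exp_le by (subst ln_ge_iff) auto
  finally have "real a * ln (real (Suc a)) \<le> real (Suc a) * ln (real a)"
    by (simp add: algebra_simps)
  thus ?thesis using a by (simp add: field_simps)
qed

context real_character
begin

lemma chi_ln_sum_bounded: "\<bar>\<Sum>n=1..x. \<chi> n * (ln (real n) / real n)\<bar> \<le> real q + 1"
proof -
  have ln2: "\<bar>\<chi> 2 * (ln 2 / 2)\<bar> \<le> 1"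
  proof -
    have "\<bar>\<chi> 2\<bar> * (ln 2 / 2) \<le> 1 * 1"
      using ln_2_less_1 by (intro mult_mono chi_abs_le) auto
    thus ?thesis by (simp add: abs_mult)
  qed
  consider "x = 0" | "x = 1" | "x \<ge> 2" by linarith
  thus ?thesis
  proof cases
    case 3
    \<comment> \<open>ln n / n decreases only from n = 3 on; the term at 1 is 0 and the term at 2 is
      at most 1 in absolute value.\<close>
    have "{1..x} = {1, 2} \<union> {3..<Suc x}" using 3 by auto
    hence "(\<Sum>n=1..x. \<chi> n * (ln (real n) / real n)) =
           \<chi> 2 * (ln 2 / 2) + (\<Sum>n=3..<Suc x. \<chi> n * (ln (real n) / real n))"
      by (simp add: sum.union_disjoint)
    moreover have "\<bar>\<Sum>n=3..<Suc x. \<chi> n * (ln (real n) / real n)\<bar> \<le> real q * (ln (real 3) / real 3)"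
      using 3 ln_div_antimono by (intro abel_bound) auto
    moreover have "real q * (ln (real 3) / real 3) \<le> real q * 1"
      using ln_le_minus_one[of 3] by (intro mult_left_mono) auto
    ultimately show ?thesis using ln2 by linarith
  qed auto
qed

text \<open>Expanding ln n as a divisor sum writes the bounded sum of \<chi>(n) ln n / n as a sum of
  \<chi>(d) mangoldt(d) / d times \<open>Lsum (x div d)\<close>. Replacing each \<open>Lsum\<close>
  by L1 costs at most q psi x / x \<le> 4 q in total, and then L1 can be divided out.\<close>

lemma chi_mangoldt_bounded: "\<bar>\<Sum>d=1..x. \<chi> d * mangoldt d / real d\<bar> \<le> (5 * real q + 1) / \<bar>L1\<bar>"
proof (cases "x = 0")
  case False
  let ?S = "\<Sum>d=1..x. \<chi> d * mangoldt d / real d"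
  have "(\<Sum>n=1..x. \<chi> n * (ln (real n) / real n))
      = (\<Sum>n=1..x. \<Sum>d | d dvd n. \<chi> n * (mangoldt d / real n))"
  proof (intro sum.cong refl)
    fix n assume "n \<in> {1..x}"
    hence "ln (real n) = (\<Sum>d | d dvd n. mangoldt d)"
      using mangoldt_sum[of n, where ?'a = real] by simp
    thus "\<chi> n * (ln (real n) / real n) = (\<Sum>d | d dvd n. \<chi> n * (mangoldt d / real n))"
      by (simp add: sum_distrib_left sum_divide_distrib)
  qed
  also have "\<dots> = (\<Sum>d=1..x. \<Sum>k=1..x div d. \<chi> (d * k) * (mangoldt d / real (d * k)))"
    by (rule sum_divisors_swap)
  also have "\<dots> = (\<Sum>d=1..x. \<chi> d * mangoldt d / real d * Lsum (x div d))"
    by (simp add: Lsum_def sum_distrib_left chi_mult mult_ac)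
  also have "\<dots> = ?S * L1 + (\<Sum>d=1..x. \<chi> d * mangoldt d / real d * (Lsum (x div d) - L1))"
    by (simp add: right_diff_distrib sum_subtractf sum_distrib_right)
  finally have "?S * L1 = (\<Sum>n=1..x. \<chi> n * (ln (real n) / real n))
      - (\<Sum>d=1..x. \<chi> d * mangoldt d / real d * (Lsum (x div d) - L1))" by simp
  hence "\<bar>?S * L1\<bar> \<le> \<bar>\<Sum>n=1..x. \<chi> n * (ln (real n) / real n)\<bar>
      + \<bar>\<Sum>d=1..x. \<chi> d * mangoldt d / real d * (Lsum (x div d) - L1)\<bar>" by linarith
  also have "\<bar>\<Sum>d=1..x. \<chi> d * mangoldt d / real d * (Lsum (x div d) - L1)\<bar>
      \<le> (\<Sum>d=1..x. mangoldt d * (real q / real x))"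
  proof (rule order_trans[OF sum_abs], rule sum_mono)
    fix d assume d: "d \<in> {1..x}"
    have "x mod d < d" using d by simp
    moreover have "d * (x div d) + x mod d = x" by (rule mult_div_mod_eq)
    ultimately have "x \<le> d * Suc (x div d)" unfolding mult_Suc_right by linarith
    hence "real x \<le> real d * real (Suc (x div d))" by (metis of_nat_le_iff of_nat_mult)
    hence "real q * real x \<le> real q * (real d * real (Suc (x div d)))" by (rule mult_left_mono) simp
    moreover have "v / (a * c) \<le> v / b" if "v * b \<le> v * (a * c)" "a > 0" "b > 0" "c > 0" for a b c v :: real
      using that by (simp add: field_simps)
    ultimately have *: "real q / (real d * real (Suc (x div d))) \<le> real q / real x"
      using d False by simp
    have "\<bar>\<chi> d * mangoldt d / real d * (Lsum (x div d) - L1)\<bar>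
        = \<bar>\<chi> d\<bar> * (mangoldt d / real d * \<bar>Lsum (x div d) - L1\<bar>)"
      by (simp add: abs_mult)
    also have "\<dots> \<le> 1 * (mangoldt d / real d * (real q / real (Suc (x div d))))"
      by (intro mult_mono chi_abs_le Lsum_L1) (auto simp: mangoldt_nonneg)
    also have "\<dots> = mangoldt d * (real q / (real d * real (Suc (x div d))))" by simp
    also have "\<dots> \<le> mangoldt d * (real q / real x)"
      using * by (intro mult_left_mono mangoldt_nonneg)
    finally show "\<bar>\<chi> d * mangoldt d / real d * (Lsum (x div d) - L1)\<bar> \<le> mangoldt d * (real q / real x)" .
  qed
  also have "\<dots> = psi x * (real q / real x)" by (simp only: psi_def sum_distrib_right)
  also have "\<dots> \<le> 4 * real x * (real q / real x)"
    by (intro mult_right_mono psi_le) auto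
  also have "\<dots> = 4 * real q" using False by simp
  also note chi_ln_sum_bounded[of x]
  finally have "\<bar>?S\<bar> * \<bar>L1\<bar> \<le> 5 * real q + 1" by (simp add: abs_mult)
  thus ?thesis using L1_nonzero by (simp add: field_simps)
qed auto

lemma chi_mertens:
  "\<bar>\<Sum>p | prime p \<and> p \<le> n. \<chi> p * ln (real p) / real p\<bar> \<le> (5 * real q + 1) / \<bar>L1\<bar> + 6"
  using mangoldt_sum_primes[of \<chi> n] chi_abs_le chi_mangoldt_bounded[of n] by (simp add: abs_le_iff)

end

section \<open>The quadratic character\<close>

lemma Legendre_values: "Legendre a p \<in> {-1, 0, 1}"
  by (simp add: Legendre_def)

lemma Legendre_cong: "[a = b] (mod p) \<Longrightarrow> Legendre a p = Legendre b p"
  unfolding Legendre_def QuadRes_def cong_def by simp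

text \<open>Euler's criterion gives the equality modulo p, and the two sides differ by at most 2 <
  p.\<close>

lemma Legendre_mult:
  assumes "prime p" "p > 2"
  shows "Legendre (a * b) (int p) = Legendre a (int p) * Legendre b (int p)"
proof -
  have "[Legendre (a * b) (int p) = Legendre a (int p) * Legendre b (int p)] (mod int p)"
    using euler_criterion[OF assms, of "a * b"]
      cong_mult[OF euler_criterion[OF assms, of a] euler_criterion[OF assms, of b]]
    unfolding power_mult_distrib by (meson cong_sym cong_trans)
  hence dvd: "int p dvd Legendre (a * b) (int p) - Legendre a (int p) * Legendre b (int p)"
    by (simp add: cong_iff_dvd_diff)
  have "\<bar>Legendre (a * b) (int p) - Legendre a (int p) * Legendre b (int p)\<bar> \<le> 2"
    using Legendre_values[of "a * b" "int p"] Legendre_values[of a "int p"]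
      Legendre_values[of b "int p"] by auto
  hence "\<not> int p \<le> \<bar>Legendre (a * b) (int p) - Legendre a (int p) * Legendre b (int p)\<bar>"
    using assms(2) by linarith
  hence "Legendre (a * b) (int p) - Legendre a (int p) * Legendre b (int p) = 0"
    using dvd_imp_le_int[OF _ dvd] by auto
  thus ?thesis by simp
qed

lemma Legendre_one: "prime p \<Longrightarrow> Legendre 1 (int p) = 1"
proof -
  assume p: "prime p"
  have "\<not> [1 = 0] (mod int p)"
    using p by (auto simp: cong_0_iff dest: prime_gt_1_nat)
  moreover have "QuadRes (int p) 1" unfolding QuadRes_def by (intro exI[of _ 1]) simp
  ultimately show ?thesis by (simp add: Legendre_def)
qed

lemma Legendre_prod:
  assumes "prime p" "p > 2" "finite S"
  shows "Legendre (\<Prod>a\<in>S. f a) (int p) = (\<Prod>a\<in>S. Legendre (f a) (int p))"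
  using assms(3) by induction (simp_all add: Legendre_one[OF assms(1)] Legendre_mult[OF assms(1,2)])

text \<open>The symbols (-1/n) and, in \<open>chi8\<close>, (2/n) for odd n, extended by 0.\<close>

definition chi4 :: "nat \<Rightarrow> int" where
  "chi4 n = (if even n then 0 else if n mod 4 = 1 then 1 else -1)"

definition chi8 :: "nat \<Rightarrow> int" where
  "chi8 n = (if even n then 0 else if n mod 8 = 1 \<or> n mod 8 = 7 then 1 else -1)"

lemma chi4_mult: "chi4 (a * b) = chi4 a * chi4 b"
proof -
  define f :: "nat \<Rightarrow> int" where "f = (\<lambda>r. if r = 1 then 1 else if r = 3 then -1 else 0)"
  have chi4: "chi4 n = f (n mod 4)" for n
    unfolding chi4_def f_def by (cases "even n") presburger+
  have "f ((r * s) mod 4) = f r * f s" if "r < 4" "s < 4" for r s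
  proof -
    have "r = 0 \<or> r = 1 \<or> r = 2 \<or> r = 3" "s = 0 \<or> s = 1 \<or> s = 2 \<or> s = 3"
      using that by linarith+
    thus ?thesis unfolding f_def by (elim disjE) simp_all
  qed
  from this[of "a mod 4" "b mod 4"] show ?thesis unfolding chi4 mod_mult_eq by simp
qed

lemma chi8_mult: "chi8 (a * b) = chi8 a * chi8 b"
proof -
  define f :: "nat \<Rightarrow> int" where
    "f = (\<lambda>r. if r = 1 \<or> r = 7 then 1 else if r = 3 \<or> r = 5 then -1 else 0)"
  have chi8: "chi8 n = f (n mod 8)" for n
    unfolding chi8_def f_def by (cases "even n") presburger+
  have "f ((r * s) mod 8) = f r * f s" if "r < 8" "s < 8" for r s
  proof -
    have "r = 0 \<or> r = 1 \<or> r = 2 \<or> r = 3 \<or> r = 4 \<or> r = 5 \<or> r = 6 \<or> r = 7"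
      "s = 0 \<or> s = 1 \<or> s = 2 \<or> s = 3 \<or> s = 4 \<or> s = 5 \<or> s = 6 \<or> s = 7"
      using that by linarith+
    thus ?thesis unfolding f_def by (elim disjE) simp_all
  qed
  from this[of "a mod 8" "b mod 8"] show ?thesis unfolding chi8 mod_mult_eq by simp
qed

text \<open>Gauss's lemma: with p = 2 h + 1, the numbers among 2, 4, ..., 2 h that exceed h are 2 x
  with h div 2 < x \<le> h.\<close>

lemma Legendre_two:
  assumes "prime p" "p > 2"
  shows "Legendre 2 (int p) = chi8 p"
proof -
  interpret GAUSS p 2
  proof
    show "[2 \<noteq> 0] (mod int p)"
      using assms zdvd_imp_le[of "int p" 2] by (auto simp: cong_0_iff)
  qed (use assms in auto)
  have p: "odd p" using assms prime_odd_nat by blast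
  then obtain h where h: "p = 2 * h + 1" by (elim oddE)
  have ph: "(int p - 1) div 2 = int h" "int p = 2 * int h + 1" using h by simp_all
  have "E = (\<lambda>x. 2 * x) ` {int h div 2<..int h}"
  proof -
    have "C = (\<lambda>x. (x * 2) mod int p) ` {0<..int h}"
      by (simp only: C_def B_def A_def image_image ph(1))
    also have "\<dots> = (\<lambda>x. 2 * x) ` {0<..int h}"
      unfolding ph(2) by (intro image_cong) auto
    finally show ?thesis unfolding E_def ph(1) by (auto simp: image_iff; presburger)
  qed
  hence "card E = card {int h div 2<..int h}"
    by (simp add: card_image inj_on_def)
  also have "\<dots> = nat (int h - int h div 2)" by simp
  finally have E: "card E = h - h div 2"
    by (metis nat_diff_distrib nat_int of_nat_0_le_iff of_nat_diff div_le_dividend of_nat_div of_nat_numeral)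
  have "even (h - h div 2) \<longleftrightarrow> p mod 8 = 1 \<or> p mod 8 = 7" unfolding h by presburger
  thus ?thesis using gauss_lemma p unfolding E chi8_def by (auto simp: minus_one_power_iff)
qed

text \<open>The symbol (p/l) as a periodic function of l: reciprocity gives (l/p), corrected by
  (-1/l) if p is 3 modulo 4, and p = 2 is the supplementary law.\<close>

definition prime_char :: "nat \<Rightarrow> nat \<Rightarrow> int" where
  "prime_char p n = (if p = 2 then chi8 n
     else if p mod 4 = 3 then chi4 n * Legendre (int n) (int p) else Legendre (int n) (int p))"

lemma prime_char_mult:
  "prime p \<Longrightarrow> prime_char p (a * b) = prime_char p a * prime_char p b"
  using prime_ge_2_nat[of p] Legendre_mult[of p]
  by (auto simp: prime_char_def chi8_mult chi4_mult)

lemma prime_char_values: "prime_char p n \<in> {-1, 0, 1}"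
  using Legendre_values[of "int n" "int p"] by (auto simp: prime_char_def chi4_def chi8_def)

lemma prime_char_one: "prime p \<Longrightarrow> prime_char p 1 = 1"
  using Legendre_one[of p] by (auto simp: prime_char_def chi4_def chi8_def)

lemma prime_char_periodic:
  assumes "8 * p dvd q"
  shows "prime_char p (n + q) = prime_char p n"
proof -
  obtain k where q: "q = 8 * p * k" using assms by blast
  have "[int (n + q) = int n] (mod int p)" unfolding q by (simp add: cong_iff_dvd_diff)
  hence L: "Legendre (int (n + q)) (int p) = Legendre (int n) (int p)" by (rule Legendre_cong)
  have q': "q = 8 * (p * k)" unfolding q by (rule mult.assoc)
  have m8: "(n + q) mod 8 = n mod 8" unfolding q' by (rule mod_mult_self2)
  have "(n + q) mod 4 = n mod 4" "(n + q) mod 2 = n mod 2"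
    using arg_cong[OF m8, of "\<lambda>w. w mod 4"] arg_cong[OF m8, of "\<lambda>w. w mod 2"]
    by (simp_all add: mod_mod_cancel)
  hence "chi8 (n + q) = chi8 n" "chi4 (n + q) = chi4 n"
    unfolding chi8_def chi4_def m8 even_iff_mod_2_eq_zero by simp_all
  with L show ?thesis by (simp add: prime_char_def)
qed

lemma prime_char_reciprocity:
  assumes "prime p" "prime l" "l > 2" "p \<noteq> l"
  shows "prime_char p l = Legendre (int p) (int l)"
proof (cases "p = 2")
  case True
  thus ?thesis using Legendre_two[OF assms(2,3)] by (simp add: prime_char_def)
next
  case False
  hence p: "p > 2" using assms(1) prime_ge_2_nat[of p] by simp
  have odd: "odd p" "odd l" using assms p prime_odd_nat by auto
  have "\<not> [int l = 0] (mod int p)" "\<not> [int p = 0] (mod int l)"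
    using assms primes_dvd_imp_eq[of p l] primes_dvd_imp_eq[of l p] by (auto simp: cong_0_iff)
  hence nz: "Legendre (int l) (int p) \<in> {1, -1}" "Legendre (int p) (int l) \<in> {1, -1}"
    by (auto simp: Legendre_def)
  have qr: "Legendre (int p) (int l) * Legendre (int l) (int p)
          = (-1) ^ ((p - 1) div 2 * ((l - 1) div 2))"
    using Quadratic_Reciprocity[OF assms(1) p assms(2,3,4)] .
  have "even ((p - 1) div 2) \<longleftrightarrow> p mod 4 \<noteq> 3" "even ((l - 1) div 2) \<longleftrightarrow> l mod 4 = 1"
    using odd by presburger+
  thus ?thesis using nz qr False odd
    by (auto simp: prime_char_def chi4_def minus_one_power_iff)
qed

definition quad_char :: "nat \<Rightarrow> nat \<Rightarrow> real" where
  "quad_char N n = (\<Prod>p\<in>prime_factors N. real_of_int (prime_char p n))"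

lemma prod_prime_factors_squarefree:
  assumes "squarefree (N :: nat)"
  shows "\<Prod>(prime_factors N) = N"
proof -
  have N: "N \<noteq> 0" using assms not_squarefree_0 by metis
  hence m: "multiplicity p N = 1" if "p \<in> prime_factors N" for p
    using assms that squarefree_factorial_semiring''[OF N] by (auto simp: prime_factors_multiplicity)
  have "N = (\<Prod>p\<in>prime_factors N. p ^ multiplicity p N)"
    using N by (intro prime_factorization_nat) simp
  also have "\<dots> = \<Prod>(prime_factors N)" using m by (intro prod.cong) auto
  finally show ?thesis ..
qed

lemma quad_char_prime:
  assumes "squarefree N" "prime l" "l > 2" "\<not> l dvd N"
  shows "quad_char N l = real_of_int (Legendre (int N) (int l))"
proof -
  have "quad_char N l = (\<Prod>p\<in>prime_factors N. real_of_int (Legendre (int p) (int l)))"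
    unfolding quad_char_def
  proof (intro prod.cong refl)
    fix p assume "p \<in> prime_factors N"
    hence "prime p" "p \<noteq> l" using assms(4) by auto
    thus "real_of_int (prime_char p l) = real_of_int (Legendre (int p) (int l))"
      using prime_char_reciprocity assms by simp
  qed
  also have "\<dots> = real_of_int (Legendre (\<Prod>p\<in>prime_factors N. int p) (int l))"
    by (simp only: Legendre_prod[OF assms(2,3) finite_set_mset] of_int_prod)
  also have "(\<Prod>p\<in>prime_factors N. int p) = int N"
  proof -
    have "int (\<Prod>(prime_factors N)) = (\<Prod>p\<in>prime_factors N. int p)" by (rule of_nat_prod)
    thus ?thesis unfolding prod_prime_factors_squarefree[OF assms(1)] ..
  qed
  finally show ?thesis .
qed

text \<open>Up to sign all roots lie in 1, ..., h with p = 2 h + 1, so at most h of the 2 h units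
  are squares.\<close>

lemma nonresidue_exists:
  assumes "prime p" "p > 2"
  shows "\<exists>a::nat. Legendre (int a) (int p) = -1"
proof (rule ccontr)
  assume "\<nexists>a::nat. Legendre (int a) (int p) = -1"
  hence sq: "QuadRes (int p) (int a)" if "\<not> p dvd a" for a
    using that by (auto simp: Legendre_def cong_0_iff split: if_splits)
  define h where "h = (p - 1) div 2"
  have ph: "p = 2 * h + 1" using assms prime_odd_nat[of p] unfolding h_def by presburger
  have "{1..<p} \<subseteq> (\<lambda>y. y\<^sup>2 mod p) ` {1..h}"
  proof
    fix a assume a: "a \<in> {1..<p}"
    hence "\<not> p dvd a" by (auto dest: dvd_imp_le)
    then obtain y where y: "[y\<^sup>2 = int a] (mod int p)" using sq unfolding QuadRes_def by blast
    define z where "z = nat (y mod int p)"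
    have z: "int z = y mod int p" "z < p" using assms by (auto simp: z_def nat_less_iff)
    have za: "[z\<^sup>2 = a] (mod p)"
    proof -
      have "[(int z)\<^sup>2 = y\<^sup>2] (mod int p)" unfolding z(1) by (intro cong_pow) simp
      hence "[int (z\<^sup>2) = int a] (mod int p)" using y cong_trans by auto
      thus ?thesis by (simp only: cong_int_iff)
    qed
    have "z \<noteq> 0"
    proof
      assume "z = 0"
      hence "[0 = a] (mod p)" using za by simp
      thus False using \<open>\<not> p dvd a\<close> cong_dvd_iff by fastforce
    qed
    define w where "w = (if z \<le> h then z else p - z)"
    have w: "w \<in> {1..h}" using \<open>z \<noteq> 0\<close> z(2) ph by (auto simp: w_def)
    have "[w\<^sup>2 = a] (mod p)"
    proof (cases "z \<le> h")
      case False
      have "[(int p - int z)\<^sup>2 = (int z)\<^sup>2] (mod int p)"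
        unfolding cong_iff_dvd_diff by (simp add: power2_eq_square algebra_simps)
      hence "[int ((p - z)\<^sup>2) = int (z\<^sup>2)] (mod int p)" using z(2) by simp
      hence "[(p - z)\<^sup>2 = z\<^sup>2] (mod p)" by (simp only: cong_int_iff)
      thus ?thesis using False za cong_trans by (auto simp: w_def)
    qed (use za in \<open>simp add: w_def\<close>)
    hence "w\<^sup>2 mod p = a" using a by (simp add: cong_def)
    thus "a \<in> (\<lambda>y. y\<^sup>2 mod p) ` {1..h}" using w by force
  qed
  hence "card {1..<p} \<le> card {1..h}" by (rule surj_card_le[rotated]) simp
  thus False using ph assms by simp
qed

text \<open>8 N is a common multiple of the periods 8 p. The sum over a period vanishes because
  multiplication by a unit of value -1 permutes the residues and negates the sum.\<close>

lemma real_character_quad_char: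
  assumes sf: "squarefree N" and "N > 1"
  shows "real_character (quad_char N) (8 * N)"
proof
  have N0: "N \<noteq> 0" using assms by simp
  show "8 * N > 0" using assms by simp
  show mult: "quad_char N (a * b) = quad_char N a * quad_char N b" for a b
    unfolding quad_char_def prod.distrib[symmetric]
  proof (intro prod.cong refl)
    fix p assume "p \<in> prime_factors N"
    hence "prime p" by auto
    thus "real_of_int (prime_char p (a * b)) = real_of_int (prime_char p a) * real_of_int (prime_char p b)"
      by (simp add: prime_char_mult)
  qed
  show "quad_char N 1 = 1"
    unfolding quad_char_def
  proof (intro prod.neutral ballI)
    fix p assume "p \<in> prime_factors N"
    hence "prime p" by auto
    thus "real_of_int (prime_char p 1) = 1" by (simp only: prime_char_one of_int_1)
  qed
  show "quad_char N a \<in> {-1, 0, 1}" for a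
  proof -
    have "finite S \<Longrightarrow> (\<Prod>p\<in>S. real_of_int (prime_char p a)) \<in> {-1, 0, 1}" for S
    proof (induction rule: finite_induct)
      case (insert p S)
      thus ?case using prime_char_values[of p a] by auto
    qed simp
    thus ?thesis unfolding quad_char_def by blast
  qed
  show per: "quad_char N (a + 8 * N) = quad_char N a" for a
    unfolding quad_char_def
    by (intro prod.cong refl, subst prime_char_periodic) (auto simp: prime_factors_dvd)
  have per': "quad_char N (a mod (8 * N)) = quad_char N a" for a
  proof (induction a rule: less_induct)
    case (less a)
    show ?case
    proof (cases "a < 8 * N")
      case False
      thus ?thesis using less[of "a - 8 * N"] per[of "a - 8 * N"] assms by (simp add: le_mod_geq)
    qed simp
  qed
  \<comment> \<open>If N has an odd prime factor p, take a nonresidue modulo p that is 1 modulo 8 N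
    / p, so that only the factor at p is -1. Otherwise N = 2 and a = 5.\<close>
  obtain a where a: "coprime a (8 * N)" "quad_char N a = -1"
  proof (cases "\<exists>p\<in>prime_factors N. p > 2")
    case False
    have "prime_factors N = {2}"
    proof -
      have "p = 2" if "p \<in> prime_factors N" for p
        using False that prime_ge_2_nat[of p] by force
      moreover obtain p where "p \<in> prime_factors N"
        using assms prime_factor_nat[of N] by (auto simp: prime_factors_dvd)
      ultimately show ?thesis by blast
    qed
    moreover from this have "N = 2" using prod_prime_factors_squarefree[OF sf] by simp
    moreover have "coprime (5 :: nat) (2 ^ 4)" by (simp only: coprime_power_right_iff coprime_right_2_iff_odd) simp
    ultimately show ?thesis
      by (intro that[of 5]) (auto simp: quad_char_def prime_char_def chi8_def)
  next
    case True
    then obtain p where p: "p \<in> prime_factors N" "p > 2" by blast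
    hence pp: "prime p" "p dvd N" by auto
    then obtain M where M: "N = p * M" by blast
    have "coprime p M"
      using sf unfolding M by (rule squarefree_mult_imp_coprime)
    have "coprime p 8"
    proof -
      have "coprime p (2 ^ 3)" using pp(1) p(2) prime_odd_nat by (metis coprime_power_right_iff coprime_right_2_iff_odd)
      thus ?thesis by simp
    qed
    hence cop: "coprime p (8 * M)" using \<open>coprime p M\<close> by simp
    obtain b where b: "Legendre (int b) (int p) = -1" using nonresidue_exists[OF pp(1) p(2)] by blast
    obtain a where a: "[a = b] (mod p)" "[a = 1] (mod 8 * M)"
      using binary_chinese_remainder_nat[OF cop] by blast
    have Lb: "Legendre (int a) (int p) = -1"
      using b a(1) Legendre_cong[of "int a" "int b" "int p"] by (simp add: cong_int_iff)
    have a8: "[a = 1] (mod 8)" using a(2) cong_modulus_mult_nat by blast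
    hence m8: "a mod 8 = 1" by (simp add: cong_def)
    have "a mod 4 = 1" "a mod 2 = 1"
      using arg_cong[OF m8, of "\<lambda>w. w mod 4"] arg_cong[OF m8, of "\<lambda>w. w mod 2"]
      by (simp_all add: mod_mod_cancel)
    hence a8': "chi8 a = 1" "chi4 a = 1"
      using m8 by (simp_all add: chi8_def chi4_def even_iff_mod_2_eq_zero)
    have "prime_char p a = -1" using Lb a8' p(2) by (simp add: prime_char_def)
    moreover have "prime_char r a = 1" if r: "r \<in> prime_factors N - {p}" for r
    proof -
      have "prime r" "r dvd p * M" "r \<noteq> p" using r M by auto
      hence "r dvd M" using pp(1) primes_dvd_imp_eq prime_dvd_mult_iff by metis
      hence "[a = 1] (mod r)" using a(2) by (meson cong_dvd_modulus_nat dvd_mult dvd_refl dvd_trans)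
      hence "[int a = int 1] (mod int r)" by (simp only: cong_int_iff)
      hence "Legendre (int a) (int r) = Legendre (int 1) (int r)" by (rule Legendre_cong)
      thus ?thesis using Legendre_one[OF \<open>prime r\<close>] a8' by (simp add: prime_char_def)
    qed
    ultimately have "quad_char N a = -1"
      unfolding quad_char_def using p(1) by (subst prod.remove[of _ p]) auto
    moreover have "coprime a p"
    proof -
      have "\<not> [int a = 0] (mod int p)" using Lb by (auto simp: Legendre_def)
      hence "\<not> p dvd a" by (simp add: cong_0_iff)
      hence "coprime p a" by (rule prime_imp_coprime[OF pp(1)])
      thus ?thesis by (metis coprime_commute)
    qed
    moreover have "coprime a (8 * M)" using a(2) cong_imp_coprime cong_sym by (metis coprime_1_left)
    ultimately show ?thesis by (intro that[of a]) (auto simp: M)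
  qed
  have "(\<Sum>n<8 * N. quad_char N n) = (\<Sum>n<8 * N. quad_char N ((a * n) mod (8 * N)))"
  proof (rule sum.reindex_bij_betw[symmetric])
    have "inj_on (\<lambda>n. (a * n) mod (8 * N)) {..<8 * N}"
    proof (rule inj_onI)
      fix m n assume mn: "m \<in> {..<8 * N}" "n \<in> {..<8 * N}" "(a * m) mod (8 * N) = (a * n) mod (8 * N)"
      hence "[a * m = a * n] (mod 8 * N)" by (simp add: cong_def)
      hence "[m = n] (mod 8 * N)" using a(1) cong_mult_lcancel_nat by blast
      thus "m = n" using mn by (simp add: cong_def)
    qed
    moreover have "(\<lambda>n. (a * n) mod (8 * N)) ` {..<8 * N} = {..<8 * N}"
      by (rule endo_inj_surj) (use calculation N0 in auto)
    ultimately show "bij_betw (\<lambda>n. (a * n) mod (8 * N)) {..<8 * N} {..<8 * N}"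
      by (simp add: bij_betw_def)
  qed
  also have "\<dots> = - (\<Sum>n<8 * N. quad_char N n)" by (simp add: per' mult a(2) sum_negf)
  finally show "(\<Sum>n<8 * N. quad_char N n) = 0" by simp
qed

section \<open>Counting squarefree products of primes of positive density\<close>

definition mertens_density :: "real \<Rightarrow> nat set \<Rightarrow> bool" where
  "mertens_density \<kappa> P \<longleftrightarrow>
     (\<exists>C. \<forall>n\<ge>1. \<bar>(\<Sum>p | prime p \<and> p \<in> P \<and> p \<le> n. ln (real p) / real p) - \<kappa> * ln (real n)\<bar> \<le> C)"

lemma mertens_density_finite_change:
  assumes "mertens_density \<kappa> P" "finite F" "P - F = Q - F"
  shows "mertens_density \<kappa> Q"
proof -
  obtain C where C: "\<And>n. n \<ge> 1 \<Longrightarrow>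
      \<bar>(\<Sum>p | prime p \<and> p \<in> P \<and> p \<le> n. ln (real p) / real p) - \<kappa> * ln (real n)\<bar> \<le> C"
    using assms(1) unfolding mertens_density_def by blast
  define B where "B = (\<Sum>p | prime p \<and> p \<in> F. ln (real p) / real p)"
  have split: "(\<Sum>p | prime p \<and> p \<in> S \<and> p \<le> n. ln (real p) / real p) =
      (\<Sum>p | prime p \<and> p \<in> S - F \<and> p \<le> n. ln (real p) / real p)
      + (\<Sum>p | prime p \<and> p \<in> S \<inter> F \<and> p \<le> n. ln (real p) / real p)" for S n
    by (subst sum.union_disjoint[symmetric]) (auto intro: sum.cong)
  have nn: "prime p \<Longrightarrow> 0 \<le> ln (real p) / real p" for p :: nat
    using prime_ge_1_nat[of p] by simp
  have small: "0 \<le> (\<Sum>p | prime p \<and> p \<in> S \<inter> F \<and> p \<le> n. ln (real p) / real p)"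
    "(\<Sum>p | prime p \<and> p \<in> S \<inter> F \<and> p \<le> n. ln (real p) / real p) \<le> B" for S n
    unfolding B_def using assms(2) nn by (auto intro!: sum_nonneg sum_mono2)
  have "\<bar>(\<Sum>p | prime p \<and> p \<in> Q \<and> p \<le> n. ln (real p) / real p) - \<kappa> * ln (real n)\<bar> \<le> C + B"
    if "n \<ge> 1" for n
    using C[OF that] split[of P n] split[of Q n] small[of P n] small[of Q n] assms(3)
    by (simp add: abs_le_iff)
  thus ?thesis unfolding mertens_density_def by blast
qed

lemma sum_inverse_squares_le: "(\<Sum>k=1..n. 1 / (real k)\<^sup>2) \<le> 2"
proof (cases "n \<ge> 1")
  case True
  have "(\<Sum>k=1..n. 1 / (real k)\<^sup>2) \<le> 2 - 1 / real n"
    using True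
  proof (induction n rule: dec_induct)
    case (step n)
    have "1 / (real n + 1)\<^sup>2 \<le> 1 / (real n * (real n + 1))"
      using step.hyps by (intro divide_left_mono) (auto simp: power2_eq_square)
    also have "\<dots> = 1 / real n - 1 / (real n + 1)" using step.hyps by (simp add: field_simps)
    finally show ?case using step.IH by (simp add: add.commute)
  qed auto
  also have "\<dots> \<le> 2" by simp
  finally show ?thesis .
qed auto

lemma ln_Suc_le_harmonic: "ln (real (Suc n)) \<le> (\<Sum>m=1..n. 1 / real m)"
proof (induction n)
  case (Suc n)
  have "ln (real (Suc (Suc n))) - ln (real (Suc n)) \<le> (real (Suc (Suc n)) - real (Suc n)) / real (Suc n)"
    by (intro ln_diff_le) auto
  thus ?case using Suc by simp
qed auto

lemma ln_le_harmonic: "n \<ge> 1 \<Longrightarrow> ln (real n) \<le> (\<Sum>m=1..n. 1 / real m)"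
  using ln_Suc_le_harmonic[of n] by (smt (verit) ln_mono of_nat_Suc of_nat_0_less_iff less_le_trans zero_less_one)

section \<open>Reciprocal sums over squarefree products\<close>

definition smooth_squarefree :: "nat set \<Rightarrow> nat \<Rightarrow> nat set" where
  "smooth_squarefree P x = {n. n \<le> x \<and> squarefree n \<and> prime_factors n \<subseteq> P}"

lemma smooth_squarefree_props:
  "finite (smooth_squarefree P x)" "n \<in> smooth_squarefree P x \<Longrightarrow> n > 0"
proof -
  show "finite (smooth_squarefree P x)"
    by (rule finite_subset[of _ "{..x}"]) (auto simp: smooth_squarefree_def)
  show "n \<in> smooth_squarefree P x \<Longrightarrow> n > 0"
    using not_squarefree_0 unfolding smooth_squarefree_def by (metis (no_types, lifting) mem_Collect_eq not_gr_zero)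
qed

text \<open>By Mertens' theorem the primes outside P have density 1 - \<kappa>; partial summation
  with the weight 1 / ln passes from ln p / p to 1 / p.\<close>

lemma sum_inverse_primes_complement:
  assumes \<kappa>: "\<kappa> \<le> 1" and P: "mertens_density \<kappa> P"
  shows "\<exists>C. \<forall>n\<ge>2. (\<Sum>p | prime p \<and> p \<notin> P \<and> p \<le> n. 1 / real p) \<le> (1 - \<kappa>) * ln (ln (real n)) + C"
proof -
  obtain C0 where C0: "\<And>n. n \<ge> 1 \<Longrightarrow>
      \<bar>(\<Sum>p | prime p \<and> p \<in> P \<and> p \<le> n. ln (real p) / real p) - \<kappa> * ln (real n)\<bar> \<le> C0"
    using P unfolding mertens_density_def by blast
  define A where "A = (\<lambda>n. \<Sum>p | prime p \<and> p \<notin> P \<and> p \<le> n. ln (real p) / real p)"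
  define H where "H = (\<lambda>n. \<Sum>p | prime p \<and> p \<notin> P \<and> p \<le> n. 1 / real p)"
  define C where "C = C0 + 10"
  have A: "A n \<le> (1 - \<kappa>) * ln (real n) + C" if "n \<ge> 1" for n
  proof -
    have "(\<Sum>p | prime p \<and> p \<le> n. ln (real p) / real p)
        = A n + (\<Sum>p | prime p \<and> p \<in> P \<and> p \<le> n. ln (real p) / real p)"
      unfolding A_def by (subst sum.union_disjoint[symmetric]) (auto intro: sum.cong)
    thus ?thesis using mertens[OF that] C0[OF that] unfolding C_def abs_le_iff
      by (simp add: algebra_simps)
  qed
  have C: "C \<ge> 0" using C0[of 1] by (simp add: C_def)
  have ln_pos: "ln (real n) > 0" if "n \<ge> 2" for n using that by simp
  \<comment> \<open>Keeping the boundary term A n / ln n turns partial summation into an induction.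
    Its step rests on 1 - u/v \<le> ln v - ln u for u = ln n and v = ln (n + 1).\<close>
  have main: "H n \<le> A n / ln (real n) + (1 - \<kappa>) * (ln (ln (real n)) - ln (ln 2))
                   + C * (1 / ln 2 - 1 / ln (real n))" if "n \<ge> 2" for n
    using that
  proof (induction n rule: dec_induct)
    case base
    have set2: "{p. prime p \<and> p \<notin> P \<and> p \<le> 2} = (if 2 \<in> P then {} else {2::nat})"
    proof -
      have "prime p \<and> p \<le> 2 \<longleftrightarrow> p = 2" for p :: nat using prime_ge_2_nat[of p] by auto
      hence "{p. prime p \<and> p \<notin> P \<and> p \<le> 2} = {p. p = 2 \<and> p \<notin> P}" by blast
      thus ?thesis by auto
    qed
    have "H 2 = A 2 / ln 2" unfolding H_def A_def set2 by simp
    thus ?case by simp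
  next
    case (step n)
    define a where "a = (if prime (Suc n) \<and> Suc n \<notin> P then 1 / real (Suc n) else 0)"
    define u where "u = ln (real n)"
    define v where "v = ln (real (Suc n))"
    have uv: "0 < u" "u \<le> v" "0 < v" using step.hyps ln_pos[of n] ln_pos[of "Suc n"]
      by (auto simp: u_def v_def)
    have set_eq: "{p. prime p \<and> p \<notin> P \<and> p \<le> Suc n} = {p. prime p \<and> p \<notin> P \<and> p \<le> n}
        \<union> (if prime (Suc n) \<and> Suc n \<notin> P then {Suc n} else {})"
      by (auto simp: le_Suc_eq)
    have H: "H (Suc n) = H n + a" and A': "A (Suc n) = A n + v * a"
      unfolding H_def A_def set_eq a_def v_def
      by (subst sum.union_disjoint; auto)+
    have "ln (u / v) \<le> u / v - 1" using uv by (intro ln_le_minus_one) auto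
    hence l: "1 - u / v \<le> ln v - ln u" using uv by (simp add: ln_div)
    have "A n * (1 / u - 1 / v) \<le> ((1 - \<kappa>) * u + C) * (1 / u - 1 / v)"
      using A[of n] step.hyps uv unfolding u_def[symmetric]
      by (intro mult_right_mono) (auto simp: frac_le)
    also have "\<dots> = (1 - \<kappa>) * (1 - u / v) + C * (1 / u - 1 / v)"
      using uv by (simp add: field_simps)
    also have "\<dots> \<le> (1 - \<kappa>) * (ln v - ln u) + C * (1 / u - 1 / v)"
      using l \<kappa> by (intro add_right_mono mult_left_mono) auto
    finally have *: "A n * (1 / u - 1 / v) \<le> (1 - \<kappa>) * (ln v - ln u) + C * (1 / u - 1 / v)" .
    have "A (Suc n) / v = A n / v + a" unfolding A' using uv by (simp add: field_simps)
    hence "H (Suc n) = H n + A (Suc n) / v - A n / v" unfolding H by simp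
    also have "\<dots> \<le> A n / u + (1 - \<kappa>) * (ln u - ln (ln 2)) + C * (1 / ln 2 - 1 / u)
                   + A (Suc n) / v - A n / v"
      using step.IH by (simp add: u_def)
    also have "\<dots> = A n * (1 / u - 1 / v) + A (Suc n) / v + (1 - \<kappa>) * (ln u - ln (ln 2)) + C * (1 / ln 2 - 1 / u)"
      by (simp add: algebra_simps)
    also have "\<dots> \<le> (1 - \<kappa>) * (ln v - ln u) + C * (1 / u - 1 / v) + A (Suc n) / v
        + (1 - \<kappa>) * (ln u - ln (ln 2)) + C * (1 / ln 2 - 1 / u)"
      using * by simp
    also have "\<dots> = A (Suc n) / v + (1 - \<kappa>) * (ln v - ln (ln 2)) + C * (1 / ln 2 - 1 / v)"
      by (simp add: algebra_simps)
    finally show ?case by (simp add: v_def)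
  qed
  define C' where "C' = (1 - \<kappa>) + C / ln 2 - (1 - \<kappa>) * ln (ln 2) + C / ln 2"
  have "H n \<le> (1 - \<kappa>) * ln (ln (real n)) + C'" if "n \<ge> 2" for n
  proof -
    have l2: "ln 2 \<le> ln (real n)" "ln (real n) > 0" using that ln_pos by auto
    have "A n / ln (real n) \<le> ((1 - \<kappa>) * ln (real n) + C) / ln (real n)"
      using A[of n] that l2 by (intro divide_right_mono) auto
    also have "\<dots> = (1 - \<kappa>) + C / ln (real n)" using l2 by (simp add: add_divide_distrib)
    also have "C / ln (real n) \<le> C / ln 2" using C l2 by (intro divide_left_mono) auto
    finally have 1: "A n / ln (real n) \<le> (1 - \<kappa>) + C / ln 2" by simp
    have "C * (1 / ln 2 - 1 / ln (real n)) \<le> C * (1 / ln 2)"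
      using C l2 by (intro mult_left_mono) auto
    hence "C * (1 / ln 2 - 1 / ln (real n)) \<le> C / ln 2" by simp
    with main[OF that] 1 show ?thesis unfolding C'_def right_diff_distrib[of "1 - \<kappa>"] by linarith
  qed
  thus ?thesis unfolding H_def by blast
qed

text \<open>Every m \<le> x is k^2 times s times the product of a set B, with s squarefree over P
  and B a set of primes outside P. So the harmonic sum is at most a product of three sums, the one
  over k being at most 2.\<close>

lemma harmonic_le_smooth:
  assumes "x \<ge> 1"
  shows "ln (real x) \<le> 2 * (\<Sum>s\<in>smooth_squarefree P x. 1 / real s)
                        * (\<Prod>p | prime p \<and> p \<notin> P \<and> p \<le> x. 1 + 1 / real p)"
proof -
  define Q where "Q = {p. prime p \<and> p \<notin> P \<and> p \<le> x}"
  have finQ: "finite Q" by (simp add: Q_def)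
  define f where "f = (\<lambda>m. (square_part m, \<Prod>(prime_factors (squarefree_part m) \<inter> P),
      prime_factors (squarefree_part m) - P))"
  define g where "g = (\<lambda>(k :: nat, s :: nat, B :: nat set). k\<^sup>2 * (s * \<Prod>B))"
  have gf: "g (f m) = m" if "m \<in> {1..x}" for m
  proof -
    have "\<Prod>(prime_factors (squarefree_part m) \<inter> P) * \<Prod>(prime_factors (squarefree_part m) - P)
        = \<Prod>(prime_factors (squarefree_part m))"
      by (subst prod.union_disjoint[symmetric]) (auto intro: prod.cong)
    also have "\<dots> = squarefree_part m" by (rule prod_prime_factors_squarefree) auto
    finally show ?thesis
      unfolding f_def g_def using squarefree_decompose[of m] by (simp add: mult.commute)
  qed
  have img: "f m \<in> {1..x} \<times> smooth_squarefree P x \<times> Pow Q" if m: "m \<in> {1..x}" for m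
  proof -
    define u where "u = squarefree_part m"
    have mu: "m = u * (square_part m)\<^sup>2" unfolding u_def by (rule squarefree_decompose)
    have "u dvd m" using mu by (metis dvd_triv_left)
    hence "u \<le> x" "u > 0" using m by (auto dest: dvd_imp_le intro: Nat.gr0I)
    have sf: "squarefree u" by (simp add: u_def)
    have k: "square_part m \<ge> 1" "square_part m \<le> x"
    proof -
      have "square_part m \<noteq> 0" using m by simp
      thus "square_part m \<ge> 1" by linarith
      have "square_part m dvd m" using mu by (metis dvd_mult dvd_triv_left power2_eq_square)
      thus "square_part m \<le> x" using m by (auto dest: dvd_imp_le)
    qed
    have "\<Prod>(prime_factors u \<inter> P) dvd \<Prod>(prime_factors u)"
      by (intro prod_dvd_prod_subset) auto
    hence dvd: "\<Prod>(prime_factors u \<inter> P) dvd u" using prod_prime_factors_squarefree[OF sf] by simp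
    hence "\<Prod>(prime_factors u \<inter> P) \<le> x" using \<open>u \<le> x\<close> \<open>u > 0\<close> by (auto dest: dvd_imp_le)
    moreover have "squarefree (\<Prod>(prime_factors u \<inter> P))" using squarefree_mono[OF dvd sf] .
    moreover have "prime_factors (\<Prod>(prime_factors u \<inter> P)) \<subseteq> P"
    proof
      fix p assume "p \<in> prime_factors (\<Prod>(prime_factors u \<inter> P))"
      hence "prime p" "p dvd \<Prod>(prime_factors u \<inter> P)" by auto
      then obtain r where "r \<in> prime_factors u \<inter> P" "p dvd r"
        using prime_dvd_prod_iff[of "prime_factors u \<inter> P" p "\<lambda>x. x"] by auto
      thus "p \<in> P" using \<open>prime p\<close> primes_dvd_imp_eq by auto
    qed
    ultimately have "\<Prod>(prime_factors u \<inter> P) \<in> smooth_squarefree P x"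
      by (simp add: smooth_squarefree_def)
    moreover have "prime_factors u - P \<subseteq> Q"
    proof
      fix p assume p: "p \<in> prime_factors u - P"
      hence "prime p" "p dvd u" by auto
      hence "p \<le> x" using \<open>u \<le> x\<close> \<open>u > 0\<close> dvd_imp_le[of p u] by linarith
      thus "p \<in> Q" using p \<open>prime p\<close> by (simp add: Q_def)
    qed
    ultimately show ?thesis using k unfolding f_def u_def[symmetric] by simp
  qed
  have "ln (real x) \<le> (\<Sum>m=1..x. 1 / real m)" by (rule ln_le_harmonic[OF assms])
  also have "\<dots> = (\<Sum>m=1..x. 1 / real (g (f m)))" by (intro sum.cong refl) (simp add: gf)
  also have "\<dots> = (\<Sum>w\<in>f ` {1..x}. 1 / real (g w))"
    by (subst sum.reindex[OF inj_on_inverseI[of _ g]]) (auto simp: gf)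
  also have "\<dots> \<le> (\<Sum>w\<in>{1..x} \<times> smooth_squarefree P x \<times> Pow Q. 1 / real (g w))"
  proof (rule sum_mono2)
    show "finite ({1..x} \<times> smooth_squarefree P x \<times> Pow Q)"
      using smooth_squarefree_props(1) finQ by simp
    show "f ` {1..x} \<subseteq> {1..x} \<times> smooth_squarefree P x \<times> Pow Q"
      using img by (rule image_subsetI)
  qed auto
  also have "\<dots> = (\<Sum>(k, s, B)\<in>{1..x} \<times> smooth_squarefree P x \<times> Pow Q.
       1 / (real k)\<^sup>2 * (1 / real s * (\<Prod>p\<in>B. 1 / real p)))"
    by (intro sum.cong) (auto simp: g_def prod_dividef)
  also have "\<dots> = (\<Sum>k=1..x. 1 / (real k)\<^sup>2) * ((\<Sum>s\<in>smooth_squarefree P x. 1 / real s)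
       * (\<Sum>B\<in>Pow Q. \<Prod>p\<in>B. 1 / real p))"
    by (simp add: sum_product sum.cartesian_product case_prod_unfold)
  also have "(\<Sum>B\<in>Pow Q. \<Prod>p\<in>B. 1 / real p) = (\<Prod>p\<in>Q. 1 + 1 / real p)"
    using prod_add[OF finQ, of "\<lambda>p. 1 / real p" "\<lambda>_. 1"] by (simp add: add.commute)
  also have "(\<Sum>k=1..x. 1 / (real k)\<^sup>2) * ((\<Sum>s\<in>smooth_squarefree P x. 1 / real s) * (\<Prod>p\<in>Q. 1 + 1 / real p))
      \<le> 2 * ((\<Sum>s\<in>smooth_squarefree P x. 1 / real s) * (\<Prod>p\<in>Q. 1 + 1 / real p))"
    by (intro mult_right_mono sum_inverse_squares_le mult_nonneg_nonneg sum_nonneg prod_nonneg) auto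
  finally show ?thesis by (simp add: Q_def mult.assoc)
qed

text \<open>By 1 + 1/p \<le> exp (1/p) the product over primes outside P is at most a constant times
  (ln x)^(1 - \<kappa>). Dividing the harmonic bound by it leaves (ln x)^\<kappa>.\<close>

lemma smooth_sum_lower:
  assumes "\<kappa> \<le> 1" "mertens_density \<kappa> P"
  shows "\<exists>c>0. \<forall>x\<ge>2. (\<Sum>s\<in>smooth_squarefree P x. 1 / real s) \<ge> c * ln (real x) powr \<kappa>"
proof -
  obtain C where C: "\<And>n. n \<ge> 2 \<Longrightarrow>
     (\<Sum>p | prime p \<and> p \<notin> P \<and> p \<le> n. 1 / real p) \<le> (1 - \<kappa>) * ln (ln (real n)) + C"
    using sum_inverse_primes_complement[OF assms] by blast
  have "(\<Sum>s\<in>smooth_squarefree P x. 1 / real s) \<ge> (1 / (2 * exp C)) * ln (real x) powr \<kappa>" if x: "x \<ge> 2" for x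
  proof -
    let ?T = "\<Sum>s\<in>smooth_squarefree P x. 1 / real s"
    have lx: "ln (real x) > 0" using x by simp
    have "(\<Prod>p | prime p \<and> p \<notin> P \<and> p \<le> x. 1 + 1 / real p)
        \<le> (\<Prod>p | prime p \<and> p \<notin> P \<and> p \<le> x. exp (1 / real p))"
      by (intro prod_mono) (auto simp: exp_ge_add_one_self)
    also have "\<dots> = exp (\<Sum>p | prime p \<and> p \<notin> P \<and> p \<le> x. 1 / real p)"
      by (simp add: exp_sum)
    also have "\<dots> \<le> exp ((1 - \<kappa>) * ln (ln (real x)) + C)" using C[OF x] by simp
    also have "\<dots> = ln (real x) powr (1 - \<kappa>) * exp C"
      using lx by (simp add: exp_add powr_def)
    finally have "2 * ?T * (\<Prod>p | prime p \<and> p \<notin> P \<and> p \<le> x. 1 + 1 / real p)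
        \<le> 2 * ?T * (ln (real x) powr (1 - \<kappa>) * exp C)"
      by (intro mult_left_mono mult_nonneg_nonneg sum_nonneg) auto
    with harmonic_le_smooth[of x P] x
    have "ln (real x) \<le> 2 * ?T * (ln (real x) powr (1 - \<kappa>) * exp C)" by linarith
    hence "ln (real x) * ln (real x) powr (\<kappa> - 1)
        \<le> 2 * ?T * (ln (real x) powr (1 - \<kappa>) * exp C) * ln (real x) powr (\<kappa> - 1)"
      by (intro mult_right_mono) auto
    also have "\<dots> = 2 * ?T * exp C * (ln (real x) powr (1 - \<kappa>) * ln (real x) powr (\<kappa> - 1))"
      by (simp only: mult_ac)
    also have "ln (real x) powr (1 - \<kappa>) * ln (real x) powr (\<kappa> - 1) = 1"
      using lx by (simp flip: powr_add)
    also have "ln (real x) * ln (real x) powr (\<kappa> - 1) = ln (real x) powr \<kappa>"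
      using lx powr_mult_base[of "ln (real x)" "\<kappa> - 1"] by simp
    finally show ?thesis by (simp add: field_simps)
  qed
  thus ?thesis by (intro exI[of _ "1 / (2 * exp C)"]) auto
qed

text \<open>Once \<kappa> ln K exceeds twice the error of the Mertens estimate by 1, the weights ln
  p / p of the primes between n / K and n sum to at least 1, and each weight is at most K / n times
  ln p.\<close>

lemma theta_lower:
  assumes \<kappa>: "\<kappa> > 0" and P: "mertens_density \<kappa> P"
  shows "\<exists>c>0. \<exists>x0\<ge>1. \<forall>n\<ge>x0. (\<Sum>p | prime p \<and> p \<in> P \<and> p \<le> n. ln (real p)) \<ge> c * real n"
proof -
  define M where "M = (\<lambda>n. \<Sum>p | prime p \<and> p \<in> P \<and> p \<le> n. ln (real p) / real p)"
  obtain C where C: "\<And>n. n \<ge> 1 \<Longrightarrow> \<bar>M n - \<kappa> * ln (real n)\<bar> \<le> C"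
    using P unfolding mertens_density_def M_def by blast
  obtain K :: nat where K: "exp ((2 * C + 1) / \<kappa>) < real K" using reals_Archimedean2 by blast
  have K0: "real K > 0" using K exp_gt_zero[of "(2 * C + 1) / \<kappa>"] by linarith
  have "ln (exp ((2 * C + 1) / \<kappa>)) < ln (real K)" using K K0 by (subst ln_less_cancel_iff) auto
  hence "(2 * C + 1) / \<kappa> < ln (real K)" by simp
  hence lK: "2 * C + 1 \<le> \<kappa> * ln (real K)" using \<kappa> by (simp add: field_simps)
  have "(1 / real K) * real n \<le> (\<Sum>p | prime p \<and> p \<in> P \<and> p \<le> n. ln (real p))" if n: "n \<ge> K" for n
  proof -
    define d where "d = n div K"
    have d: "d \<ge> 1" using n K0 by (simp add: d_def Suc_le_eq div_greater_zero_iff)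
    have "real d \<le> real n / real K" unfolding d_def by (rule of_nat_div_le_of_nat)
    hence "ln (real d) \<le> ln (real n / real K)" using d by (subst ln_le_cancel_iff) auto
    also have "\<dots> = ln (real n) - ln (real K)" using K0 n by (subst ln_div) auto
    finally have "\<kappa> * ln (real d) \<le> \<kappa> * (ln (real n) - ln (real K))" using \<kappa> by simp
    hence "1 \<le> M n - M d"
      using C[of n] C[OF d] lK n K0 by (simp add: abs_le_iff algebra_simps)
    also have "M n - M d = (\<Sum>p | prime p \<and> p \<in> P \<and> d < p \<and> p \<le> n. ln (real p) / real p)"
    proof -
      have "d \<le> n" by (simp add: d_def)
      hence "{p. prime p \<and> p \<in> P \<and> p \<le> n} = {p. prime p \<and> p \<in> P \<and> p \<le> d}
          \<union> {p. prime p \<and> p \<in> P \<and> d < p \<and> p \<le> n}" (is "_ = ?U \<union> ?V") by auto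
      hence "M n = (\<Sum>p\<in>?U \<union> ?V. ln (real p) / real p)" by (simp only: M_def)
      also have "\<dots> = M d + (\<Sum>p\<in>?V. ln (real p) / real p)"
        unfolding M_def by (rule sum.union_disjoint) auto
      finally show ?thesis by simp
    qed
    also have "\<dots> \<le> (\<Sum>p | prime p \<and> p \<in> P \<and> d < p \<and> p \<le> n. ln (real p) * (real K / real n))"
    proof (rule sum_mono)
      fix p assume "p \<in> {p. prime p \<and> p \<in> P \<and> d < p \<and> p \<le> n}"
      hence p: "prime p" "d < p" by auto
      have "n < K * Suc d"
      proof -
        have "n mod K < K" using K0 by simp
        moreover have "K * d + n mod K = n" unfolding d_def by (rule mult_div_mod_eq)
        ultimately show ?thesis unfolding mult_Suc_right by linarith
      qed
      also have "\<dots> \<le> K * p" using p by (intro mult_left_mono) auto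
      finally have "real n \<le> real K * real p" by (metis less_imp_le of_nat_le_iff of_nat_mult)
      hence "1 / real p \<le> real K / real n"
        using prime_gt_0_nat[OF p(1)] n K0 by (simp add: field_simps)
      hence "ln (real p) * (1 / real p) \<le> ln (real p) * (real K / real n)"
        using prime_ge_1_nat[OF p(1)] by (intro mult_left_mono) auto
      thus "ln (real p) / real p \<le> ln (real p) * (real K / real n)" by simp
    qed
    also have "\<dots> \<le> (\<Sum>p | prime p \<and> p \<in> P \<and> p \<le> n. ln (real p) * (real K / real n))"
      by (rule sum_mono2) (auto intro!: mult_nonneg_nonneg dest: prime_ge_1_nat)
    also have "\<dots> = (\<Sum>p | prime p \<and> p \<in> P \<and> p \<le> n. ln (real p)) * (real K / real n)"
      by (simp only: sum_distrib_right)
    finally show ?thesis using n K0 by (simp add: field_simps)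
  qed
  moreover have "K \<ge> 1" using K0 by simp
  ultimately show ?thesis using K0
    by (intro exI[of _ "1 / real K"] conjI exI[of _ K] allI impI) auto
qed

section \<open>From logarithmic sums to the count\<close>

lemma ln_squarefree:
  assumes "squarefree (k :: nat)"
  shows "(\<Sum>p\<in>prime_factors k. ln (real p)) = ln (real k)"
proof -
  have "ln (real (\<Prod>(prime_factors k))) = (\<Sum>p\<in>prime_factors k. ln (real p))"
    unfolding of_nat_prod by (rule ln_prod) (auto dest!: in_prime_factors_imp_prime prime_gt_0_nat)
  thus ?thesis using prod_prime_factors_squarefree[OF assms] by simp
qed

text \<open>Writing ln n as the sum of ln p over p dividing n, keep only the pairs n = k p with k
  \<le> r. As r^2 \<le> x, the range p \<le> x / k is long enough for \<open>theta\<close>. Leaving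
  out the primes dividing k costs ln k, which \<open>ln_x\<close> makes at most half of the
  gain.\<close>

lemma sum_ln_smooth_ge:
  assumes "r * r \<le> x" "x0 \<ge> 1" "x0 \<le> r" "c0 > 0"
    and theta: "\<And>n. n \<ge> x0 \<Longrightarrow> (\<Sum>p | prime p \<and> p \<in> P \<and> p \<le> n. ln (real p)) \<ge> c0 * real n"
    and ln_x: "ln (real x) \<le> c0 / 4 * (real x / real r)"
  shows "(c0 * real x / 4) * (\<Sum>k\<in>smooth_squarefree P r. 1 / real k)
         \<le> (\<Sum>n\<in>smooth_squarefree P x. ln (real n))"
proof -
  define V where "V = (\<lambda>k. {p. prime p \<and> p \<in> P \<and> p \<le> x div k \<and> \<not> p dvd k})"
  have x_pos: "x > 0" using assms(1-3) by (auto intro: Nat.gr0I)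
  have term_ge: "c0 * real x / 4 * (1 / real k) \<le> (\<Sum>p\<in>V k. ln (real p))"
    if k: "k \<in> smooth_squarefree P r" for k
  proof -
    have k0: "k > 0" "k \<le> r" "squarefree k" using k smooth_squarefree_props(2)[OF k]
      by (auto simp: smooth_squarefree_def)
    have "k * r \<le> x" using k0(2) assms(1) by (meson le_trans mult_le_mono1)
    hence rdiv: "r \<le> x div k" using k0(1) by (simp add: less_eq_div_iff_mult_less_eq mult.commute)
    have "x < k * Suc (x div k)"
    proof -
      have "x mod k < k" using k0 by simp
      moreover have "k * (x div k) + x mod k = x" by (rule mult_div_mod_eq)
      ultimately show ?thesis unfolding mult_Suc_right by linarith
    qed
    also have "\<dots> \<le> k * (2 * (x div k))" using rdiv assms(2,3) by (intro mult_left_mono) auto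
    finally have "real x \<le> real (k * (2 * (x div k)))" by (simp only: of_nat_le_iff less_imp_le)
    hence xk: "real x / (2 * real k) \<le> real (x div k)" using k0 by (simp add: field_simps)
    have "ln (real k) \<le> ln (real x)"
      using k0 assms(1) x_pos \<open>k * r \<le> x\<close> assms(2,3)
      by (subst ln_le_cancel_iff) (auto intro: order_trans[of k "k * r"])
    also have "\<dots> \<le> c0 / 4 * (real x / real r)" by (rule ln_x)
    also have "\<dots> \<le> c0 / 4 * (real x / real k)"
      using k0 assms(4) by (intro mult_left_mono divide_left_mono) auto
    finally have lnk: "ln (real k) \<le> c0 * real x / 4 * (1 / real k)" by simp
    have "c0 * (real x / (2 * real k)) \<le> c0 * real (x div k)" using xk assms(4) by (intro mult_left_mono) auto
    also have "\<dots> \<le> (\<Sum>p | prime p \<and> p \<in> P \<and> p \<le> x div k. ln (real p))"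
      using rdiv assms(3) by (intro theta) simp
    also have "\<dots> \<le> (\<Sum>p\<in>V k \<union> prime_factors k. ln (real p))"
    proof (rule sum_mono2)
      have "finite (V k)" by (rule finite_subset[of _ "{..x div k}"]) (auto simp: V_def)
      thus "finite (V k \<union> prime_factors k)" by simp
      show "{p. prime p \<and> p \<in> P \<and> p \<le> x div k} \<subseteq> V k \<union> prime_factors k"
        using k0 by (auto simp: V_def prime_factors_dvd)
      fix p assume "p \<in> V k \<union> prime_factors k - {p. prime p \<and> p \<in> P \<and> p \<le> x div k}"
      hence "prime p" by (auto simp: V_def)
      thus "0 \<le> ln (real p)" using prime_ge_1_nat[of p] by simp
    qed
    also have "\<dots> = (\<Sum>p\<in>V k. ln (real p)) + (\<Sum>p\<in>prime_factors k. ln (real p))"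
      by (rule sum.union_disjoint) (auto simp: V_def)
    also have "(\<Sum>p\<in>prime_factors k. ln (real p)) = ln (real k)" by (rule ln_squarefree[OF k0(3)])
    finally have "c0 * (real x / (2 * real k)) \<le> (\<Sum>p\<in>V k. ln (real p)) + ln (real k)" .
    moreover have "c0 * (real x / (2 * real k)) = 2 * (c0 * real x / 4 * (1 / real k))" by simp
    ultimately show ?thesis using lnk by linarith
  qed
  have finV: "finite (V k)" for k
    by (rule finite_subset[of _ "{..x div k}"]) (auto simp: V_def)
  have "(c0 * real x / 4) * (\<Sum>k\<in>smooth_squarefree P r. 1 / real k)
      \<le> (\<Sum>k\<in>smooth_squarefree P r. \<Sum>p\<in>V k. ln (real p))"
    unfolding sum_distrib_left by (intro sum_mono term_ge)
  also have "\<dots> = (\<Sum>(k, p)\<in>(SIGMA k:smooth_squarefree P r. V k). ln (real p))"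
    by (subst sum.Sigma) (auto simp: smooth_squarefree_props finV)
  \<comment> \<open>One number may be k p for several k; recording p as well makes the map
    injective.\<close>
  also have "\<dots> = (\<Sum>(n, p)\<in>(\<lambda>(k, p). (k * p, p)) ` (SIGMA k:smooth_squarefree P r. V k). ln (real p))"
  proof (subst sum.reindex)
    show "inj_on (\<lambda>(k, p). (k * p, p)) (SIGMA k:smooth_squarefree P r. V k)"
      by (auto simp: inj_on_def V_def)
  qed (auto intro!: sum.cong)
  also have "\<dots> \<le> (\<Sum>(n, p)\<in>(SIGMA n:smooth_squarefree P x. prime_factors n). ln (real p))"
  proof (rule sum_mono2)
    show "finite (SIGMA n:smooth_squarefree P x. prime_factors n)"
      by (intro finite_SigmaI smooth_squarefree_props) auto
    show "(\<lambda>(k, p). (k * p, p)) ` (SIGMA k:smooth_squarefree P r. V k)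
        \<subseteq> (SIGMA n:smooth_squarefree P x. prime_factors n)"
    proof clarify
      fix k p assume k: "k \<in> smooth_squarefree P r" and p: "p \<in> V k"
      have p': "prime p" "p \<in> P" "p \<le> x div k" "\<not> p dvd k" using p by (auto simp: V_def)
      have k0: "k > 0" "squarefree k" "prime_factors k \<subseteq> P"
        using k smooth_squarefree_props(2)[OF k] by (auto simp: smooth_squarefree_def)
      have "k * p \<le> x" using p'(3) k0(1) by (simp add: less_eq_div_iff_mult_less_eq mult.commute)
      moreover have "coprime k p" using p' prime_imp_coprime coprime_commute by metis
      hence "squarefree (k * p)" using k0 p' squarefree_prime by (intro squarefree_mult_coprime) auto
      moreover have "prime_factors (k * p) \<subseteq> P"
      proof
        fix l assume "l \<in> prime_factors (k * p)"
        hence "prime l" "l dvd k * p" by auto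
        hence "l dvd k \<or> l = p" using p'(1) prime_dvd_mult_iff primes_dvd_imp_eq by metis
        thus "l \<in> P" using k0 p' \<open>prime l\<close> by (auto simp: prime_factors_dvd)
      qed
      moreover have "p \<in> prime_factors (k * p)" using p' k0 by (auto simp: prime_factors_dvd prime_gt_0_nat)
      ultimately show "k * p \<in> smooth_squarefree P x \<and> p \<in> prime_factors (k * p)"
        by (simp only: smooth_squarefree_def mem_Collect_eq)
    qed
    fix b assume "b \<in> (SIGMA n:smooth_squarefree P x. prime_factors n)
        - (\<lambda>(k, p). (k * p, p)) ` (SIGMA k:smooth_squarefree P r. V k)"
    then obtain n p where "b = (n, p)" "prime p" by auto
    thus "0 \<le> (case b of (n, p) \<Rightarrow> ln (real p))" using prime_ge_1_nat[of p] by simp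
  qed
  also have "\<dots> = (\<Sum>n\<in>smooth_squarefree P x. \<Sum>p\<in>prime_factors n. ln (real p))"
    by (subst sum.Sigma) (auto simp: smooth_squarefree_props)
  also have "\<dots> = (\<Sum>n\<in>smooth_squarefree P x. ln (real n))"
    by (intro sum.cong refl ln_squarefree) (simp add: smooth_squarefree_def)
  finally show ?thesis .
qed

text \<open>Since ln n \<le> ln x, the count is at least the sum of ln n divided by ln x, hence of
  order x (ln x)^\<kappa> / ln x.\<close>

lemma card_smooth_squarefree_lower:
  assumes \<kappa>: "0 < \<kappa>" "\<kappa> \<le> 1" and P: "mertens_density \<kappa> P"
  shows "\<exists>c>0. \<exists>X. \<forall>x\<ge>X. real (card (smooth_squarefree P x)) \<ge> c * real x / ln (real x) powr (1 - \<kappa>)"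
proof -
  obtain c1 where c1: "c1 > 0"
    "\<And>x. x \<ge> 2 \<Longrightarrow> (\<Sum>s\<in>smooth_squarefree P x. 1 / real s) \<ge> c1 * ln (real x) powr \<kappa>"
    using smooth_sum_lower[OF \<kappa>(2) P] by blast
  obtain c0 x0 where c0: "c0 > 0" "x0 \<ge> 1"
    "\<And>n. n \<ge> x0 \<Longrightarrow> (\<Sum>p | prime p \<and> p \<in> P \<and> p \<le> n. ln (real p)) \<ge> c0 * real n"
    using theta_lower[OF \<kappa>(1) P] by blast
  \<comment> \<open>W is a lower bound for w = x^(1/4). Here 16 / c0 yields ln x \<le> 4 w \<le>
    c0/4 w^2 with w^2 \<le> x / r, the 2 yields r \<ge> w, and x0 yields r \<ge> x0. The factor
    (1/4)^\<kappa> in \<open>c\<close> comes from ln r \<ge> ln w = ln x / 4.\<close>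
  define W where "W = max (16 / c0) (max 2 (real x0))"
  define c where "c = c0 / 4 * c1 * (1 / 4) powr \<kappa>"
  have "real (card (smooth_squarefree P x)) \<ge> c * real x / ln (real x) powr (1 - \<kappa>)"
    if "x \<ge> nat \<lceil>W ^ 4\<rceil>" for x
  proof -
    define w where "w = sqrt (sqrt (real x))"
    have W: "W \<ge> 2" "W \<ge> 16 / c0" "W \<ge> real x0" by (auto simp: W_def)
    have "W ^ 4 \<le> real x" using that by linarith
    hence "sqrt (sqrt (W ^ 4)) \<le> w" unfolding w_def by simp
    moreover have "sqrt (sqrt (W ^ 4)) = W"
    proof -
      have "W ^ 4 = (W\<^sup>2)\<^sup>2" by simp
      thus ?thesis using W(1) by (simp only: real_sqrt_abs) simp
    qed
    ultimately have w: "w \<ge> 2" "w \<ge> 16 / c0" "w \<ge> real x0" using W by auto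
    have sx: "sqrt (real x) = w\<^sup>2" "real x = w ^ 4"
    proof -
      show "sqrt (real x) = w\<^sup>2" by (simp add: w_def)
      hence "(sqrt (real x))\<^sup>2 = (w\<^sup>2)\<^sup>2" by simp
      thus "real x = w ^ 4" by simp
    qed
    obtain r where r: "r\<^sup>2 \<le> x" "x < (r + 1)\<^sup>2" by (rule square_bracket)
    have "real x < (real r + 1)\<^sup>2" using r(2) by (metis of_nat_1 of_nat_add of_nat_less_iff of_nat_power)
    hence "sqrt (real x) < real r + 1" by (intro real_less_lsqrt) auto
    hence rw2: "w\<^sup>2 < real r + 1" unfolding sx(1) .
    have "2 * w \<le> w\<^sup>2" using w(1) unfolding power2_eq_square by (intro mult_right_mono) auto
    hence rw: "real r \<ge> w" using rw2 w(1) by linarith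
    have r2: "r \<ge> 2" "x0 \<le> r" using rw w by linarith+
    have "(real r)\<^sup>2 \<le> real x" using r(1) by (metis of_nat_le_iff of_nat_power)
    hence "real r \<le> sqrt (real x)" by (rule real_le_rsqrt)
    hence rle: "real r \<le> w\<^sup>2" unfolding sx(1) .
    have lx: "ln (real x) = 4 * ln w" unfolding sx(2) using w(1) by (simp add: ln_realpow)
    have lnw: "ln w \<ge> 0" using w(1) by simp
    have "ln (real x) \<le> 4 * w" unfolding lx using ln_le_minus_one[of w] w(1) by simp
    also have "4 * w \<le> c0 / 4 * w\<^sup>2"
    proof -
      have "16 \<le> c0 * w" using w(2) c0(1) by (simp add: field_simps)
      hence "16 * w \<le> c0 * w * w" using w(1) by (intro mult_right_mono) auto
      thus ?thesis by (simp add: power2_eq_square)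
    qed
    also have "w\<^sup>2 \<le> real x / real r"
    proof -
      have "w\<^sup>2 * real r \<le> w\<^sup>2 * w\<^sup>2" using rle by (intro mult_left_mono) auto
      also have "\<dots> = real x" unfolding sx(2) by (simp add: power_add[symmetric])
      finally show ?thesis using r2 by (simp add: field_simps)
    qed
    finally have lnx: "ln (real x) \<le> c0 / 4 * (real x / real r)" using c0(1) by simp
    have "r * r \<le> x" using r(1) by (simp add: power2_eq_square)
    from sum_ln_smooth_ge[OF this c0(2) r2(2) c0(1,3) lnx]
    have 1: "(c0 * real x / 4) * (\<Sum>k\<in>smooth_squarefree P r. 1 / real k)
         \<le> (\<Sum>n\<in>smooth_squarefree P x. ln (real n))" .
    have x1: "x \<ge> 2" using \<open>r * r \<le> x\<close> r2(1) by (meson le_trans le_square)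
    have lnpos: "ln (real x) > 0" using x1 by simp
    have "(1 / 4) powr \<kappa> * ln (real x) powr \<kappa> = (ln w) powr \<kappa>"
      using lnw by (simp add: lx powr_mult[symmetric])
    also have "\<dots> \<le> ln (real r) powr \<kappa>"
      using lnw rw w(1) \<kappa> by (intro powr_mono2) auto
    finally have "c1 * ((1 / 4) powr \<kappa> * ln (real x) powr \<kappa>) \<le> c1 * ln (real r) powr \<kappa>"
      using c1(1) by simp
    also have "\<dots> \<le> (\<Sum>k\<in>smooth_squarefree P r. 1 / real k)" by (rule c1(2)[OF r2(1)])
    finally have "(c0 * real x / 4) * (c1 * ((1 / 4) powr \<kappa> * ln (real x) powr \<kappa>))
        \<le> (c0 * real x / 4) * (\<Sum>k\<in>smooth_squarefree P r. 1 / real k)"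
      using c0(1) by (intro mult_left_mono) auto
    also note 1
    also have "(\<Sum>n\<in>smooth_squarefree P x. ln (real n)) \<le> (\<Sum>n\<in>smooth_squarefree P x. ln (real x))"
    proof (rule sum_mono)
      fix n assume n: "n \<in> smooth_squarefree P x"
      hence "n \<le> x" "n > 0" using smooth_squarefree_props(2) by (auto simp: smooth_squarefree_def)
      thus "ln (real n) \<le> ln (real x)" by simp
    qed
    also have "\<dots> = real (card (smooth_squarefree P x)) * ln (real x)" by simp
    finally have 2: "c * real x * ln (real x) powr \<kappa> \<le> real (card (smooth_squarefree P x)) * ln (real x)"
      by (simp add: c_def mult_ac)
    have "ln (real x) powr \<kappa> * ln (real x) powr (1 - \<kappa>) = ln (real x)"
      using lnpos by (simp flip: powr_add)
    hence "c * real x * ln (real x) powr \<kappa>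
        \<le> (real (card (smooth_squarefree P x)) * ln (real x) powr (1 - \<kappa>)) * ln (real x) powr \<kappa>"
      using 2 by (simp add: mult_ac)
    moreover have "ln (real x) powr \<kappa> > 0" using lnpos by simp
    ultimately have "c * real x \<le> real (card (smooth_squarefree P x)) * ln (real x) powr (1 - \<kappa>)"
      by (simp only: mult_le_cancel_right_pos)
    thus ?thesis using lnpos by (simp add: field_simps)
  qed
  moreover have "c > 0" using c0(1) c1(1) by (simp add: c_def)
  ultimately show ?thesis by blast
qed

section \<open>Admissible integers\<close>

lemma not_coprime_nat_obtain_prime:
  fixes a b :: nat
  assumes "\<not> coprime a b"
  obtains p where "prime p" "p dvd a" "p dvd b"
proof -
  have "gcd a b \<noteq> 1" using assms coprime_iff_gcd_eq_1 by metis
  then obtain p where "prime p" "p dvd gcd a b" using prime_factor_nat by blast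
  thus ?thesis using that by auto
qed

lemma coprime_8_iff_odd: "coprime k 8 \<longleftrightarrow> odd (k :: nat)"
proof -
  have "coprime k (2 ^ 3) \<longleftrightarrow> odd k" by (simp only: coprime_power_right_iff coprime_right_2_iff_odd) simp
  thus ?thesis by simp
qed

definition split_primes :: "nat \<Rightarrow> nat set" where
  "split_primes N = {p. prime p \<and> \<not> p dvd 8 * N \<and> (\<exists>s. [s\<^sup>2 = int N] (mod int p))}"

lemma quad_char_split_prime:
  assumes "squarefree N" "prime p" "\<not> p dvd 8 * N"
  shows "quad_char N p = (if p \<in> split_primes N then 1 else -1)"
proof -
  have "p \<noteq> 2" using assms(3) by auto
  hence p2: "p > 2" using prime_ge_2_nat[OF assms(2)] by simp
  have pN: "\<not> p dvd N" using assms(3) by auto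
  hence "\<not> [int N = 0] (mod int p)" by (simp add: cong_0_iff)
  thus ?thesis
    unfolding quad_char_prime[OF assms(1,2) p2 pN] using assms(2,3)
    by (simp add: Legendre_def QuadRes_def split_primes_def)
qed

lemma mertens_density_all: "mertens_density 1 UNIV"
  unfolding mertens_density_def using mertens by auto

text \<open>Outside the primes of 8 N, (1 + \<chi>) / 2 is the indicator of the split primes, so the
  estimate is the mean of those for 1 and for \<chi>.\<close>

lemma mertens_density_split_primes:
  assumes sf: "squarefree N"
  shows "mertens_density (if N = 1 then 1 else 1 / 2) (split_primes N)"
proof -
  define F where "F = {p. p dvd 8 * N}"
  have N0: "N \<noteq> 0" using sf not_squarefree_0 by metis
  hence finF: "finite F" unfolding F_def by (intro finite_divisors_nat) simp
  show ?thesis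
  proof (cases "N = 1")
    case True
    have "\<exists>s. [s\<^sup>2 = int N] (mod int p)" for p using True by (intro exI[of _ 1]) simp
    hence eq: "prime p \<Longrightarrow> p \<in> UNIV - F \<longleftrightarrow> p \<in> split_primes N - F" for p
      by (auto simp: split_primes_def F_def)
    \<comment> \<open>Adding the non-primes makes Q agree with UNIV outside F as a set, as
      \<open>mertens_density_finite_change\<close> requires.\<close>
    define Q where "Q = {p. prime p \<longrightarrow> p \<in> split_primes N}"
    have "mertens_density 1 Q"
      by (rule mertens_density_finite_change[OF mertens_density_all finF])
        (use eq in \<open>auto simp: Q_def\<close>)
    moreover have "prime p \<and> p \<in> Q \<longleftrightarrow> prime p \<and> p \<in> split_primes N" for p
      by (auto simp: Q_def)
    hence "{p. prime p \<and> p \<in> Q \<and> p \<le> n} = {p. prime p \<and> p \<in> split_primes N \<and> p \<le> n}" for n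
      by blast
    ultimately show ?thesis using True unfolding mertens_density_def by simp
  next
    case False
    hence "N > 1" using N0 by simp
    interpret real_character "quad_char N" "8 * N"
      by (rule real_character_quad_char[OF sf \<open>N > 1\<close>])
    define C where "C = (5 * real (8 * N) + 1) / \<bar>L1\<bar> + 6"
    define B where "B = (\<Sum>p | prime p \<and> p \<in> F. ln (real p) / real p)"
    have nn: "prime p \<Longrightarrow> 0 \<le> ln (real p) / real p" for p :: nat
      using prime_ge_1_nat[of p] by simp
    have "\<bar>(\<Sum>p | prime p \<and> p \<in> split_primes N \<and> p \<le> n. ln (real p) / real p)
            - 1 / 2 * ln (real n)\<bar> \<le> C + B + 10" if n: "n \<ge> 1" for n
    proof -
      let ?l = "\<lambda>p. ln (real p) / real p"
      have split: "(\<Sum>p | prime p \<and> p \<le> n. f p) = (\<Sum>p | prime p \<and> p \<le> n \<and> p \<notin> F. f p)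
           + (\<Sum>p | prime p \<and> p \<le> n \<and> p \<in> F. f p)" for f :: "nat \<Rightarrow> real"
        by (subst sum.union_disjoint[symmetric]) (auto intro: sum.cong)
      have ind: "(\<Sum>p | prime p \<and> p \<in> split_primes N \<and> p \<le> n. ?l p)
          = (\<Sum>p | prime p \<and> p \<le> n \<and> p \<notin> F. (1 + quad_char N p) / 2 * ?l p)"
      proof (rule sum.mono_neutral_cong_left)
        show "\<forall>p\<in>{p. prime p \<and> p \<le> n \<and> p \<notin> F} - {p. prime p \<and> p \<in> split_primes N \<and> p \<le> n}.
            (1 + quad_char N p) / 2 * ?l p = 0"
        proof
          fix p assume "p \<in> {p. prime p \<and> p \<le> n \<and> p \<notin> F} - {p. prime p \<and> p \<in> split_primes N \<and> p \<le> n}"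
          hence "p \<notin> split_primes N" "prime p" "\<not> p dvd 8 * N" by (auto simp: F_def)
          thus "(1 + quad_char N p) / 2 * ?l p = 0" using quad_char_split_prime[OF sf, of p] by simp
        qed
        show "?l p = (1 + quad_char N p) / 2 * ?l p"
          if "p \<in> {p. prime p \<and> p \<in> split_primes N \<and> p \<le> n}" for p
          using that quad_char_split_prime[OF sf, of p] by (simp add: split_primes_def)
      qed (auto simp: split_primes_def F_def)
      have "(\<Sum>p | prime p \<and> p \<le> n. (1 + quad_char N p) / 2 * ?l p)
          = 1 / 2 * (\<Sum>p | prime p \<and> p \<le> n. ?l p)
            + 1 / 2 * (\<Sum>p | prime p \<and> p \<le> n. quad_char N p * ln (real p) / real p)"
        unfolding sum_distrib_left sum.distrib[symmetric]
        by (intro sum.cong refl) (simp add: algebra_simps add_divide_distrib)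
      moreover have "\<bar>\<Sum>p | prime p \<and> p \<le> n \<and> p \<in> F. (1 + quad_char N p) / 2 * ?l p\<bar> \<le> B"
      proof -
        have "\<bar>\<Sum>p | prime p \<and> p \<le> n \<and> p \<in> F. (1 + quad_char N p) / 2 * ?l p\<bar>
            \<le> (\<Sum>p | prime p \<and> p \<le> n \<and> p \<in> F. ?l p)"
        proof (rule order_trans[OF sum_abs], rule sum_mono)
          fix p assume "p \<in> {p. prime p \<and> p \<le> n \<and> p \<in> F}"
          hence l: "0 \<le> ?l p" using nn by blast
          have "\<bar>(1 + quad_char N p) / 2\<bar> \<le> 1" using chi_abs_le[of p] by (simp add: abs_le_iff)
          hence "\<bar>(1 + quad_char N p) / 2\<bar> * ?l p \<le> 1 * ?l p" using l by (rule mult_right_mono)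
          thus "\<bar>(1 + quad_char N p) / 2 * ?l p\<bar> \<le> ?l p"
            unfolding abs_mult abs_of_nonneg[OF l] by simp
        qed
        also have "\<dots> \<le> B" unfolding B_def using nn finF by (intro sum_mono2) auto
        finally show ?thesis .
      qed
      moreover note ind split[of "\<lambda>p. (1 + quad_char N p) / 2 * ?l p"] mertens[OF n] chi_mertens[of n]
      ultimately show ?thesis unfolding C_def[symmetric] abs_le_iff by linarith
    qed
    thus ?thesis using False unfolding mertens_density_def by auto
  qed
qed

text \<open>Every prime factor \<open>l\<close> of \<open>N\<^sup>2 + N + 1 = (N + 1)\<^sup>2 - N\<close> has \<open>N\<close> as a quadratic residue.
  The squarefree part of this number represents the residue class needed at the prime 2.\<close>

definition base_num :: "nat \<Rightarrow> nat" where "base_num N = squarefree_part (N\<^sup>2 + N + 1)"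

text \<open>Squares of units are allowed as factors because they affect neither the class modulo 8
  nor being a square modulo a prime of N. The multiplier argument in
  \<open>card_admissible_lower\<close> uses this freedom.\<close>

definition admissible :: "nat \<Rightarrow> nat set" where
  "admissible N = {n. squarefree n \<and> prime_factors n \<subseteq> split_primes N \<and>
     (\<exists>s. coprime s (8 * N) \<and> [n = base_num N * s\<^sup>2] (mod 8 * N))}"

lemma base_num_props:
  assumes "N > 0"
  obtains e where "base_num N * e\<^sup>2 = N\<^sup>2 + N + 1" "coprime e (8 * N)"
    "squarefree (base_num N)" "prime_factors (base_num N) \<subseteq> split_primes N"
proof
  let ?e = "square_part (N\<^sup>2 + N + 1)"
  show eq: "base_num N * ?e\<^sup>2 = N\<^sup>2 + N + 1"
    unfolding base_num_def using squarefree_decompose[of "N\<^sup>2 + N + 1"] by simp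
  have c2: "coprime (N\<^sup>2 + N + 1) 8" unfolding coprime_8_iff_odd by simp
  have "coprime (N\<^sup>2 + N + 1) N"
    by (rule coprimeI) (metis One_nat_def add.commute dvd_add_right_iff dvd_add dvd_mult power2_eq_square)
  with c2 have cop: "coprime (N\<^sup>2 + N + 1) (8 * N)" by simp
  have "?e dvd N\<^sup>2 + N + 1" using eq by (metis dvd_mult dvd_triv_left power2_eq_square)
  thus "coprime ?e (8 * N)" by (rule coprime_divisors[OF _ dvd_refl cop])
  show "squarefree (base_num N)" by (simp add: base_num_def)
  show "prime_factors (base_num N) \<subseteq> split_primes N"
  proof
    fix l assume "l \<in> prime_factors (base_num N)"
    hence l: "prime l" "l dvd base_num N" by auto
    hence ld: "l dvd N\<^sup>2 + N + 1" using eq by (metis dvd_mult2)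
    hence "\<not> l dvd 8 * N" using cop l(1) coprime_common_divisor not_prime_unit by blast
    moreover have "int l dvd (int N + 1)\<^sup>2 - int N"
    proof -
      have "(int N + 1)\<^sup>2 - int N = int (N\<^sup>2 + N + 1)" by (simp add: power2_eq_square algebra_simps)
      thus ?thesis using ld by (simp only: int_dvd_int_iff)
    qed
    hence "[(int N + 1)\<^sup>2 = int N] (mod int l)" by (simp add: cong_iff_dvd_diff)
    ultimately show "l \<in> split_primes N" using l(1) unfolding split_primes_def by blast
  qed
qed

lemma admissible_props:
  assumes sf: "squarefree N" and n: "n \<in> admissible N"
  shows "squarefree (N * n)" "odd n" "[n = N\<^sup>2 + N + 1] (mod 8)"
    "\<And>p. prime p \<Longrightarrow> p dvd n \<Longrightarrow> \<exists>s. [s\<^sup>2 = int N] (mod int p)"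
    "\<And>p. prime p \<Longrightarrow> p dvd N \<Longrightarrow> \<exists>s. [s\<^sup>2 = int n] (mod int p)"
proof -
  have N0: "N > 0" using sf not_squarefree_0 by (metis neq0_conv)
  have sfn: "squarefree n" and pf: "prime_factors n \<subseteq> split_primes N"
    using n by (auto simp: admissible_def)
  have n0: "n > 0" using sfn not_squarefree_0 by (metis neq0_conv)
  obtain s where s: "coprime s (8 * N)" "[n = base_num N * s\<^sup>2] (mod 8 * N)"
    using n by (auto simp: admissible_def)
  obtain e where e: "base_num N * e\<^sup>2 = N\<^sup>2 + N + 1" "coprime e (8 * N)"
    using base_num_props[OF N0] by blast
  have spl: "p \<in> split_primes N" if "prime p" "p dvd n" for p
    using that pf n0 by (auto simp: prime_factors_dvd)
  thus "\<exists>s. [s\<^sup>2 = int N] (mod int p)" if "prime p" "p dvd n" for p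
    using that by (auto simp: split_primes_def)
  have cop: "coprime n (8 * N)"
  proof (rule ccontr)
    assume "\<not> coprime n (8 * N)"
    then obtain p where "prime p" "p dvd n" "p dvd 8 * N" by (rule not_coprime_nat_obtain_prime)
    thus False using spl[of p] by (auto simp: split_primes_def)
  qed
  have "coprime N n" using cop by (metis coprime_commute coprime_mult_right_iff)
  thus "squarefree (N * n)" using sf sfn by (intro squarefree_mult_coprime)
  have "coprime n 8" "coprime s 8" "coprime e 8" using cop s(1) e(2) by auto
  hence odd: "odd n" "odd s" "odd e" unfolding coprime_8_iff_odd by blast+
  thus "odd n" by simp
  have sq8: "[k\<^sup>2 = 1] (mod 8)" if "odd k" for k :: nat
    using odd_square_mod_8[of "int k"] that by (metis cong_int_iff even_of_nat of_nat_1 of_nat_numeral of_nat_power)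
  have "[n = base_num N * s\<^sup>2] (mod 8)" using s(2) by (rule cong_modulus_mult_nat)
  also have "[base_num N * s\<^sup>2 = base_num N * 1] (mod 8)" by (intro cong_mult sq8 odd) auto
  also have "[base_num N * 1 = base_num N * e\<^sup>2] (mod 8)" by (intro cong_mult cong_sym[OF sq8] odd) auto
  finally show "[n = N\<^sup>2 + N + 1] (mod 8)" unfolding e(1) .
  show "\<exists>s. [s\<^sup>2 = int n] (mod int p)" if p: "prime p" "p dvd N" for p
  proof -
    have "p dvd 8 * N" using p by simp
    hence np: "[n = base_num N * s\<^sup>2] (mod p)" using s(2) cong_dvd_modulus_nat by blast
    have "p dvd N\<^sup>2 + N" using p(2) by (simp add: power2_eq_square)
    \<comment> \<open>Multiplying by this 1 completes the residue of n to the square of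
      \<open>base_num N * s * e\<close>.\<close>
    hence "[base_num N * e\<^sup>2 = 1] (mod p)" unfolding e(1)
      by (metis add.commute cong_add_lcancel_0_nat cong_0_iff)
    hence "[base_num N * s\<^sup>2 * (base_num N * e\<^sup>2) = base_num N * s\<^sup>2 * 1] (mod p)"
      by (intro cong_mult cong_refl)
    moreover have "base_num N * s\<^sup>2 * (base_num N * e\<^sup>2) = (base_num N * s * e)\<^sup>2"
      by (simp add: power2_eq_square mult_ac)
    ultimately have "[(base_num N * s * e)\<^sup>2 = base_num N * s\<^sup>2] (mod p)" by simp
    hence "[(base_num N * s * e)\<^sup>2 = n] (mod p)" using cong_sym[OF np] by (rule cong_trans)
    hence "[int ((base_num N * s * e)\<^sup>2) = int n] (mod int p)" by (simp only: cong_int_iff)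
    thus ?thesis by (metis of_nat_power)
  qed
qed

lemma admissible_curve:
  assumes D: "good D" "sgn D = eps D" and n: "n \<in> admissible (nat \<bar>D\<bar>)"
  shows "\<exists>E. ell_curve_over (quad_field (- (\<bar>D\<bar> * int n))) E \<and>
             everywhere_good_reduction (quad_field (- (\<bar>D\<bar> * int n))) E \<and> j_inv E \<in> \<rat>"
proof -
  define N where "N = nat \<bar>D\<bar>"
  have N: "int N = \<bar>D\<bar>" by (simp add: N_def)
  have sfD: "squarefree D" using D(1) by (simp add: good_def)
  hence "squarefree (int N)" unfolding N by (cases "D \<ge> 0") auto
  hence sf: "squarefree N" by (simp only: squarefree_int_iff)
  obtain A t where At: "A \<in> setR" "D * t\<^sup>2 = A ^ 3 - 1728" using D(1) by (auto simp: good_def)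
  note props = admissible_props[OF sf n[folded N_def]]
  obtain x0 y0 z0 where xyz0: "z0 \<noteq> 0" "int N * x0\<^sup>2 + int n * y0\<^sup>2 = z0\<^sup>2"
    using legendre_ternary[OF props(1) props(4,5)] by blast
  have "squarefree (int (N * n))" using props(1) by (simp only: squarefree_int_iff)
  hence sfi: "squarefree (int N * int n)" by simp
  obtain x y z where xyz: "int N * x\<^sup>2 + int n * y\<^sup>2 = z\<^sup>2" "coprime z (2 * int N * x)" "z \<noteq> 0"
    using conic_odd_solution[OF sfi _ xyz0(2,1)] props(2) by (metis even_of_nat)
  have "[int n = int (N\<^sup>2 + N + 1)] (mod int 8)" using props(3) by (simp only: cong_int_iff)
  hence n8: "[int n = int N ^ 2 + int N + 1] (mod 8)" by (simp add: add_ac)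
  show ?thesis
  proof (cases "odd D")
    case True
    have "int N mod 4 = 1"
    proof (cases "D mod 4 = 1")
      case True
      thus ?thesis using D(2) N by (simp add: eps_def sgn_if split: if_splits)
    next
      case False
      hence "D < 0" using D(2) by (simp add: eps_def sgn_if split: if_splits)
      thus ?thesis using False \<open>odd D\<close> N by presburger
    qed
    hence N4: "[int N = 1] (mod 4)" by (simp add: cong_def)
    have "[int n = int N ^ 2 + int N + 1] (mod 4)" by (rule cong_dvd_modulus[OF n8]) simp
    also have "[int N ^ 2 + int N + 1 = 1 ^ 2 + 1 + 1] (mod 4)" by (intro cong_add cong_pow N4 cong_refl)
    finally have "int n mod 4 = 3" by (simp add: cong_def)
    from egr_curve_odd[OF sfD At D(2) N xyz True this] show ?thesis unfolding N .
  next
    case False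
    then obtain k where "N = 2 * k" using N by (metis dvd_abs_iff even_of_nat dvdE)
    moreover have "odd k"
      using sf squarefree_mult_imp_coprime[of 2 k] unfolding \<open>N = 2 * k\<close> by simp
    ultimately obtain l where l: "N = 2 * (2 * l + 1)" by (metis oddE)
    \<comment> \<open>For N = 2 modulo 4 the class N^2 + N + 1 agrees with 1 - N modulo 8, as the
      ramified model demands.\<close>
    have "int N ^ 2 + int N + 1 - (1 - int N) = 8 * (2 * int l ^ 2 + 3 * int l + 1)"
      unfolding l by (simp add: power2_eq_square algebra_simps)
    hence "[int N ^ 2 + int N + 1 = 1 - int N] (mod 8)"
      unfolding cong_iff_dvd_diff by (metis dvd_triv_left)
    with n8 have n8': "[int n = 1 - int N] (mod 8)" by (rule cong_trans)
    from False have "even D" by simp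
    from egr_curve_even[OF sfD At D(2) N xyz this n8'] show ?thesis unfolding N .
  qed
qed

lemma I_count_ge_admissible:
  assumes D: "good D" "sgn D = eps D"
  shows "card {n \<in> admissible (nat \<bar>D\<bar>). real n \<le> X} \<le> I_count D X"
proof -
  define N where "N = nat \<bar>D\<bar>"
  have N: "int N = \<bar>D\<bar>" by (simp add: N_def)
  have sfD: "squarefree D" using D(1) by (simp add: good_def)
  hence "D \<noteq> 0" by auto
  have "squarefree (int N)" using sfD unfolding N by (cases "D \<ge> 0") auto
  hence sf: "squarefree N" by (simp only: squarefree_int_iff)
  let ?I = "{q::int. real_of_int \<bar>q\<bar> \<le> X \<and> squarefree (D * q) \<and> D * q < 0 \<and>
      (\<exists>E. ell_curve_over (quad_field (D * q)) E \<and>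
           everywhere_good_reduction (quad_field (D * q)) E \<and> j_inv E \<in> \<rat>)}"
  let ?f = "\<lambda>n. - sgn D * int n"
  \<comment> \<open>An infinite set would have \<open>card\<close> 0, so finiteness matters for a
    lower bound.\<close>
  have "finite ?I"
    by (rule finite_subset[of _ "{- \<lfloor>X\<rfloor>..\<lfloor>X\<rfloor>}"]) (auto simp: le_floor_iff minus_le_iff abs_le_iff)
  moreover have "?f ` {n \<in> admissible N. real n \<le> X} \<subseteq> ?I"
  proof clarify
    fix n assume n: "n \<in> admissible N" "real n \<le> X"
    have Dq: "D * ?f n = - (\<bar>D\<bar> * int n)" by (simp add: abs_sgn mult.assoc)
    have sfn: "squarefree (N * n)" using admissible_props(1)[OF sf n(1)] .
    hence "squarefree (int (N * n))" by (simp only: squarefree_int_iff)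
    hence sfq: "squarefree (- (\<bar>D\<bar> * int n))" unfolding squarefree_minus by (simp add: N)
    have "n \<noteq> 0" using sfn by (metis mult_0_right not_squarefree_0)
    hence "- (\<bar>D\<bar> * int n) < 0" using \<open>D \<noteq> 0\<close> by simp
    moreover have "\<bar>?f n\<bar> = int n" using \<open>D \<noteq> 0\<close> by (simp add: abs_mult)
    ultimately show "real_of_int \<bar>?f n\<bar> \<le> X \<and> squarefree (D * ?f n) \<and> D * ?f n < 0 \<and>
      (\<exists>E. ell_curve_over (quad_field (D * ?f n)) E \<and>
           everywhere_good_reduction (quad_field (D * ?f n)) E \<and> j_inv E \<in> \<rat>)"
      unfolding Dq using admissible_curve[OF D n(1)[unfolded N_def]] sfq n(2) by simp
  qed
  moreover have "inj_on ?f {n \<in> admissible N. real n \<le> X}"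
    using \<open>D \<noteq> 0\<close> by (auto simp: inj_on_def sgn_if)
  ultimately have "card {n \<in> admissible N. real n \<le> X} \<le> card ?I"
    using card_inj_on_le by blast
  thus ?thesis by (simp add: I_count_def N_def)
qed

text \<open>Multiplying \<open>n\<close> by a fixed representative of its own residue class produces a square class, so
  that no theorem on primes in progressions is needed to hit the admissible residue classes.\<close>

lemma card_admissible_lower:
  assumes sf: "squarefree N" and \<kappa>: "\<kappa> = (if N = 1 then 1 else 1 / 2)"
  shows "\<exists>c>0. \<exists>B\<ge>1. \<exists>X0. \<forall>x\<ge>X0.
           c * real x / ln (real x) powr (1 - \<kappa>) \<le> real (card {n \<in> admissible N. n \<le> B * x})"
proof -
  have N0: "N > 0" using sf not_squarefree_0 by (metis neq0_conv)
  define b where "b = base_num N"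
  have b: "squarefree b" "prime_factors b \<subseteq> split_primes N"
    using base_num_props[OF N0] unfolding b_def by metis+
  have b0: "b > 0" using b(1) not_squarefree_0 by (metis neq0_conv)
  define Q where "Q = split_primes N - prime_factors b"
  \<comment> \<open>Avoiding the primes of b keeps the representative coprime to b. It has the
    stated properties for every class met by a squarefree number over Q, the only classes to which
    they are applied.\<close>
  define rep where "rep = (\<lambda>a. SOME m. squarefree m \<and> prime_factors m \<subseteq> Q \<and> m mod (8 * N) = a)"
  have rep: "squarefree (rep (n mod (8 * N)))" "prime_factors (rep (n mod (8 * N))) \<subseteq> Q"
    "rep (n mod (8 * N)) mod (8 * N) = n mod (8 * N)"
    if "squarefree n" "prime_factors n \<subseteq> Q" for n
    using someI[of "\<lambda>m. squarefree m \<and> prime_factors m \<subseteq> Q \<and> m mod (8 * N) = n mod (8 * N)" n] that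
    unfolding rep_def by auto
  \<comment> \<open>Finitely many primes; removing them makes n coprime to its multiplier and
    preserves the density.\<close>
  define F where "F = prime_factors b \<union> (\<Union>a<8 * N. prime_factors (rep a))"
  have finF: "finite F" by (simp add: F_def)
  define Q' where "Q' = split_primes N - F"
  have Q': "Q' \<subseteq> Q" by (auto simp: Q'_def Q_def F_def)
  have mQ': "mertens_density \<kappa> Q'"
    unfolding \<kappa> by (rule mertens_density_finite_change[OF mertens_density_split_primes[OF sf] finF])
      (auto simp: Q'_def)
  define B where "B = b * (1 + (\<Sum>a<8 * N. rep a))"
  \<comment> \<open>The representative is congruent to n, so h n is b n^2 modulo 8 N: the admissible
    class with s = n.\<close>
  define h where "h = (\<lambda>n. n * rep (n mod (8 * N)) * b)"
  have pfc: "coprime u v" if "squarefree u" "\<And>p. p \<in> prime_factors u \<Longrightarrow> p \<notin> prime_factors v" "v \<noteq> 0"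
    for u v :: nat
  proof (rule ccontr)
    assume "\<not> coprime u v"
    then obtain p where "prime p" "p dvd u" "p dvd v" by (rule not_coprime_nat_obtain_prime)
    moreover have "u \<noteq> 0" using that(1) not_squarefree_0 by metis
    ultimately show False using that(2)[of p] that(3) by (auto simp: prime_factors_dvd)
  qed
  have h: "h n \<in> admissible N" "h n \<le> B * x" "rep (n mod (8 * N)) > 0"
    if n: "n \<in> smooth_squarefree Q' x" for n x
  proof -
    define r where "r = rep (n mod (8 * N))"
    have n': "squarefree n" "prime_factors n \<subseteq> Q'" "n \<le> x" "n > 0"
      using n smooth_squarefree_props(2)[OF n] by (auto simp: smooth_squarefree_def)
    have r: "squarefree r" "prime_factors r \<subseteq> Q" "r mod (8 * N) = n mod (8 * N)"
      unfolding r_def using rep[of n] n' Q' by auto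
    have r0: "r \<noteq> 0" using r(1) not_squarefree_0 by metis
    thus "rep (n mod (8 * N)) > 0" by (simp add: r_def)
    have nm: "n mod (8 * N) < 8 * N" using N0 by simp
    have "coprime n r" using n' r0 nm unfolding r_def
      by (intro pfc) (auto simp: Q'_def F_def)
    moreover have "coprime (n * r) b"
    proof -
      have "coprime n b" using n' b0 by (intro pfc) (auto simp: Q'_def F_def)
      moreover have "coprime r b" using r b0 by (intro pfc) (auto simp: Q_def)
      ultimately show ?thesis by simp
    qed
    ultimately have "squarefree (n * r * b)"
      using n'(1) r(1) b(1) by (intro squarefree_mult_coprime)
    moreover have "prime_factors (n * r * b) \<subseteq> split_primes N"
    proof
      fix p assume "p \<in> prime_factors (n * r * b)"
      hence p: "prime p" "p dvd n * r * b" by auto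
      hence "p dvd n \<or> p dvd r \<or> p dvd b" by (simp add: prime_dvd_mult_iff)
      hence "p \<in> prime_factors n \<or> p \<in> prime_factors r \<or> p \<in> prime_factors b"
        using p(1) n'(4) r0 b0 by (auto simp: prime_factors_dvd)
      thus "p \<in> split_primes N" using n'(2) r(2) b(2) Q' by (auto simp: Q_def)
    qed
    moreover have "coprime n (8 * N)"
    proof (rule pfc[OF n'(1)])
      fix p assume "p \<in> prime_factors n"
      hence "p \<in> split_primes N" using n'(2) by (auto simp: Q'_def)
      thus "p \<notin> prime_factors (8 * N)" by (auto simp: split_primes_def)
    qed (use N0 in simp)
    moreover have "[n * r * b = base_num N * n\<^sup>2] (mod 8 * N)"
    proof -
      have "[r = n] (mod 8 * N)" using r(3) by (simp add: cong_def)
      hence "[n * r * b = n * n * b] (mod 8 * N)" by (intro cong_mult cong_refl)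
      thus ?thesis by (simp add: b_def power2_eq_square mult_ac)
    qed
    ultimately show "h n \<in> admissible N"
      unfolding admissible_def h_def r_def[symmetric] by blast
    have "r \<le> (\<Sum>a<8 * N. rep a)" unfolding r_def using nm by (intro member_le_sum) auto
    hence "n * r * b \<le> x * (1 + (\<Sum>a<8 * N. rep a)) * b"
      using n'(3) by (intro mult_le_mono) auto
    also have "x * (1 + (\<Sum>a<8 * N. rep a)) * b = B * x" unfolding B_def by (simp only: mult_ac)
    finally show "h n \<le> B * x" unfolding h_def r_def[symmetric] .
  qed
  \<comment> \<open>h becomes injective once paired with the residue of n, which determines the
    multiplier. This costs the factor 8 N.\<close>
  have card_le: "card (smooth_squarefree Q' x) \<le> card {n \<in> admissible N. n \<le> B * x} * (8 * N)" for x
  proof -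
    have "finite {n \<in> admissible N. n \<le> B * x}" by (rule finite_subset[of _ "{..B * x}"]) auto
    moreover have "inj_on (\<lambda>n. (h n, n mod (8 * N))) (smooth_squarefree Q' x)"
    proof (rule inj_onI)
      fix m n assume mn: "m \<in> smooth_squarefree Q' x" "n \<in> smooth_squarefree Q' x"
        "(h m, m mod (8 * N)) = (h n, n mod (8 * N))"
      hence "m mod (8 * N) = n mod (8 * N)" "h m = h n" by simp_all
      hence "m * rep (n mod (8 * N)) * b = n * rep (n mod (8 * N)) * b" by (simp only: h_def)
      thus "m = n" using h(3)[OF mn(2)] b0 by simp
    qed
    moreover have "(\<lambda>n. (h n, n mod (8 * N))) ` smooth_squarefree Q' x
        \<subseteq> {n \<in> admissible N. n \<le> B * x} \<times> {..<8 * N}"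
      using h(1,2) N0 by auto
    ultimately have "card (smooth_squarefree Q' x) \<le> card ({n \<in> admissible N. n \<le> B * x} \<times> {..<8 * N})"
      by (intro card_inj_on_le) auto
    thus ?thesis by (simp add: card_cartesian_product)
  qed
  have "0 < \<kappa>" "\<kappa> \<le> 1" by (auto simp: \<kappa>)
  then obtain c X0 where c: "c > 0" "\<And>x. x \<ge> X0 \<Longrightarrow>
      real (card (smooth_squarefree Q' x)) \<ge> c * real x / ln (real x) powr (1 - \<kappa>)"
    using card_smooth_squarefree_lower[OF _ _ mQ'] by blast
  have "(c / real (8 * N)) * real x / ln (real x) powr (1 - \<kappa>) \<le> real (card {n \<in> admissible N. n \<le> B * x})"
    if "x \<ge> X0" for x
  proof -
    have "c * real x / ln (real x) powr (1 - \<kappa>) \<le> real (card (smooth_squarefree Q' x))"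
      by (rule c(2)[OF that])
    also have "\<dots> \<le> real (card {n \<in> admissible N. n \<le> B * x} * (8 * N))"
      using card_le[of x] by (simp only: of_nat_le_iff)
    finally have "c * real x / ln (real x) powr (1 - \<kappa>)
        \<le> real (card {n \<in> admissible N. n \<le> B * x}) * real (8 * N)" by (simp only: of_nat_mult)
    hence "c * real x / ln (real x) powr (1 - \<kappa>) / real (8 * N) \<le> real (card {n \<in> admissible N. n \<le> B * x})"
      using N0 by (subst pos_divide_le_eq) auto
    thus ?thesis by (simp add: mult.commute)
  qed
  moreover have "B \<ge> 1" using b0 by (simp add: B_def)
  moreover have "c / real (8 * N) > 0" using c(1) N0 by simp
  ultimately show ?thesis by blast
qed

theorem theorem1p6:
  fixes D :: int
  assumes "good D"
    and "sgn D = eps D"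
  shows "\<exists>c>0. \<forall>\<^sub>F X in at_top.
           real (I_count D X) \<ge>
             c * X / (ln X) powr (1 - 1 / 2 ^ card (prime_factors D))"
proof -
  define N where "N = nat \<bar>D\<bar>"
  have N: "int N = \<bar>D\<bar>" by (simp add: N_def)
  have sfD: "squarefree D" using assms(1) by (simp add: good_def)
  hence "D \<noteq> 0" by auto
  have "squarefree (int N)" using sfD unfolding N by (cases "D \<ge> 0") auto
  hence sf: "squarefree N" by (simp only: squarefree_int_iff)
  define \<kappa> :: real where "\<kappa> = (if N = 1 then 1 else 1 / 2)"
  define \<delta> :: real where "\<delta> = 1 - 1 / 2 ^ card (prime_factors D)"
  have k: "0 \<le> 1 - \<kappa>" "1 - \<kappa> \<le> \<delta>"
  proof -
    show "0 \<le> 1 - \<kappa>" by (simp add: \<kappa>_def)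
    show "1 - \<kappa> \<le> \<delta>"
    proof (cases "N = 1")
      case True
      thus ?thesis by (simp add: \<kappa>_def \<delta>_def)
    next
      case False
      hence "\<not> is_unit D" using N by auto
      then obtain p where "p dvd D" "prime p" using prime_divisor_exists[OF \<open>D \<noteq> 0\<close>] by blast
      hence "p \<in> prime_factors D" using \<open>D \<noteq> 0\<close> by (simp add: prime_factors_dvd)
      hence "card (prime_factors D) \<noteq> 0" by auto
      hence "card (prime_factors D) \<ge> 1" by linarith
      hence "(2 :: real) ^ 1 \<le> 2 ^ card (prime_factors D)" by (intro power_increasing) auto
      hence "1 / 2 ^ card (prime_factors D) \<le> 1 / (2 :: real)" by (intro divide_left_mono) auto
      thus ?thesis using False by (simp add: \<kappa>_def \<delta>_def)
    qed
  qed
  obtain c B X0 where c: "c > 0" "B \<ge> 1" and low: "\<And>x. x \<ge> X0 \<Longrightarrow>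
      c * real x / ln (real x) powr (1 - \<kappa>) \<le> real (card {n \<in> admissible N. n \<le> B * x})"
    using card_admissible_lower[OF sf \<kappa>_def] by blast
  have "real (I_count D X) \<ge> c / (2 * real B) * X / ln X powr \<delta>"
    if X: "X \<ge> real B * (real X0 + 3)" "X \<ge> exp 1" for X
  proof -
    \<comment> \<open>The threshold X0 + 3 for X / B gives x \<ge> X0, x \<ge> 2 and x \<ge> X / (2
      B). The threshold exp 1 gives ln X \<ge> 1, so that passing from the exponent 1 - \<kappa> to
      \<delta> can only increase the power.\<close>
    define x where "x = nat \<lfloor>X / real B\<rfloor>"
    have "X / real B \<ge> real X0 + 3" using X(1) c(2) by (simp add: field_simps)
    moreover from this have xr: "real x \<le> X / real B" "X / real B < real x + 1"
      unfolding x_def by linarith+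
    ultimately have x: "x \<ge> X0" "x \<ge> 2" "real x \<ge> X / (2 * real B)" by simp_all
    have Bx: "real B * real x \<le> X" using xr(1) c(2) by (simp add: field_simps)
    have "X > 0" using X(2) exp_gt_zero[of 1] by linarith
    have lX: "ln X \<ge> 1" using X(2) \<open>X > 0\<close> by (simp add: ln_ge_iff)
    have "real x \<le> real B * real x" using c(2) mult_right_mono[of 1 "real B" "real x"] by simp
    hence "real x \<le> X" using Bx by linarith
    hence lx: "0 < ln (real x)" "ln (real x) \<le> ln X" using x by auto
    have "ln (real x) powr (1 - \<kappa>) \<le> ln X powr (1 - \<kappa>)" using lx k by (intro powr_mono2) auto
    also have "\<dots> \<le> ln X powr \<delta>" using k lX by (intro powr_mono) auto
    finally have pw: "ln (real x) powr (1 - \<kappa>) \<le> ln X powr \<delta>" .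
    have "c / (2 * real B) * X / ln X powr \<delta> = c * (X / (2 * real B)) / ln X powr \<delta>" by simp
    also have "\<dots> \<le> c * real x / ln (real x) powr (1 - \<kappa>)"
      using c x lx pw \<open>X > 0\<close> by (intro frac_le mult_left_mono) auto
    also have "\<dots> \<le> real (card {n \<in> admissible N. n \<le> B * x})" by (rule low[OF x(1)])
    also have "\<dots> \<le> real (card {n \<in> admissible N. real n \<le> X})"
    proof -
      have "finite {n \<in> admissible N. real n \<le> X}"
        by (rule finite_subset[of _ "{..nat \<lfloor>X\<rfloor>}"]) (auto simp: le_nat_floor)
      moreover have "{n \<in> admissible N. n \<le> B * x} \<subseteq> {n \<in> admissible N. real n \<le> X}"
      proof clarify
        fix n assume "n \<le> B * x"
        hence "real n \<le> real B * real x" by (metis of_nat_le_iff of_nat_mult)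
        thus "real n \<le> X" using Bx by linarith
      qed
      ultimately show ?thesis by (simp add: card_mono)
    qed
    also have "\<dots> \<le> real (I_count D X)"
      using I_count_ge_admissible[OF assms, of X] by (simp add: N_def)
    finally show ?thesis .
  qed
  hence "\<forall>\<^sub>F X in at_top. real (I_count D X) \<ge> c / (2 * real B) * X / ln X powr \<delta>"
    by (intro eventually_at_top_linorderI[of "max (real B * (real X0 + 3)) (exp 1)"]) auto
  moreover have "c / (2 * real B) > 0" using c by simp
  ultimately show ?thesis unfolding \<delta>_def by blast
qed

end
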